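(* Let $p$ be an odd prime, let $m=2s$ and $l$ be positive integers with $l\neq s$ and $0\le l\le m-1$, and put $q=p^m$, $d=\gcd(s,l)$, $d'=\gcd(s+l,2l)$. Let $${\overline{\mathbb{C}^\bot}}^\bot=\Big\{\big(Tr_s(ax^{p^s+1})+Tr_m(bx^{p^l+1}+cx)+h\big)_{x\in\mathbb{F}_q} : a\in\mathbb{F}_{p^s},\ b,c\in\mathbb{F}_q,\ h\in\mathbb{F}_p\Big\}.$$ Then for $m\geq 4$ the code ${\overline{\mathbb{C}^\bot}}^\bot$ over $\mathbb{F}_p$ has length $p^m$ and dimension $\frac{5m}{2}+1$, and its weight distribution is given by the following tables. (Each item is "weight: multiplicity".) (1) If $d'=d$ is odd: - $0$: $1$; - $(p-1)(p^{m-1}-p^{s-1})$: $\dfrac{p^{m+d}(p^s+1)(p^m-1)}{2(p^d+1)}$; - $p^{m-1}(p-1)+p^{s-1}$: $\dfrac{p^{m+d}(p-1)(p^s+1)(p^m-1)}{2(p^d+1)}$; - $(p-1)(p^{m-1}+p^{s-1})$: $\dfrac{p^{m+d}(p^m-2p^{m-d}+1)(p^s-1)}{2(p^d-1)}$; - $p^{m-1}(p-1)-p^{s-1}$: $\dfrac{p^{m+d}(p-1)(p^m-2p^{m-d}+1)(p^s-1)}{2(p^d-1)}$; - for each of the two choices of sign, $p^{m-1}(p-1)\pm(-1)^{\frac{p-1}{2}}p^{s+\frac{d-1}{2}}$: $\frac12 p^{3s-2d}(p-1)(p^m-1)$; - $p^{s+d-1}(p-1)(p^{s-d}+1)$: $\dfrac{p^{m-2d}(p^{s-d}-1)(p^m-1)}{p^{2d}-1}$;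 - $p^{m-1}(p-1)-p^{s+d-1}$: $\dfrac{p^{m-2d}(p-1)(p^{s-d}-1)(p^m-1)}{p^{2d}-1}$; - $p^{m-1}(p-1)$: $p\,(p^{3s-d}-p^{3s-2d}+p^{3s-2d-1}+p^{3s-3d}-p^{m-2d}+1)(p^m-1)$; - $p^m$: $p-1$. (2) If $d'=d$ is even: - $0$: $1$; - $p^{s-1}(p-1)(p^s-1)$: $\dfrac{p^{m+d}(p^s+1)(p^m-1)}{2(p^d+1)}$; - $p^{s-1}(p^{s+1}-p^s+1)$: $\dfrac{p^{m+d}(p-1)(p^s+1)(p^m-1)}{2(p^d+1)}$; - $p^{s-1}(p-1)(p^s+1)$: $\dfrac{p^{s+d-1}(p^m-2p^{m-d}+1)(p^s+1)(p^{s+1}-2p+2)}{2(p^d-1)}$; - $p^{s-1}(p^{s+1}-p^s-1)$: $\dfrac{p^{s+d-1}(p-1)(p^m-2p^{m-d}+1)(p^s+1)(p^{s+1}-2p+2)}{2(p^d-1)}$; - for each of the two choices of sign, $p^{s+\frac d2-1}(p-1)(p^{s-\frac d2}\pm1)$: $\frac12p^{3s-2d}(p^m-1)$; - for each of the two choices of sign, $p^{s+\frac d2-1}(p^{s-\frac d2+1}-p^{s-\frac d2}\pm1)$: $\frac12p^{3s-2d}(p-1)(p^m-1)$; - $p^{s+d-1}(p-1)(p^{s-d}+1)$: $\dfrac{p^{m-2d}(p^{s-d}-1)(p^m-1)}{p^{2d}-1}$; - $p^{s+d-1}(p^{s-d+1}-p^{s-d}-1)$: $\dfrac{p^{m-2d}(p-1)(p^{s-d}-1)(p^m-1)}{p^{2d}-1}$;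 - $p^{m-1}(p-1)$: $p\,(p^{3s-d}-p^{3s-2d}+p^{3s-3d}-p^{m-2d}+1)(p^m-1)$; - $p^m$: $p-1$. (3) If $d'=2d$: - $0$: $1$; - $p^{s-1}(p-1)(p^s+1)$: $\dfrac{p^{m+3d}(p^m-p^{m-2d}-p^{m-3d}+p^s-p^{s-d}+1)(p^s-1)}{(p^d+1)(p^{2d}-1)}$; - $p^{s-1}(p^{s+1}-p^s-1)$: $\dfrac{p^{m+3d}(p-1)(p^m-p^{m-2d}-p^{m-3d}+p^s-p^{s-d}+1)(p^s-1)}{(p^d+1)(p^{2d}-1)}$; - $p^{s+d-1}(p-1)(p^{s-d}-1)$: $\dfrac{p^{m-d}(p^s+p^{s-d}+p^{s-2d}+1)(p^m-1)}{(p^d+1)^2}$; - $p^{s+d-1}(p^{s-d+1}-p^{s-d}+1)$: $\dfrac{p^{m-d}(p-1)(p^s+p^{s-d}+p^{s-2d}+1)(p^m-1)}{(p^d+1)^2}$; - $p^{s+2d-1}(p-1)(p^{s-2d}+1)$: $\dfrac{p^{m-4d}(p^{s-d}-1)(p^m-1)}{(p^d+1)(p^{2d}-1)}$; - $p^{s+2d-1}(p^{s-2d+1}-p^{s-2d}-1)$: $\dfrac{p^{m-4d}(p-1)(p^{s-d}-1)(p^m-1)}{(p^d+1)(p^{2d}-1)}$; - $p^{m-1}(p-1)$: $p\,(p^{3s-d}-p^{3s-2d}+p^{3s-3d}-p^{3s-4d}+p^{3s-5d}+p^{m-d}-2p^{m-2d}+p^{m-3d}-p^{m-4d}+1)(p^m-1)$;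 - $p^m$: $p-1$.
   Context: For a positive integer $r$, $Tr_r(x)=x+x^p+\cdots+x^{p^{r-1}}$ is the absolute trace from $\mathbb{F}_{p^r}$ onto $\mathbb{F}_p$. The weight distribution of a code of length $n$ is the sequence of numbers $A_i$ ($0\le i\le n$) of codewords of Hamming weight $i$. The notation ${\overline{\mathbb{C}^\bot}}^\bot$ indicates that the code is the dual of the extended code of the dual of the non-binary Kasami cyclic code $\mathbb{C}$, the cyclic code of length $q-1$ over $\mathbb{F}_p$ with parity-check polynomial $h_1(x)h_{p^s+1}(x)h_{p^l+1}(x)$, where $h_j$ is the minimal polynomial over $\mathbb{F}_p$ of $\alpha^j$ and $\alpha$ is a primitive element of $\mathbb{F}_q$.
   Formalization: In table (2), for the weights p^{s-1}(p-1)(p^s+1) and p^{s-1}(p^{s+1}-p^s-1), the factor p^{s+d-1}(p^s+1)(p^{s+1}-2p+2) of the multiplicity is replaced by p^{m+d}(p^s-1); as printed, the multiplicities do not sum to p^{5m/2+1}. *)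

theory Defs
  imports "HOL-Analysis.Cartesian_Space" "Berlekamp_Zassenhaus.Finite_Field"
begin

text \<open>
  The prime field with p = CARD('p) elements is the type 'p mod_ring, and the field with q
  elements is an arbitrary finite field type 'a. Words whose coordinates are indexed by the
  elements of 'a are the vectors of type ('p mod_ring, 'a) vec.
\<close>

text \<open>The inclusion of the prime field; a ring homomorphism when CHAR('a) = CARD('p).\<close>

definition Fp_incl :: "'p::prime_card mod_ring \<Rightarrow> 'a::field" where
  "Fp_incl t = of_int (to_int_mod_ring t)"

definition subfield_of_order :: "nat \<Rightarrow> 'a::field set" where
  "subfield_of_order n = {x. x ^ n = x}"

text \<open>
  The absolute trace with values in the prime field. It is used only on arguments in the subfield
  with p^r elements, where the sum does lie in the image of the prime field.
\<close>

definition abs_trace :: "nat \<Rightarrow> 'a::field \<Rightarrow> 'p::prime_card mod_ring" where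
  "abs_trace r x = (THE t. Fp_incl t = (\<Sum>i<r. x ^ (CARD('p) ^ i)))"

definition kasami_word ::
  "nat \<Rightarrow> nat \<Rightarrow> 'a \<Rightarrow> 'a \<Rightarrow> 'a \<Rightarrow> 'p mod_ring \<Rightarrow> 'p::prime_card mod_ring ^ 'a::{field,finite}" where
  "kasami_word s l a b c h =
     (\<chi> x. abs_trace s (a * x ^ (CARD('p) ^ s + 1))
         + abs_trace (2 * s) (b * x ^ (CARD('p) ^ l + 1) + c * x) + h)"

definition kasami_code :: "nat \<Rightarrow> nat \<Rightarrow> ('p::prime_card mod_ring ^ 'a::{field,finite}) set" where
  "kasami_code s l =
     {kasami_word s l a b c h | a b c h. a \<in> subfield_of_order (CARD('p) ^ s)}"

definition code_length :: "('f ^ 'n::finite) set \<Rightarrow> nat" where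
  "code_length C = CARD('n)"

definition hamming_weight :: "'f::zero ^ 'n::finite \<Rightarrow> nat" where
  "hamming_weight v = card {i. v $ i \<noteq> 0}"

definition weight_count :: "('f::zero ^ 'n::finite) set \<Rightarrow> nat \<Rightarrow> nat" where
  "weight_count C i = card {v \<in> C. hamming_weight v = i}"

text \<open>
  A table is a list of pairs (weight, multiplicity). For special parameters distinct rows can have
  the same weight (then the multiplicities add up) or multiplicity 0. The second conjunct of
  has_weight_distribution ensures that no row is ignored because its weight is not one of
  0, ..., n.
\<close>

definition table_count :: "(real \<times> real) list \<Rightarrow> real \<Rightarrow> real" where
  "table_count T w = (\<Sum>(w', k) \<leftarrow> T. if w' = w then k else 0)"

definition has_weight_distribution ::
  "('f::zero ^ 'n::finite) set \<Rightarrow> (real \<times> real) list \<Rightarrow> bool" where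
  "has_weight_distribution C T \<longleftrightarrow>
     (\<forall>i \<le> code_length C. real (weight_count C i) = table_count T (real i)) \<and>
     (\<forall>w. w \<notin> real ` {0..code_length C} \<longrightarrow> table_count T w = 0)"

text \<open>
  In the following tables the base P is real, and the exponents are natural numbers. No
  subtraction in an exponent is truncated: d divides s and s \<ge> 2, and d' = 2d forces
  3d \<le> s. The divisions d div 2, (d - 1) div 2 and (p - 1) div 2 are exact where they are used.
\<close>

definition table_d_odd :: "nat \<Rightarrow> nat \<Rightarrow> nat \<Rightarrow> nat \<Rightarrow> (real \<times> real) list" where
  "table_d_odd p m s d = (let P = real p in
    [(0, 1),
     ((P - 1) * (P^(m-1) - P^(s-1)),
        P^(m+d) * (P^s + 1) * (P^m - 1) / (2 * (P^d + 1))),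
     (P^(m-1) * (P - 1) + P^(s-1),
        P^(m+d) * (P - 1) * (P^s + 1) * (P^m - 1) / (2 * (P^d + 1))),
     ((P - 1) * (P^(m-1) + P^(s-1)),
        P^(m+d) * (P^m - 2 * P^(m-d) + 1) * (P^s - 1) / (2 * (P^d - 1))),
     (P^(m-1) * (P - 1) - P^(s-1),
        P^(m+d) * (P - 1) * (P^m - 2 * P^(m-d) + 1) * (P^s - 1) / (2 * (P^d - 1))),
     (P^(m-1) * (P - 1) + (-1)^((p-1) div 2) * P^(s + (d-1) div 2),
        1/2 * P^(3 * s - 2 * d) * (P - 1) * (P^m - 1)),
     (P^(m-1) * (P - 1) - (-1)^((p-1) div 2) * P^(s + (d-1) div 2),
        1/2 * P^(3 * s - 2 * d) * (P - 1) * (P^m - 1)),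
     (P^(s+d-1) * (P - 1) * (P^(s-d) + 1),
        P^(m - 2 * d) * (P^(s-d) - 1) * (P^m - 1) / (P^(2 * d) - 1)),
     (P^(m-1) * (P - 1) - P^(s+d-1),
        P^(m - 2 * d) * (P - 1) * (P^(s-d) - 1) * (P^m - 1) / (P^(2 * d) - 1)),
     (P^(m-1) * (P - 1),
        P * (P^(3 * s - d) - P^(3 * s - 2 * d) + P^(3 * s - 2 * d - 1) + P^(3 * s - 3 * d) - P^(m - 2 * d) + 1)
          * (P^m - 1)),
     (P^m, P - 1)])"

text \<open>
  The fourth and fifth rows of the next table correct a misprint. In print, their multiplicities
  have the factor p^(s+d-1) (p^s + 1) (p^(s+1) - 2p + 2) where p^(m+d) (p^s - 1) stands here (and
  in the odd case). The printed multiplicities do not add up to the number p^(5m/2+1) of codewords;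
  for p = 3, s = 2, l = 0 they add up to 181683 instead of 177147.
\<close>

definition table_d_even :: "nat \<Rightarrow> nat \<Rightarrow> nat \<Rightarrow> nat \<Rightarrow> (real \<times> real) list" where
  "table_d_even p m s d = (let P = real p in
    [(0, 1),
     (P^(s-1) * (P - 1) * (P^s - 1),
        P^(m+d) * (P^s + 1) * (P^m - 1) / (2 * (P^d + 1))),
     (P^(s-1) * (P^(s+1) - P^s + 1),
        P^(m+d) * (P - 1) * (P^s + 1) * (P^m - 1) / (2 * (P^d + 1))),
     (P^(s-1) * (P - 1) * (P^s + 1),
        P^(m+d) * (P^m - 2 * P^(m-d) + 1) * (P^s - 1) / (2 * (P^d - 1))),
     (P^(s-1) * (P^(s+1) - P^s - 1),
        P^(m+d) * (P - 1) * (P^m - 2 * P^(m-d) + 1) * (P^s - 1) / (2 * (P^d - 1))),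
     (P^(s + d div 2 - 1) * (P - 1) * (P^(s - d div 2) + 1),
        1/2 * P^(3 * s - 2 * d) * (P^m - 1)),
     (P^(s + d div 2 - 1) * (P - 1) * (P^(s - d div 2) - 1),
        1/2 * P^(3 * s - 2 * d) * (P^m - 1)),
     (P^(s + d div 2 - 1) * (P^(s - d div 2 + 1) - P^(s - d div 2) + 1),
        1/2 * P^(3 * s - 2 * d) * (P - 1) * (P^m - 1)),
     (P^(s + d div 2 - 1) * (P^(s - d div 2 + 1) - P^(s - d div 2) - 1),
        1/2 * P^(3 * s - 2 * d) * (P - 1) * (P^m - 1)),
     (P^(s+d-1) * (P - 1) * (P^(s-d) + 1),
        P^(m - 2 * d) * (P^(s-d) - 1) * (P^m - 1) / (P^(2 * d) - 1)),
     (P^(s+d-1) * (P^(s-d+1) - P^(s-d) - 1),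
        P^(m - 2 * d) * (P - 1) * (P^(s-d) - 1) * (P^m - 1) / (P^(2 * d) - 1)),
     (P^(m-1) * (P - 1),
        P * (P^(3 * s - d) - P^(3 * s - 2 * d) + P^(3 * s - 3 * d) - P^(m - 2 * d) + 1) * (P^m - 1)),
     (P^m, P - 1)])"

definition table_2d :: "nat \<Rightarrow> nat \<Rightarrow> nat \<Rightarrow> nat \<Rightarrow> (real \<times> real) list" where
  "table_2d p m s d = (let P = real p in
    [(0, 1),
     (P^(s-1) * (P - 1) * (P^s + 1),
        P^(m + 3 * d) * (P^m - P^(m - 2 * d) - P^(m - 3 * d) + P^s - P^(s-d) + 1) * (P^s - 1)
          / ((P^d + 1) * (P^(2 * d) - 1))),
     (P^(s-1) * (P^(s+1) - P^s - 1),
        P^(m + 3 * d) * (P - 1) * (P^m - P^(m - 2 * d) - P^(m - 3 * d) + P^s - P^(s-d) + 1) * (P^s - 1)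
          / ((P^d + 1) * (P^(2 * d) - 1))),
     (P^(s+d-1) * (P - 1) * (P^(s-d) - 1),
        P^(m-d) * (P^s + P^(s-d) + P^(s - 2 * d) + 1) * (P^m - 1) / (P^d + 1)^2),
     (P^(s+d-1) * (P^(s-d+1) - P^(s-d) + 1),
        P^(m-d) * (P - 1) * (P^s + P^(s-d) + P^(s - 2 * d) + 1) * (P^m - 1) / (P^d + 1)^2),
     (P^(s + 2 * d - 1) * (P - 1) * (P^(s - 2 * d) + 1),
        P^(m - 4 * d) * (P^(s-d) - 1) * (P^m - 1) / ((P^d + 1) * (P^(2 * d) - 1))),
     (P^(s + 2 * d - 1) * (P^(s - 2 * d + 1) - P^(s - 2 * d) - 1),
        P^(m - 4 * d) * (P - 1) * (P^(s-d) - 1) * (P^m - 1) / ((P^d + 1) * (P^(2 * d) - 1))),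
     (P^(m-1) * (P - 1),
        P * (P^(3 * s - d) - P^(3 * s - 2 * d) + P^(3 * s - 3 * d) - P^(3 * s - 4 * d) + P^(3 * s - 5 * d)
             + P^(m-d) - 2 * P^(m - 2 * d) + P^(m - 3 * d) - P^(m - 4 * d) + 1) * (P^m - 1)),
     (P^m, P - 1)])"

end

theory Submission
  imports Defs "HOL-Analysis.Complex_Transcendental"
begin

text \<open>
  Let Q be the quadratic form of the pair (a, b) and S its exponential sum. Since the square of the
  absolute value of S is the order q times the order of the radical, the numbers of solutions of
  Q(x) = t satisfy an equation x^2 + p y^2 = p^M, and descent leaves only a sign to be determined.
  A pair (c, h) contributes a word of non-generic weight only if c is orthogonal to the radical,
  and then completing the square gives its weight. It remains to count the pairs (a, b) by the
  order of the radical and the sign of S. Scaling x moves any nonzero radical element to 1.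

  If d' = d, then 1 is in the radical of (a, b) exactly if b lies in the field F with p^s elements
  and a = -(b + b'), where b' is the inverse Frobenius twist of b. On the decomposition of x into
  its symmetric and antisymmetric part under x^(p^s), the form is then a difference of two forms
  Tr(b y^2), and S becomes -p^s times a one-variable Gauss sum over the field with p^d elements.
  So the incidence moments of radical and S are explicit.

  If d' = 2d, the radical is a vector space over the field with p^(2d) elements of dimension at
  most 2. The group of elements of norm 1 of this field preserves the form and acts freely on
  nonzero vectors, which gives S modulo p^d + 1 and hence its sign. The number of pairs, the sum
  of S and the number of incidences then determine the three unknown multiplicities.
\<close>

subsection \<open>Finite fields\<close>

text \<open>The forms are never diagonalised and no quadratic Gauss sum is evaluated. In odd rank
  the sign stays unknown, and this is harmless: squares and nonsquares are equally many and h runs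
  through the whole prime field, so exchanging the two classes changes no count. In even rank the
  sign matters, but only the sum of S over all pairs with a given radical order is needed, since it
  fixes how many pairs have each sign. Weighting by the radical order minus 1 makes a moment an
  incidence count over nonzero x; as scaling moves x to 1, it is q - 1 times a sum over the pairs
  whose radical contains 1. For d' = d three such moments are explicit, with weights 1, radical
  order and S. For d' = 2d the pairs with 1 in the radical are no longer given by b in F, because
  nonzero elements negated by both Frobenius maps exist; only the first moment is used there. Rows
  of equal weight need no case distinction: table and count are compared for every real w as linear
  combinations of indicators, which leaves rational identities in p, p^d and a power such as
  p^(s-d).\<close>

lemma power_card_minus_one_eq_one:
  fixes x :: "'a::{field,finite}"
  assumes "x \<noteq> 0"
  shows "x ^ (CARD('a) - 1) = 1"
proof -
  let ?U = "UNIV - {0 :: 'a}"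
  have bij: "bij_betw ((*) x) ?U ?U"
    by (rule bij_betwI[where g = "\<lambda>y. y / x"]) (use assms in auto)
  have "(\<Prod>y\<in>?U. y) = (\<Prod>y\<in>?U. x * y)"
    using prod.reindex_bij_betw[OF bij, of "\<lambda>y. y"] by simp
  also have "\<dots> = x ^ card ?U * (\<Prod>y\<in>?U. y)"
    by (simp add: prod.distrib)
  finally have "x ^ card ?U = 1"
    by simp
  moreover have "card ?U = CARD('a) - 1"
    by (subst card_Diff_singleton) auto
  ultimately show ?thesis by simp
qed

lemma minus_one_dvd_power_minus_one:
  fixes x :: nat
  shows "x - 1 dvd x ^ n - 1"
proof (cases "x = 0")
  case False
  show ?thesis
  proof (induction n)
    case (Suc n)
    have "x ^ Suc n - 1 = x * (x ^ n - 1) + (x - 1)"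
      using False by (simp add: diff_mult_distrib2)
    thus ?case using Suc by (metis dvd_add dvd_mult dvd_refl)
  qed simp
qed (simp add: power_0_left)

lemma card_power_eq_le:
  fixes c :: "'a::{idom,finite}"
  assumes "k > 0"
  shows "card {x. x ^ k = c} \<le> k"
proof -
  let ?P = "monom 1 k - [:c:] :: 'a poly"
  have "coeff ?P k = 1" using assms by (cases k) auto
  hence "?P \<noteq> 0" by (metis coeff_0 zero_neq_one)
  hence "card {x. poly ?P x = 0} \<le> degree ?P" by (rule card_poly_roots_bound)
  also have "degree ?P \<le> k"
    by (rule degree_diff_le) (auto intro: degree_monom_le)
  finally show ?thesis by (simp add: poly_monom)
qed

text \<open>Small fibres force a large image. Together with an easy inclusion this later shows that
  the image of an additive map is a full annihilator.\<close>

lemma card_le_mult_card_image: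
  assumes "finite A" "\<And>y. y \<in> f ` A \<Longrightarrow> card {x \<in> A. f x = y} \<le> k"
  shows "card A \<le> k * card (f ` A)"
proof -
  have "card A = (\<Sum>x\<in>A. 1)" by simp
  also have "\<dots> = (\<Sum>y\<in>f ` A. \<Sum>x\<in>{x \<in> A. f x = y}. 1)"
    by (rule sum.group[symmetric]) (use assms in auto)
  also have "\<dots> \<le> (\<Sum>y\<in>f ` A. k)"
    by (rule sum_mono) (use assms in auto)
  finally show ?thesis by (simp add: mult.commute)
qed

text \<open>Replaces the cyclicity of the multiplicative group: with k n =
  \<open>CARD('a) - 1\<close> the n-th power map sends nonzero elements to k-th roots of unity, its
  fibres have at most n elements, so at least k roots are hit.\<close>

lemma card_power_eq_one:
  assumes "k dvd CARD('a::{field,finite}) - 1"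
  shows "card {x::'a. x ^ k = 1} = k"
proof (rule antisym)
  obtain n where n: "CARD('a) - 1 = k * n" using assms by auto
  have "card {0, 1 :: 'a} \<le> CARD('a)" by (rule card_mono) auto
  hence "CARD('a) > 1" by simp
  hence "k * n > 0" using n by linarith
  hence k: "k > 0" and n0: "n > 0" by auto
  show "card {x::'a. x ^ k = 1} \<le> k" using card_power_eq_le[OF k] .
  let ?U = "UNIV - {0 :: 'a}"
  have "card ?U \<le> n * card ((\<lambda>x. x ^ n) ` ?U)"
  proof (rule card_le_mult_card_image)
    fix y :: 'a
    have "card {x \<in> ?U. x ^ n = y} \<le> card {x. x ^ n = y}"
      by (rule card_mono) auto
    also have "\<dots> \<le> n" using card_power_eq_le[OF n0] .
    finally show "card {x \<in> ?U. x ^ n = y} \<le> n" .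
  qed auto
  also have "(\<lambda>x. x ^ n) ` ?U \<subseteq> {x. x ^ k = 1}"
  proof safe
    fix x :: 'a assume "x \<noteq> 0"
    from power_card_minus_one_eq_one[OF this] show "(x ^ n) ^ k = 1"
      by (metis n power_mult mult.commute)
  qed
  hence "card ((\<lambda>x. x ^ n) ` ?U) \<le> card {x::'a. x ^ k = 1}" by (intro card_mono) auto
  hence "n * card ((\<lambda>x. x ^ n) ` ?U) \<le> n * card {x::'a. x ^ k = 1}" by simp
  finally have "k * n \<le> n * card {x::'a. x ^ k = 1}"
    using n by (simp add: card_Diff_singleton)
  thus "k \<le> card {x::'a. x ^ k = 1}" using n0 by (simp add: mult.commute)
qed

text \<open>The \<open>itself\<close> arguments pin down the types of the two fields; p, m and q
  stay variables, so that powers of p are handled by plain arithmetic.\<close>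

locale finite_extension =
  fixes m p q :: nat and base :: "'p::prime_card itself" and ext :: "'a::{field,finite} itself"
  assumes p_card: "p = CARD('p)" and q_card: "q = CARD('a)" and q_eq: "q = p ^ m" and m_pos: "m > 0"
begin

abbreviation incl :: "'p mod_ring \<Rightarrow> 'a" where "incl \<equiv> Fp_incl"
abbreviation tr :: "nat \<Rightarrow> 'a \<Rightarrow> 'p mod_ring" where "tr \<equiv> abs_trace"

text \<open>The exponent is a natural number, so an inverse is written \<open>fr (m - k)\<close>.
  Being additive and multiplicative, \<open>fr\<close> turns the monomials x^(p^k+1) of the code
  into products of x and \<open>fr k x\<close>.\<close>

definition fr :: "nat \<Rightarrow> 'a \<Rightarrow> 'a" where "fr k x = x ^ (p ^ k)"

definition Fix :: "nat \<Rightarrow> 'a set" where "Fix k = {x. fr k x = x}"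

lemma prime_p: "prime p" using prime_card[where ?'a = 'p] p_card by simp

lemma p_gt_1: "p > 1" using prime_p prime_gt_1_nat by blast

lemma char_ext: "CHAR('a) = p"
proof -
  have "CHAR('a) dvd p ^ m" using CHAR_dvd_CARD[where 'a = 'a] q_eq q_card by simp
  moreover have "prime CHAR('a)"
    by (intro prime_CHAR_semidom finite_imp_CHAR_pos) simp
  ultimately show ?thesis
    using prime_p prime_dvd_power primes_dvd_imp_eq by blast
qed

lemma fr_0 [simp]: "fr k 0 = 0" and fr_1 [simp]: "fr k 1 = 1"
  and fr_mult [simp]: "fr k (x * y) = fr k x * fr k y"
  and fr_divide [simp]: "fr k (x / y) = fr k x / fr k y"
  and fr_power: "fr k (x ^ n) = fr k x ^ n"
  and fr_zero_exp [simp]: "fr 0 x = x"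
  using p_gt_1 by (auto simp: fr_def power_mult_distrib power_divide power_mult[symmetric] mult.commute)

lemma fr_add [simp]: "fr k (x + y) = fr k x + fr k y"
  using freshmans_dream'[of "p ^ k" k x y] prime_p char_ext by (simp add: fr_def)

lemma fr_minus [simp]: "fr k (- x) = - fr k x"
  using fr_add[of k x "-x"] by (simp add: eq_neg_iff_add_eq_0 add.commute)

lemma fr_diff [simp]: "fr k (x - y) = fr k x - fr k y"
  using fr_add[of k x "-y"] by simp

lemma fr_sum: "fr k (sum f A) = (\<Sum>i\<in>A. fr k (f i))"
  by (induction A rule: infinite_finite_induct) auto

lemma fr_of_int [simp]: "fr k (of_int n) = of_int n"
proof -
  have "fr k (of_nat n) = of_nat n" for n
    by (induction n) auto
  thus ?thesis by (cases n) (auto simp del: of_nat_Suc)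
qed

lemma fr_numeral [simp]: "fr k (numeral n) = numeral n"
  using fr_of_int[of k "numeral n"] by simp

lemma fr_fr: "fr i (fr j x) = fr (i + j) x"
  by (simp add: fr_def power_mult[symmetric] power_add mult.commute)

lemma fr_eq_0_iff [simp]: "fr k x = 0 \<longleftrightarrow> x = 0"
  using p_gt_1 by (simp add: fr_def)

lemma fr_eq_iff [simp]: "fr k x = fr k y \<longleftrightarrow> x = y"
  using fr_eq_0_iff[of k "x - y"] by (simp del: fr_eq_0_iff)

lemma fr_m [simp]: "fr m x = x"
proof (cases "x = 0")
  case False
  have "fr m x = x ^ (CARD('a) - 1) * x"
    using q_card q_eq p_gt_1 by (simp add: fr_def power_Suc2[symmetric] del: power_Suc)
  thus ?thesis using power_card_minus_one_eq_one[OF False] by simp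
qed auto

lemma fr_mult_fix: "fr k x = x \<Longrightarrow> fr (k * n) x = x"
  by (induction n) (auto simp: fr_fr[symmetric])

text \<open>Euclid's algorithm on the exponents: i = i mod j + j (i div j), and the second part acts
  trivially on an element fixed by \<open>fr j\<close>.\<close>

lemma fr_gcd_fix: "fr i x = x \<Longrightarrow> fr j x = x \<Longrightarrow> fr (gcd i j) x = x"
proof (induction i j rule: gcd_nat_induct)
  case (step i j)
  have "fr (i mod j) x = fr (i mod j) (fr (j * (i div j)) x)"
    using step by (simp add: fr_mult_fix)
  also have "\<dots> = fr i x" by (simp add: fr_fr)
  finally have "fr (i mod j) x = x" using step by simp
  hence "fr (gcd j (i mod j)) x = x" using step by simp
  thus ?case by (simp add: gcd_red_nat[of i j])
qed auto

lemma Fix_iff: "x \<in> Fix k \<longleftrightarrow> fr k x = x" by (simp add: Fix_def)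

lemma Fix_dvd: "k dvd n \<Longrightarrow> Fix k \<subseteq> Fix n"
  by (auto simp: Fix_iff fr_mult_fix)

text \<open>As \<open>fr m\<close> is the identity, an exponent may be reduced to a divisor of m.
  This is applied to s + l, whose fixed field separates the two cases.\<close>

lemma Fix_eq_gcd: "Fix k = Fix (gcd k m)"
proof
  show "Fix k \<subseteq> Fix (gcd k m)" by (auto simp: Fix_iff intro!: fr_gcd_fix)
qed (rule Fix_dvd, simp)

text \<open>The fixed field is 0 together with the (p^k - 1)-th roots of unity, and p^k - 1 divides
  q - 1 because k divides m.\<close>

lemma card_Fix:
  assumes "k dvd m"
  shows "card (Fix k) = p ^ k"
proof -
  obtain n where n: "m = k * n" using assms by auto
  have k: "k > 0" using m_pos n by simp
  have pk: "p ^ k > 1" using p_gt_1 k by (metis one_less_power)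
  have "(p ^ k - 1) dvd ((p ^ k) ^ n - 1)"
    by (rule minus_one_dvd_power_minus_one)
  hence "(p ^ k - 1) dvd CARD('a) - 1"
    by (simp add: q_card[symmetric] q_eq n power_mult)
  from card_power_eq_one[OF this] have c: "card {x::'a. x ^ (p ^ k - 1) = 1} = p ^ k - 1" .
  have "fr k x = x \<longleftrightarrow> x = 0 \<or> x ^ (p ^ k - 1) = 1" for x
  proof -
    have "Suc (p ^ k - 1) = p ^ k" using pk by linarith
    hence "fr k x = x ^ (p ^ k - 1) * x"
      by (metis fr_def power_Suc2)
    thus ?thesis by auto
  qed
  hence "Fix k = insert 0 {x. x ^ (p ^ k - 1) = 1}" by (auto simp: Fix_def)
  thus ?thesis using c pk by (simp add: power_0_left)
qed

lemma Fix_0 [simp, intro]: "0 \<in> Fix k" and Fix_1 [simp, intro]: "1 \<in> Fix k"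
  and Fix_add [intro]: "x \<in> Fix k \<Longrightarrow> y \<in> Fix k \<Longrightarrow> x + y \<in> Fix k"
  and Fix_diff [intro]: "x \<in> Fix k \<Longrightarrow> y \<in> Fix k \<Longrightarrow> x - y \<in> Fix k"
  and Fix_mult [intro]: "x \<in> Fix k \<Longrightarrow> y \<in> Fix k \<Longrightarrow> x * y \<in> Fix k"
  and Fix_divide [intro]: "x \<in> Fix k \<Longrightarrow> y \<in> Fix k \<Longrightarrow> x / y \<in> Fix k"
  and Fix_minus [intro]: "x \<in> Fix k \<Longrightarrow> - x \<in> Fix k"
  and Fix_fr [intro]: "x \<in> Fix k \<Longrightarrow> fr i x \<in> Fix k"
  and Fix_numeral [intro, simp]: "numeral n \<in> Fix k"
  and Fix_power [intro]: "x \<in> Fix k \<Longrightarrow> x ^ j \<in> Fix k"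
  by (auto simp: Fix_iff fr_fr fr_power add.commute[of k]) (simp add: fr_fr[symmetric])

lemma Fix_m [simp, intro]: "x \<in> Fix m" by (simp add: Fix_iff)

subsection \<open>The prime field and the trace\<close>

lemma incl_0 [simp]: "incl 0 = 0" and incl_1 [simp]: "incl 1 = 1"
  and incl_add [simp]: "incl (t + u) = incl t + incl u"
  and incl_mult [simp]: "incl (t * u) = incl t * incl u"
  using of_int_mod_CHAR[where 'a = 'a, unfolded char_ext p_card]
  by (auto simp: Fp_incl_def p_card to_int_mod_ring_add to_int_mod_ring_mult simp flip: of_int_add of_int_mult)

lemma incl_eq_0_iff [simp]: "incl t = 0 \<longleftrightarrow> t = 0"
proof
  assume *: "incl t = 0"
  show "t = 0"
  proof (rule ccontr)
    assume "t \<noteq> 0"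
    hence "incl t * incl (1 / t) = 1" by (simp flip: incl_mult)
    thus False using * by simp
  qed
qed simp

lemma incl_minus [simp]: "incl (- t) = - incl t"
  using incl_add[of t "-t"] by (simp add: eq_neg_iff_add_eq_0 add.commute del: incl_add)

lemma incl_diff [simp]: "incl (t - u) = incl t - incl u"
  using incl_add[of t "-u"] by simp

lemma incl_eq_iff [simp]: "incl t = incl u \<longleftrightarrow> t = u"
  using incl_eq_0_iff[of "t - u"] by (simp del: incl_eq_0_iff)

lemma fr_incl [simp]: "fr k (incl t) = incl t"
  by (simp add: Fp_incl_def)

lemma incl_in_Fix [simp, intro]: "incl t \<in> Fix k"
  by (simp add: Fix_iff)

lemma range_incl: "range incl = Fix 1"
proof (rule card_seteq)
  show "card (Fix 1) \<le> card (range incl)"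
    by (subst card_image) (auto simp: card_Fix inj_def p_card[symmetric])
qed (auto)

text \<open>Gives the \<open>THE\<close> in \<open>abs_trace\<close> its meaning: on
  \<open>Fix r\<close> the sum is invariant under the Frobenius, hence a prime field element, and
  \<open>incl\<close> is injective.\<close>

lemma incl_tr:
  assumes "x \<in> Fix r"
  shows "incl (tr r x) = (\<Sum>i<r. fr i x)"
proof -
  have "fr 1 (\<Sum>i<r. fr i x) = (\<Sum>i<r. fr (Suc i) x)"
    by (simp add: fr_sum fr_fr)
  also have "\<dots> = (\<Sum>i<Suc r. fr i x) - x"
    by (subst sum.lessThan_Suc_shift) simp
  also have "\<dots> = (\<Sum>i<r. fr i x)"
    using assms by (simp add: Fix_iff)
  finally have "(\<Sum>i<r. fr i x) \<in> range incl"
    by (simp add: range_incl Fix_iff)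
  then obtain t where t: "incl t = (\<Sum>i<r. fr i x)" by auto
  have "tr r x = t"
    unfolding abs_trace_def using t by (intro the_equality) (auto simp: fr_def p_card[symmetric] simp flip: incl_eq_iff)
  thus ?thesis using t by simp
qed

lemma tr_eqI:
  assumes "x \<in> Fix r" "incl t = (\<Sum>i<r. fr i x)"
  shows "tr r x = t"
  using incl_tr[OF assms(1)] assms(2) by (metis incl_eq_iff)

lemma tr_add: "x \<in> Fix r \<Longrightarrow> y \<in> Fix r \<Longrightarrow> tr r (x + y) = tr r x + tr r y"
  by (intro tr_eqI) (auto simp: incl_tr sum.distrib)

lemma tr_0 [simp]: "tr r 0 = 0"
  by (intro tr_eqI) auto

lemma tr_scale: "x \<in> Fix r \<Longrightarrow> tr r (incl t * x) = t * tr r x"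
  by (intro tr_eqI) (auto simp: incl_tr sum_distrib_left)

lemma tr_minus: "x \<in> Fix r \<Longrightarrow> tr r (- x) = - tr r x"
  by (intro tr_eqI) (auto simp: incl_tr sum_negf)

lemma tr_diff: "x \<in> Fix r \<Longrightarrow> y \<in> Fix r \<Longrightarrow> tr r (x - y) = tr r x - tr r y"
  using tr_add[of x r "- y"] by (auto simp: tr_minus)

lemma tr_fr:
  assumes "x \<in> Fix r"
  shows "tr r (fr k x) = tr r x"
proof (induction k)
  case (Suc k)
  let ?y = "fr k x"
  have y: "?y \<in> Fix r" using assms by auto
  have "(\<Sum>i<r. fr i (fr 1 ?y)) = (\<Sum>i<r. fr (Suc i) ?y)" by (simp add: fr_fr)
  also have "\<dots> = (\<Sum>i<Suc r. fr i ?y) - ?y"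
    by (subst sum.lessThan_Suc_shift) simp
  also have "\<dots> = (\<Sum>i<r. fr i ?y)" using y by (simp add: Fix_iff)
  finally have "tr r (fr 1 ?y) = tr r ?y"
    by (intro tr_eqI) (use y in \<open>auto simp: incl_tr\<close>)
  thus ?case using Suc by (simp add: fr_fr)
qed auto

text \<open>Transitivity of the trace in degree 2; it brings both traces of the code down to the
  field with p^s elements.\<close>

lemma tr_double:
  assumes "x \<in> Fix (2 * r)"
  shows "tr (2 * r) x = tr r (x + fr r x)"
proof (rule tr_eqI)
  have "fr r (fr r x) = x" using assms by (simp add: fr_fr Fix_iff mult_2)
  hence "x + fr r x \<in> Fix r" by (simp add: Fix_iff)
  from incl_tr[OF this] have "incl (tr r (x + fr r x)) = (\<Sum>i<r. fr i x) + (\<Sum>i<r. fr (i + r) x)"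
    by (simp add: sum.distrib fr_fr)
  also have "(\<Sum>i<r. fr (i + r) x) = (\<Sum>i=r..<2*r. fr i x)"
    using sum.shift_bounds_nat_ivl[of "\<lambda>i. fr i x" 0 r r] by (simp add: lessThan_atLeast0 mult_2)
  also have "(\<Sum>i<r. fr i x) + \<dots> = (\<Sum>i<2*r. fr i x)"
    unfolding lessThan_atLeast0 by (rule sum.atLeastLessThan_concat) auto
  finally show "incl (tr r (x + fr r x)) = (\<Sum>i<2*r. fr i x)" .
qed fact

text \<open>As a polynomial the trace has degree at most p^(r-1), so it has fewer zeros than the p^r
  elements of \<open>Fix r\<close>; it is nonzero since its coefficient at X is 1.\<close>

lemma tr_nonzero:
  assumes "r dvd m"
  shows "\<exists>x\<in>Fix r. tr r x \<noteq> 0"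
proof (rule ccontr)
  assume *: "\<not> ?thesis"
  have r: "r > 0" using assms m_pos by (auto intro: Nat.gr0I)
  let ?P = "\<Sum>i<r. monom 1 (p ^ i) :: 'a poly"
  have "poly ?P x = 0" if "x \<in> Fix r" for x
    using * incl_tr[OF that] that by (simp add: poly_sum poly_monom fr_def)
  hence "Fix r \<subseteq> {x. poly ?P x = 0}" by auto
  hence "p ^ r \<le> card {x. poly ?P x = 0}"
    using card_mono[of "{x. poly ?P x = 0}" "Fix r"] assms by (simp add: card_Fix)
  moreover have "coeff ?P 1 = (\<Sum>i<r. if i = 0 then 1 else 0)"
    using p_gt_1 by (auto simp: coeff_sum intro!: sum.cong)
  hence "coeff ?P 1 = 1" using r by simp
  hence "?P \<noteq> 0" by auto
  hence "card {x. poly ?P x = 0} \<le> degree ?P" by (rule card_poly_roots_bound)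
  moreover have "degree ?P \<le> p ^ (r - 1)"
    using p_gt_1 by (intro degree_sum_le) (auto intro!: order.trans[OF degree_monom_le] power_increasing)
  moreover have "p ^ (r - 1) < p ^ r"
    using p_gt_1 r by (intro power_strict_increasing) auto
  ultimately show False by simp
qed

lemma tr_nondegenerate:
  assumes "r dvd m" "x \<in> Fix r" "\<And>y. y \<in> Fix r \<Longrightarrow> tr r (x * y) = 0"
  shows "x = 0"
proof (rule ccontr)
  assume x: "x \<noteq> 0"
  obtain z where z: "z \<in> Fix r" "tr r z \<noteq> 0" using tr_nonzero[OF assms(1)] by auto
  have "tr r (x * (z / x)) = 0" using assms z by (intro assms(3)) auto
  thus False using x z by simp
qed

subsection \<open>Additive characters\<close>

definition psi :: "'p mod_ring \<Rightarrow> complex" where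
  "psi t = cis (2 * pi * of_int (to_int_mod_ring t) / of_nat p)"

lemma psi_eq_cis:
  assumes "[n = to_int_mod_ring t] (mod int p)"
  shows "psi t = cis (2 * pi * of_int n / of_nat p)"
proof -
  obtain k where k: "n = to_int_mod_ring t + int p * k"
    using assms by (metis cong_iff_lin cong_sym)
  have "2 * pi * of_int n / of_nat p = 2 * pi * of_int (to_int_mod_ring t) / of_nat p + 2 * pi * of_int k"
    using p_gt_1 by (simp add: k field_simps)
  thus ?thesis unfolding psi_def by (simp add: cis_mult[symmetric])
qed

lemma psi_0 [simp]: "psi 0 = 1" by (simp add: psi_def)

lemma psi_add: "psi (t + u) = psi t * psi u"
proof -
  have "psi (t + u) = cis (2 * pi * of_int (to_int_mod_ring t + to_int_mod_ring u) / of_nat p)"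
    by (rule psi_eq_cis) (simp add: to_int_mod_ring_add cong_def p_card)
  thus ?thesis by (simp add: psi_def cis_mult ring_distribs add_divide_distrib)
qed

lemma norm_psi [simp]: "norm (psi t) = 1" by (simp add: psi_def)

lemma psi_minus: "psi (- t) = cnj (psi t)"
proof -
  have "psi (- t) * psi t = 1" by (simp flip: psi_add)
  moreover have "psi t * cnj (psi t) = 1"
    by (metis complex_norm_square norm_psi of_real_1 one_power2)
  ultimately show ?thesis
    by (metis mult.assoc mult.commute mult_1)
qed

lemma psi_diff: "psi (t - u) = psi t * cnj (psi u)"
  using psi_add[of t "-u"] by (simp add: psi_minus)

lemma psi_eq_1_iff: "psi t = 1 \<longleftrightarrow> t = 0"
proof
  assume "psi t = 1"
  then obtain n :: int where n: "2 * pi * of_int (to_int_mod_ring t) / of_nat p = 2 * pi * of_int n"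
    unfolding psi_def by (metis cis_conv_exp cos_one_2pi_int cis.sel(1) one_complex.sel(1) mult.commute mult.assoc)
  hence "real_of_int (to_int_mod_ring t) = real_of_int (n * int p)"
    using p_gt_1 by (simp add: field_simps)
  hence e: "to_int_mod_ring t = n * int p" by linarith
  moreover have "to_int_mod_ring t \<in> {0..<int p}"
    using range_to_int_mod_ring[where 'a = 'p] p_card by (metis rangeI)
  ultimately have "n * int p \<ge> 0" "n * int p < 1 * int p" by auto
  hence "n \<ge> 0" "n < 1" using p_gt_1 by (auto simp: zero_le_mult_iff mult_less_cancel_right)
  hence "to_int_mod_ring t = 0" using e by auto
  thus "t = 0" by (metis of_int_mod_ring_to_int_mod_ring of_int_mod_ring.abs_eq mod_0 zero_mod_ring_def)
qed simp

text \<open>Orthogonality of characters, for subgroups because it is applied to subfields, to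
  radicals and to the prime field. If f is nonzero at z, translation by z multiplies the sum by
  \<open>psi (f z)\<close>, which differs from 1.\<close>

lemma sum_psi_subgroup:
  fixes S :: "'b::ab_group_add set" and f :: "'b \<Rightarrow> 'p mod_ring"
  assumes "\<And>x y. x \<in> S \<Longrightarrow> y \<in> S \<Longrightarrow> x + y \<in> S" "\<And>x. x \<in> S \<Longrightarrow> - x \<in> S"
    and "\<And>x y. x \<in> S \<Longrightarrow> y \<in> S \<Longrightarrow> f (x + y) = f x + f y"
  shows "(\<Sum>x\<in>S. psi (f x)) = (if \<forall>x\<in>S. f x = 0 then of_nat (card S) else 0)"
proof (cases "\<forall>x\<in>S. f x = 0")
  case False
  then obtain z where z: "z \<in> S" "f z \<noteq> 0" by auto
  have bij: "bij_betw ((+) z) S S"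
    by (rule bij_betwI[where g = "(+) (- z)"]) (use assms z in auto)
  have "(\<Sum>x\<in>S. psi (f x)) = (\<Sum>x\<in>S. psi (f (z + x)))"
    using sum.reindex_bij_betw[OF bij, of "\<lambda>x. psi (f x)"] by simp
  also have "\<dots> = psi (f z) * (\<Sum>x\<in>S. psi (f x))"
    using assms z by (simp add: psi_add sum_distrib_left)
  finally have "(\<Sum>x\<in>S. psi (f x)) = 0"
    using z by (simp add: psi_eq_1_iff)
  thus ?thesis by (simp only: if_not_P[OF False])
qed simp

lemma sum_psi_tr:
  assumes "r dvd m" "x \<in> Fix r"
  shows "(\<Sum>y\<in>Fix r. psi (tr r (x * y))) = (if x = 0 then of_nat (p ^ r) else 0)"
proof -
  have "(\<Sum>y\<in>Fix r. psi (tr r (x * y))) =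
      (if \<forall>y\<in>Fix r. tr r (x * y) = 0 then of_nat (card (Fix r)) else 0)"
    by (rule sum_psi_subgroup) (use assms in \<open>auto simp: ring_distribs intro!: tr_add\<close>)
  thus ?thesis using assms tr_nondegenerate[OF assms] by (auto simp: card_Fix)
qed

end

subsection \<open>Quadratic forms\<close>

text \<open>S is a union of orbits of the multiplicative group U, each with \<open>card U\<close>
  elements because a nonzero x can be cancelled. Used with the signs 1, -1 and with a norm-one
  group.\<close>

lemma card_dvd_card_if_mult_closed:
  fixes U S :: "'a::{field,finite} set"
  assumes U: "1 \<in> U" "0 \<notin> U" "\<And>u v. u \<in> U \<Longrightarrow> v \<in> U \<Longrightarrow> u * v \<in> U" "\<And>u. u \<in> U \<Longrightarrow> inverse u \<in> U"
    and S: "0 \<notin> S" "\<And>u x. u \<in> U \<Longrightarrow> x \<in> S \<Longrightarrow> u * x \<in> S"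
  shows "card U dvd card S"
proof -
  define orb where "orb x = (\<lambda>u. u * x) ` U" for x
  have eq: "orb x = orb y" if zx: "z \<in> orb x" and zy: "z \<in> orb y" for x y z
  proof -
    have *: "orb x \<subseteq> orb y" if "u * x = v * y" "u \<in> U" "v \<in> U" for x y u v
    proof
      fix z assume "z \<in> orb x"
      then obtain w where w: "w \<in> U" "z = w * x" by (auto simp: orb_def)
      have "u \<noteq> 0" using U that by auto
      hence "x = inverse u * v * y" using that by (simp add: field_simps)
      hence "z = (w * (inverse u * v)) * y" using w by simp
      thus "z \<in> orb y" using U that w unfolding orb_def by blast
    qed
    obtain u where u: "z = u * x" "u \<in> U" using zx by (auto simp: orb_def)
    obtain v where v: "z = v * y" "v \<in> U" using zy by (auto simp: orb_def)
    show ?thesis using u v *[of u x v y] *[of v y u x] by auto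
  qed
  have "card U * card (orb ` S) = card (\<Union> (orb ` S))"
  proof (rule card_partition)
    fix c assume "c \<in> orb ` S"
    then obtain x where x: "x \<in> S" "c = orb x" by auto
    hence "x \<noteq> 0" using S by auto
    thus "card c = card U" unfolding x orb_def by (intro card_image) (auto simp: inj_on_def)
  next
    fix c d assume cd: "c \<in> orb ` S" "d \<in> orb ` S" "c \<noteq> d"
    then obtain x y where xy: "c = orb x" "d = orb y" by blast
    show "c \<inter> d = {}"
    proof (rule ccontr)
      assume "c \<inter> d \<noteq> {}"
      then obtain z where "z \<in> orb x" "z \<in> orb y" unfolding xy by blast
      from eq[OF this] cd(3) xy show False by simp
    qed
  qed auto
  moreover have "\<Union> (orb ` S) = S"
  proof
    show "S \<subseteq> \<Union> (orb ` S)" using U(1) by (force simp: orb_def)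
  qed (use S in \<open>auto simp: orb_def\<close>)
  ultimately show ?thesis by (metis dvd_triv_left)
qed

text \<open>Descent: p divides x, and x = p z gives y^2 + p z^2 with the exponent lowered by one.
  The two unknowns have changed places, which is why the parity of n decides which of them
  vanishes.\<close>

lemma sq_add_prime_mult_sq_eq_power:
  fixes x y p :: int
  assumes "prime p" "x\<^sup>2 + p * y\<^sup>2 = p ^ n"
  shows "if even n then y = 0 \<and> x\<^sup>2 = p ^ n else x = 0 \<and> y\<^sup>2 = p ^ (n - 1)"
  using assms(2)
proof (induction n arbitrary: x y)
  case 0
  have "p \<ge> 2" using assms(1) prime_ge_2_int by blast
  have "y\<^sup>2 < 1"
  proof (rule ccontr)
    assume "\<not> y\<^sup>2 < 1"
    hence "p * y\<^sup>2 \<ge> 2 * 1" using \<open>p \<ge> 2\<close> by (intro mult_mono) auto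
    moreover have "x\<^sup>2 \<ge> 0" by simp
    moreover have "x\<^sup>2 + p * y\<^sup>2 = 1" using 0 by simp
    ultimately show False by linarith
  qed
  hence "y\<^sup>2 = 0" by (smt (verit) zero_le_power2)
  hence "y = 0" by simp
  thus ?case using 0 by simp
next
  case (Suc n)
  have "x\<^sup>2 = p * (p ^ n - y\<^sup>2)" using Suc.prems by (simp add: algebra_simps)
  hence "p dvd x\<^sup>2" by simp
  hence "p dvd x" using assms(1) prime_dvd_power by blast
  then obtain z where z: "x = p * z" by auto
  have "p * (y\<^sup>2 + p * z\<^sup>2) = p * p ^ n"
    using Suc.prems by (simp add: z power2_eq_square algebra_simps)
  moreover have "p \<noteq> 0" using assms(1) by auto
  ultimately have "y\<^sup>2 + p * z\<^sup>2 = p ^ n" by simp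
  note IH = Suc.IH[OF this]
  show ?case
  proof (cases "even n")
    case True
    thus ?thesis using IH z by simp
  next
    case False
    then obtain k where "n = Suc k" by (cases n) auto
    thus ?thesis using IH z False by (simp add: power_mult_distrib power2_eq_square)
  qed
qed

lemma card_Collect_pair:
  "card {(x::'x::finite, y::'y::finite). P x y} = (\<Sum>x\<in>UNIV. card {y. P x y})"
proof -
  have "{(x, y). P x y} = Sigma UNIV (\<lambda>x. {y. P x y})" by auto
  thus ?thesis by simp
qed

lemma sum_fibres:
  fixes f :: "'x::finite \<Rightarrow> 'y::finite" and g :: "'y \<Rightarrow> 'z::comm_semiring_1"
  shows "(\<Sum>x\<in>UNIV. g (f x)) = (\<Sum>y\<in>UNIV. of_nat (card {x. f x = y}) * g y)"
proof -
  have "(\<Sum>x\<in>UNIV. g (f x)) = (\<Sum>y\<in>UNIV. \<Sum>x\<in>{x \<in> UNIV. f x = y}. g (f x))"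
    by (rule sum.group[symmetric]) auto
  also have "\<dots> = (\<Sum>y\<in>UNIV. \<Sum>x\<in>{x. f x = y}. g y)" by (auto intro!: sum.cong)
  finally show ?thesis by simp
qed

section \<open>Square classes and trace fibres in odd characteristic\<close>

locale odd_extension = finite_extension m p q base ext
  for m p q :: nat and base :: "'p::prime_card itself" and ext :: "'a::{field,finite} itself" +
  assumes odd_p: "odd p"
begin

lemma p_ge_3: "p \<ge> 3"
  using odd_p p_gt_1 by (cases "p = 2") auto

lemma two_neq_0 [simp]: "(2::'a) \<noteq> 0" and two_neq_0_base [simp]: "(2::'p mod_ring) \<noteq> 0"
proof -
  have "\<not> p dvd 2" using p_ge_3 by (auto dest: dvd_imp_le)
  thus "(2::'a) \<noteq> 0" "(2::'p mod_ring) \<noteq> 0"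
    using of_nat_eq_0_iff_char_dvd[of 2, where 'a = 'a] of_nat_eq_0_iff_char_dvd[of 2, where 'a = "'p mod_ring"]
    by (auto simp: char_ext p_card)
qed

definition Sq :: "'p mod_ring set" where "Sq = (\<lambda>u. u\<^sup>2) ` (UNIV - {0})"

lemma card_Sq: "2 * card Sq = p - 1"
proof -
  have "card (UNIV - {0 :: 'p mod_ring}) = (\<Sum>y\<in>Sq. card {x \<in> UNIV - {0}. x\<^sup>2 = y})"
    unfolding Sq_def using sum.group[of "UNIV - {0 :: 'p mod_ring}" "(\<lambda>u. u\<^sup>2) ` (UNIV - {0})" "\<lambda>u. u\<^sup>2" "\<lambda>_. 1::nat"]
    by simp
  also have "card {x \<in> UNIV - {0}. x\<^sup>2 = y} = 2" if "y \<in> Sq" for y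
  proof -
    obtain u where u: "u \<noteq> 0" "y = u\<^sup>2" using \<open>y \<in> Sq\<close> by (auto simp: Sq_def)
    have "{x \<in> UNIV - {0}. x\<^sup>2 = y} = {u, - u}" using u by (auto simp: power2_eq_iff)
    moreover have "u \<noteq> - u"
    proof
      assume "u = - u"
      hence "2 * u = 0" by (metis add.right_inverse mult_2)
      thus False using u by simp
    qed
    ultimately show ?thesis by simp
  qed
  hence "(\<Sum>y\<in>Sq. card {x \<in> UNIV - {0}. x\<^sup>2 = y}) = (\<Sum>y\<in>Sq. 2)" by (rule sum.cong[OF refl])
  finally show ?thesis by (simp add: card_Diff_singleton p_card)
qed

lemma zero_notin_Sq: "0 \<notin> Sq"
  by (auto simp: Sq_def)

text \<open>The nonsquares form one coset of \<open>Sq\<close>: multiplying \<open>Sq\<close> by a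
  nonsquare yields nonsquares only, and by \<open>card_Sq\<close> there are no others.\<close>

lemma obtain_nonsquare:
  obtains n where "n \<noteq> 0" "n \<notin> Sq" "UNIV - {0} - Sq = (*) n ` Sq"
proof -
  have c: "card (UNIV - {0} - Sq) = card Sq"
    using card_Sq zero_notin_Sq by (subst card_Diff_subset) (auto simp: card_Diff_singleton p_card)
  have "card Sq > 0" using card_Sq p_ge_3 by linarith
  hence "UNIV - {0} - Sq \<noteq> {}" using c by force
  then obtain n where n: "n \<noteq> 0" "n \<notin> Sq" by auto
  have "(*) n ` Sq \<subseteq> UNIV - {0} - Sq"
  proof (safe, goal_cases)
    case 1 show ?case by simp
  next
    case (2 _ x) thus ?case using n zero_notin_Sq by auto
  next
    case (3 _ x)
    then obtain u v where "u \<noteq> 0" "x = u\<^sup>2" "v \<noteq> 0" "n * x = v\<^sup>2" by (auto simp: Sq_def)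
    hence "n = (v / u)\<^sup>2" by (simp add: field_simps power2_eq_square)
    moreover have "v / u \<noteq> 0" using \<open>u \<noteq> 0\<close> \<open>v \<noteq> 0\<close> by simp
    ultimately show ?case using n by (auto simp: Sq_def)
  qed
  moreover have "card ((*) n ` Sq) = card Sq"
    using n by (intro card_image) (auto simp: inj_on_def)
  ultimately have "(*) n ` Sq = UNIV - {0} - Sq"
    using c by (intro card_subset_eq) auto
  thus ?thesis using n that by auto
qed

text \<open>All fibres are translates of each other, so each has q/p elements; multiplying by p
  avoids the division.\<close>

lemma card_tr_fibre:
  assumes "w \<noteq> 0"
  shows "p * card {y. tr m (w * y) = t} = q"
proof -
  have *: "card {y. tr m (w * y) = u} = card {y. tr m (w * y) = v}" for u v
  proof -
    obtain z where z: "tr m z \<noteq> 0" using tr_nonzero[of m] by auto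
    \<comment> \<open>A prime field multiple of z has the required trace v - u, and the division by
      w cancels the factor w.\<close>
    define a where "a = incl ((v - u) / tr m z) * z / w"
    have a: "tr m (w * a) = v - u" using z assms by (simp add: a_def tr_scale)
    have "bij_betw ((+) a) {y. tr m (w * y) = u} {y. tr m (w * y) = v}"
      by (rule bij_betwI[where g = "(+) (- a)"]) (auto simp: ring_distribs tr_add tr_diff a)
    thus ?thesis by (rule bij_betw_same_card)
  qed
  have "q = card (UNIV :: 'a set)" by (simp add: q_card)
  also have "\<dots> = (\<Sum>u\<in>UNIV. card {y. tr m (w * y) = u})"
    using sum_fibres[of "\<lambda>_. 1::nat" "\<lambda>y. tr m (w * y)"] by simp
  also have "\<dots> = p * card {y. tr m (w * y) = t}"
    by (subst *[of _ t]) (simp add: p_card)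
  finally show ?thesis ..
qed

end

text \<open>\<open>Lam\<close> represents the polar form as \<open>tr m (y * Lam x)\<close>. The
  radical is thus the kernel of an additive map, which for the code is an explicit combination of
  Frobenius powers.\<close>

locale quadratic_form = odd_extension m p q base ext
  for m p q :: nat and base :: "'p::prime_card itself" and ext :: "'a::{field,finite} itself" +
  fixes Q :: "'a \<Rightarrow> 'p mod_ring" and Lam :: "'a \<Rightarrow> 'a"
  assumes polar: "Q (x + y) = Q x + Q y + tr m (y * Lam x)"
    and Q_scale: "Q (incl t * x) = t\<^sup>2 * Q x"
    and Lam_add: "Lam (x + y) = Lam x + Lam y"
begin

definition Rad :: "'a set" where "Rad = {x. Lam x = 0}"
definition N :: "'p mod_ring \<Rightarrow> nat" where "N t = card {x. Q x = t}"
definition T :: complex where "T = (\<Sum>x\<in>UNIV. psi (Q x))"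

lemma tr_Lam_sym: "tr m (y * Lam x) = tr m (x * Lam y)"
  using polar[of x y] polar[of y x] by (simp add: add.commute)

lemma two_Q: "2 * Q x = tr m (x * Lam x)"
proof -
  \<comment> \<open>Q is evaluated at 2x by scaling and by polarisation; 2 is written 1 + 1 so that
    \<open>incl\<close> can be expanded.\<close>
  have "Q (incl (1 + 1) * x) = (1 + 1)\<^sup>2 * Q x" by (rule Q_scale)
  moreover have "incl (1 + 1) * x = x + x" by (simp only: incl_add incl_1 ring_distribs mult_1)
  ultimately have "(1 + 1)\<^sup>2 * Q x = 2 * Q x + tr m (x * Lam x)"
    by (simp only: polar mult_2)
  moreover have "(1 + 1)\<^sup>2 * Q x = 2 * Q x + 2 * Q x" by (simp add: power2_eq_square)
  ultimately show ?thesis by simp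
qed

lemma Lam_0 [simp]: "Lam 0 = 0" and Lam_minus [simp]: "Lam (- x) = - Lam x"
proof -
  have "Lam 0 + Lam 0 = Lam 0 + 0" using Lam_add[of 0 0] by simp
  thus *: "Lam 0 = 0" by (rule add_left_imp_eq)
  have "Lam x + Lam (- x) = 0" using Lam_add[of x "- x"] * by simp
  thus "Lam (- x) = - Lam x" by (simp add: eq_neg_iff_add_eq_0 add.commute)
qed

lemma Lam_diff: "Lam (x - y) = Lam x - Lam y"
  using Lam_add[of x "-y"] by simp

lemma Q_0 [simp]: "Q 0 = 0" and Q_minus [simp]: "Q (- x) = Q x"
  using Q_scale[of 0 0] Q_scale[of "-1" x] by auto

lemma Q_Rad: "x \<in> Rad \<Longrightarrow> Q x = 0"
  using two_Q[of x] by (simp add: Rad_def)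

lemma Rad_0: "0 \<in> Rad" by (simp add: Rad_def)

lemma card_Rad_pos: "card Rad > 0"
  using Rad_0 by (auto simp: card_gt_0_iff)

lemma sum_psi_tr_UNIV: "(\<Sum>y\<in>UNIV. psi (tr m (y * w))) = (if w = 0 then of_nat q else 0)"
proof -
  have "Fix m = UNIV" by auto
  thus ?thesis using sum_psi_tr[of m w] by (simp add: mult.commute q_eq)
qed

text \<open>Substituting x = z + y cancels Q(y), and the sum over y leaves only the z in the
  radical, where Q vanishes.\<close>

lemma T_cnj_T: "T * cnj T = of_nat (q * card Rad)"
proof -
  have "T * cnj T = (\<Sum>y\<in>UNIV. \<Sum>x\<in>UNIV. psi (Q x) * cnj (psi (Q y)))"
    unfolding T_def cnj_sum sum_product by (rule sum.swap)
  also have "\<dots> = (\<Sum>y\<in>UNIV. \<Sum>z\<in>UNIV. psi (Q (z + y)) * cnj (psi (Q y)))"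
  proof (rule sum.cong[OF refl])
    fix y :: 'a
    have bij: "bij_betw (\<lambda>z. z + y) UNIV UNIV" by (rule bij_betwI[where g = "\<lambda>z. z - y"]) auto
    show "(\<Sum>x\<in>UNIV. psi (Q x) * cnj (psi (Q y))) = (\<Sum>z\<in>UNIV. psi (Q (z + y)) * cnj (psi (Q y)))"
      by (rule sum.reindex_bij_betw[OF bij, symmetric])
  qed
  also have "\<dots> = (\<Sum>z\<in>UNIV. \<Sum>y\<in>UNIV. psi (Q z) * psi (tr m (y * Lam z)))"
    by (subst sum.swap) (simp add: polar psi_diff[symmetric] psi_add[symmetric] add.commute add.left_commute)
  also have "\<dots> = (\<Sum>z\<in>UNIV. if z \<in> Rad then of_nat q else 0)"
  proof (rule sum.cong[OF refl])
    fix z :: 'a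
    show "(\<Sum>y\<in>UNIV. psi (Q z) * psi (tr m (y * Lam z))) = (if z \<in> Rad then of_nat q else 0)"
      using Q_Rad[of z] by (simp add: sum_distrib_left[symmetric] sum_psi_tr_UNIV Rad_def)
  qed
  also have "\<dots> = of_nat (q * card Rad)" by (simp add: sum.If_cases)
  finally show ?thesis .
qed

lemma sum_N: "(\<Sum>t\<in>UNIV. N t) = q"
  using sum_fibres[of "\<lambda>_. 1::nat" Q] by (simp add: N_def q_card)

lemma T_eq_sum_N: "T = (\<Sum>t\<in>UNIV. of_nat (N t) * psi t)"
  unfolding T_def N_def by (rule sum_fibres)

text \<open>The second moment counts pairs on a common level. In terms of their difference z, the
  condition is affine in y: it is void for z in the radical and has q/p solutions for any other
  z.\<close>

lemma sum_N_sq: "p * (\<Sum>t\<in>UNIV. (N t)\<^sup>2) = q * (p * card Rad + (q - card Rad))"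
proof -
  have "(\<Sum>t\<in>UNIV. (N t)\<^sup>2) = (\<Sum>x\<in>UNIV. N (Q x))"
    using sum_fibres[of N Q] by (simp add: N_def power2_eq_square)
  also have "\<dots> = card {(y, x). Q x = Q y}" by (simp add: card_Collect_pair N_def)
  also have "\<dots> = card {(z, y). Q z + tr m (y * Lam z) = 0}"
  proof (rule bij_betw_same_card)
    show "bij_betw (\<lambda>(y, x). (x - y, y)) {(y, x). Q x = Q y} {(z, y). Q z + tr m (y * Lam z) = 0}"
      (is "bij_betw _ ?A ?B")
    proof (rule bij_betwI[where g = "\<lambda>(z, y). (y, z + y)"])
      show "(\<lambda>(y, x). (x - y, y)) \<in> ?A \<rightarrow> ?B"
      proof safe
        fix y x assume "Q x = Q y"
        thus "Q (x - y) + tr m (y * Lam (x - y)) = 0" using polar[of "x - y" y] by simp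
      qed
      show "(\<lambda>(z, y). (y, z + y)) \<in> ?B \<rightarrow> ?A"
        by (auto simp: polar algebra_simps)
    qed auto
  qed
  also have "\<dots> = (\<Sum>z\<in>UNIV. card {y. Q z + tr m (y * Lam z) = 0})" by (simp add: card_Collect_pair)
  finally have "p * (\<Sum>t\<in>UNIV. (N t)\<^sup>2) = (\<Sum>z\<in>UNIV. p * card {y. Q z + tr m (y * Lam z) = 0})"
    by (simp add: sum_distrib_left)
  also have "\<dots> = (\<Sum>z\<in>UNIV. if z \<in> Rad then p * q else q)"
  proof (rule sum.cong[OF refl])
    fix z :: 'a
    show "p * card {y. Q z + tr m (y * Lam z) = 0} = (if z \<in> Rad then p * q else q)"
    proof (cases "z \<in> Rad")
      case True
      thus ?thesis by (simp add: Q_Rad) (simp add: Rad_def q_card)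
    next
      case False
      hence "p * card {y. tr m (Lam z * y) = - Q z} = q"
        by (intro card_tr_fibre) (simp add: Rad_def)
      moreover have "{y. tr m (Lam z * y) = - Q z} = {y. Q z + tr m (y * Lam z) = 0}"
        by (auto simp: mult.commute eq_neg_iff_add_eq_0 add.commute)
      ultimately show ?thesis using False by simp
    qed
  qed
  also have "\<dots> = card Rad * (p * q) + (q - card Rad) * q"
    by (simp add: sum.If_cases q_card Compl_eq_Diff_UNIV card_Diff_subset)
  finally show ?thesis by (simp add: algebra_simps)
qed

lemma N_mult_sq:
  assumes "u \<noteq> 0"
  shows "N (u\<^sup>2 * t) = N t"
proof -
  have "bij_betw ((*) (incl u)) {x. Q x = t} {x. Q x = u\<^sup>2 * t}"
  proof (rule bij_betwI[where g = "(*) (incl (1 / u))"])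
    show "(*) (incl (1 / u)) \<in> {x. Q x = u\<^sup>2 * t} \<rightarrow> {x. Q x = t}"
      using assms by (auto simp: Q_scale power_divide)
  qed (use assms in \<open>auto simp: Q_scale mult.assoc[symmetric] simp flip: incl_mult\<close>)
  thus ?thesis unfolding N_def by (metis bij_betw_same_card)
qed

text \<open>Evenness lets \<open>two_values\<close> name halves a and b, so that the descent works
  with integers.\<close>

lemma even_N:
  assumes "t \<noteq> 0"
  shows "even (N t)"
proof -
  have "card {1, -1 :: 'a} dvd card {x. Q x = t}"
    by (rule card_dvd_card_if_mult_closed) (use assms in auto)
  moreover have "(1 :: 'a) \<noteq> - 1" using two_neq_0 by (metis add.right_inverse one_add_one)
  hence "card {1, -1 :: 'a} = 2" by simp
  ultimately show ?thesis by (simp only: N_def)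
qed

lemma two_values:
  "\<exists>a b. (\<forall>t\<in>Sq. N t = 2 * a) \<and> (\<forall>t. t \<noteq> 0 \<longrightarrow> t \<notin> Sq \<longrightarrow> N t = 2 * b)"
proof -
  obtain n where n: "n \<noteq> 0" "n \<notin> Sq" "UNIV - {0} - Sq = (*) n ` Sq" by (rule obtain_nonsquare)
  have "N t = N 1" if "t \<in> Sq" for t using that N_mult_sq[of _ 1] by (auto simp: Sq_def)
  moreover have "N t = N n" if "t \<noteq> 0" "t \<notin> Sq" for t
  proof -
    have "t \<in> (*) n ` Sq" using that n(3)[symmetric] by auto
    then obtain s where "s \<in> Sq" "t = n * s" by auto
    moreover from this obtain u where "u \<noteq> 0" "s = u\<^sup>2" by (auto simp: Sq_def)
    ultimately have "u \<noteq> 0" "t = u\<^sup>2 * n" by simp_all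
    thus ?thesis using N_mult_sq by simp
  qed
  moreover obtain a b where "N 1 = 2 * a" "N n = 2 * b" using even_N[of 1] even_N[of n] n by (auto elim!: evenE)
  ultimately show ?thesis by auto
qed

text \<open>Doubled so that the number (p - 1)/2 of squares enters as p - 1, in an arbitrary
  commutative ring.\<close>

lemma sum_split_Sq:
  fixes f :: "'p mod_ring \<Rightarrow> 'z::comm_ring_1"
  assumes "\<And>t. t \<in> Sq \<Longrightarrow> f t = x" "\<And>t. t \<noteq> 0 \<Longrightarrow> t \<notin> Sq \<Longrightarrow> f t = y"
  shows "2 * (\<Sum>t\<in>UNIV. f t) = 2 * f 0 + (of_nat p - 1) * (x + y)"
proof -
  have "UNIV = insert 0 (Sq \<union> (UNIV - {0} - Sq))" by auto
  hence "(\<Sum>t\<in>UNIV. f t) = (\<Sum>t\<in>insert 0 (Sq \<union> (UNIV - {0} - Sq)). f t)" by metis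
  also have "\<dots> = f 0 + ((\<Sum>t\<in>Sq. f t) + (\<Sum>t\<in>UNIV - {0} - Sq. f t))"
    using zero_notin_Sq by (subst sum.insert) (auto simp: sum.union_disjoint[symmetric])
  also have "(\<Sum>t\<in>Sq. f t) = of_nat (card Sq) * x" using assms by simp
  also have "(\<Sum>t\<in>UNIV - {0} - Sq. f t) = of_nat (card (UNIV - {0} - Sq)) * y" using assms by simp
  also have "card (UNIV - {0} - Sq) = card Sq"
    using card_Sq zero_notin_Sq by (subst card_Diff_subset) (auto simp: card_Diff_singleton p_card)
  finally have "2 * (\<Sum>t\<in>UNIV. f t) = 2 * f 0 + of_nat (2 * card Sq) * (x + y)"
    by (simp add: algebra_simps)
  thus ?thesis using card_Sq p_gt_1 by (simp add: of_nat_diff)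
qed

lemma card_Rad_le: "card Rad \<le> q"
  unfolding q_card by (rule card_mono) auto

text \<open>N 0 - a - b and a - b are the coordinates of T with respect to 1 and the quadratic Gauss
  sum of the prime field. The equation comes from the first two moments of the level counts, so that
  Gauss sum never has to appear.\<close>

lemma norm_equation:
  fixes a b :: nat
  assumes "\<And>t. t \<in> Sq \<Longrightarrow> N t = 2 * a" "\<And>t. t \<noteq> 0 \<Longrightarrow> t \<notin> Sq \<Longrightarrow> N t = 2 * b"
  shows "int q = int (N 0) + (int p - 1) * (int a + int b)"
    and "(int (N 0) - int a - int b)\<^sup>2 + int p * (int a - int b)\<^sup>2 = int (q * card Rad)"
proof -
  have "2 * (\<Sum>t\<in>UNIV. int (N t)) = 2 * int (N 0) + (int p - 1) * (int (2 * a) + int (2 * b))"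
    by (rule sum_split_Sq[where f = "\<lambda>t. int (N t)", unfolded of_nat_id]) (use assms in auto)
  moreover have "(\<Sum>t\<in>UNIV. int (N t)) = int q" using sum_N by (simp flip: of_nat_sum)
  ultimately show 1: "int q = int (N 0) + (int p - 1) * (int a + int b)" by (simp add: algebra_simps)
  have "2 * (\<Sum>t\<in>UNIV. (int (N t))\<^sup>2) = 2 * (int (N 0))\<^sup>2 + (int p - 1) * ((2 * int a)\<^sup>2 + (2 * int b)\<^sup>2)"
    by (rule sum_split_Sq[where f = "\<lambda>t. (int (N t))\<^sup>2", unfolded of_nat_id]) (use assms in auto)
  moreover have "int (p * (\<Sum>t\<in>UNIV. (N t)\<^sup>2)) = int (q * (p * card Rad + (q - card Rad)))"
    using sum_N_sq by metis
  hence "int p * (\<Sum>t\<in>UNIV. (int (N t))\<^sup>2) = int q * (int p * card Rad + int q - card Rad)"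
    using card_Rad_le by (simp add: of_nat_diff)
  moreover from calculation(1) have "(\<Sum>t\<in>UNIV. (int (N t))\<^sup>2) = (int (N 0))\<^sup>2 + (int p - 1) * (2 * (int a)\<^sup>2 + 2 * (int b)\<^sup>2)"
    by (simp add: power_mult_distrib algebra_simps)
  ultimately have "int p * ((int (N 0))\<^sup>2 + (int p - 1) * (2 * (int a)\<^sup>2 + 2 * (int b)\<^sup>2))
      = int q * int q + (int p - 1) * (int q * card Rad)"
    by (simp add: algebra_simps)
  \<comment> \<open>The right side is p times the second moment minus the square of the total, a
    variance up to scaling; once q is replaced by the first equation it has the factor p -
    1.\<close>
  moreover have "(int p - 1) * ((int (N 0) - int a - int b)\<^sup>2 + int p * (int a - int b)\<^sup>2)
      = int p * ((int (N 0))\<^sup>2 + (int p - 1) * (2 * (int a)\<^sup>2 + 2 * (int b)\<^sup>2)) - int q * int q"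
    unfolding 1 by (simp add: algebra_simps power2_eq_square)
  ultimately have "(int p - 1) * ((int (N 0) - int a - int b)\<^sup>2 + int p * (int a - int b)\<^sup>2)
      = (int p - 1) * (int q * card Rad)"
    by simp
  moreover have "int p - 1 \<noteq> 0" using p_gt_1 by simp
  ultimately show "(int (N 0) - int a - int b)\<^sup>2 + int p * (int a - int b)\<^sup>2 = int (q * card Rad)"
    by simp
qed

lemma sum_psi_base: "(\<Sum>t\<in>UNIV. psi t) = 0"
proof -
  have "(\<Sum>t\<in>UNIV. psi t) = (if \<forall>t\<in>UNIV. t = (0::'p mod_ring) then of_nat (card (UNIV :: 'p mod_ring set)) else 0)"
    by (rule sum_psi_subgroup) auto
  moreover have "\<not> (\<forall>t\<in>UNIV. t = (0::'p mod_ring))" by (meson UNIV_I one_neq_zero)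
  ultimately show ?thesis by (simp only: if_False)
qed

text \<open>The even exponent forces equal counts on squares and nonsquares. One sign remains, and
  it is the sign of T; the last clause keeps it in integers for a congruence argument.\<close>

lemma even_rank:
  assumes "q * card Rad = p ^ (2 * e)"
  obtains eps :: int where "eps \<in> {1, -1}" "T = of_int (eps * int p ^ e)"
    "real (N 0) = real q / p + eps * (real p - 1) * real p ^ e / p"
    "\<And>t. t \<noteq> 0 \<Longrightarrow> real (N t) = real q / p - eps * real p ^ e / p"
    "int (N 0) - int (N 1) = eps * int p ^ e"
proof -
  from two_values obtain a b where "(\<forall>t\<in>Sq. N t = 2 * a) \<and> (\<forall>t. t \<noteq> 0 \<longrightarrow> t \<notin> Sq \<longrightarrow> N t = 2 * b)"
    by (elim exE)
  hence ab: "\<And>t. t \<in> Sq \<Longrightarrow> N t = 2 * a" "\<And>t. t \<noteq> 0 \<Longrightarrow> t \<notin> Sq \<Longrightarrow> N t = 2 * b"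
    by simp_all
  define X where "X = int (N 0) - int a - int b"
  have "X\<^sup>2 + int p * (int a - int b)\<^sup>2 = int p ^ (2 * e)"
    using norm_equation(2)[OF ab] assms by (simp add: X_def)
  from sq_add_prime_mult_sq_eq_power[OF _ this] prime_p
  have "a = b" and "X\<^sup>2 = (int p ^ e)\<^sup>2"
    by (auto simp: power_mult[symmetric] mult.commute)
  hence "X = int p ^ e \<or> X = - (int p ^ e)" by (simp add: power2_eq_iff)
  then obtain eps :: int where eps: "eps \<in> {1, -1}" "X = eps * int p ^ e"
    by (elim disjE; force)
  have N: "N t = 2 * a" if "t \<noteq> 0" for t using ab that \<open>a = b\<close> by auto
  have 1: "int (N 0) - int (2 * a) = eps * int p ^ e" using eps \<open>a = b\<close> by (simp add: X_def)
  have 2: "int q = int (N 0) + (int p - 1) * (2 * int a)"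
    using norm_equation(1)[OF ab] \<open>a = b\<close> by simp
  hence "real_of_int (int q) = real_of_int (int (N 0) + (int p - 1) * (2 * int a))" by (simp only:)
  hence q: "real q = real (N 0) + (real p - 1) * (2 * real a)" by simp
  have "real_of_int (int (N 0) - int (2 * a)) = real_of_int (eps * int p ^ e)" using 1 by (simp only:)
  hence n0: "real (N 0) = 2 * real a + eps * real p ^ e" by simp
  have p0: "real p \<noteq> 0" using p_gt_1 by simp
  have "real q = real p * (2 * real a) + eps * real p ^ e" using q n0 by (simp add: algebra_simps)
  hence ra: "2 * real a = real q / p - eps * real p ^ e / p" using p0 by (simp add: field_simps)
  have "T = (\<Sum>t\<in>UNIV. of_nat (2 * a) * psi t + (if t = 0 then of_nat (N 0) - of_nat (2 * a) else 0))"
    unfolding T_eq_sum_N by (rule sum.cong) (auto simp: N)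
  also have "\<dots> = of_nat (2 * a) * (\<Sum>t\<in>UNIV. psi t) + (of_nat (N 0) - of_nat (2 * a))"
    by (simp add: sum.distrib sum_distrib_left)
  also have "\<dots> = of_int (int (N 0) - int (2 * a))" by (simp add: sum_psi_base)
  finally have T: "T = of_int (eps * int p ^ e)" unfolding 1 .
  have n0': "real (N 0) = real q / p + eps * (real p - 1) * real p ^ e / p"
    using n0 ra p0 by (simp add: field_simps)
  have n1: "real (N t) = real q / p - eps * real p ^ e / p" if "t \<noteq> 0" for t
    using N[OF that] ra by simp
  show ?thesis by (rule that[OF eps(1) T n0' n1]) (use 1 N[of 1] in simp_all)
qed

text \<open>Here the other unknown of the descent vanishes. Which square class has the larger level
  sets stays open, hence the equality of two-element sets.\<close>

lemma odd_rank:
  assumes "q * card Rad = p ^ (2 * e + 1)"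
  obtains a b where "\<And>t. t \<in> Sq \<Longrightarrow> N t = a" "\<And>t. t \<noteq> 0 \<Longrightarrow> t \<notin> Sq \<Longrightarrow> N t = b"
    "real (N 0) = real q / p" "{real a, real b} = {real q / p + real p ^ e, real q / p - real p ^ e}"
proof -
  from two_values obtain a b where "(\<forall>t\<in>Sq. N t = 2 * a) \<and> (\<forall>t. t \<noteq> 0 \<longrightarrow> t \<notin> Sq \<longrightarrow> N t = 2 * b)"
    by (elim exE)
  hence ab: "\<And>t. t \<in> Sq \<Longrightarrow> N t = 2 * a" "\<And>t. t \<noteq> 0 \<Longrightarrow> t \<notin> Sq \<Longrightarrow> N t = 2 * b"
    by simp_all
  define X where "X = int (N 0) - int a - int b"
  have "X\<^sup>2 + int p * (int a - int b)\<^sup>2 = int p ^ (2 * e + 1)"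
    using norm_equation(2)[OF ab] assms by (simp add: X_def)
  from sq_add_prime_mult_sq_eq_power[OF _ this] prime_p
  have X: "X = 0" and "(int a - int b)\<^sup>2 = (int p ^ e)\<^sup>2"
    by (auto simp: power_mult[symmetric] mult.commute)
  hence Y: "int a - int b = int p ^ e \<or> int a - int b = - (int p ^ e)" by (simp add: power2_eq_iff)
  have "int (N 0) = int a + int b" using X by (simp add: X_def)
  hence n0: "real (N 0) = real a + real b" by linarith
  have "int q = int (N 0) + (int p - 1) * (int a + int b)" by (rule norm_equation(1)[OF ab])
  hence "real_of_int (int q) = real_of_int (int (N 0) + (int p - 1) * (int a + int b))" by (simp only:)
  hence "real q = real p * (real a + real b)" using n0 by (simp add: algebra_simps)
  hence s: "real a + real b = real q / p" using p_gt_1 by (simp add: field_simps)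
  have "real_of_int (int a - int b) = real p ^ e \<or> real_of_int (int a - int b) = - (real p ^ e)"
    using Y by (metis of_int_minus of_int_of_nat_eq of_int_power)
  hence "real a - real b = real p ^ e \<or> real a - real b = - (real p ^ e)" by simp
  hence "{real (2 * a), real (2 * b)} = {real q / p + real p ^ e, real q / p - real p ^ e}"
    using s by (elim disjE) (auto simp: doubleton_eq_iff)
  thus ?thesis using that[of "2 * a" "2 * b"] ab n0 s by simp
qed

section \<open>From level sets of a form to weights of words\<close>

lemma card_eq_sum_indicator: "real (card {t::'p mod_ring. P t}) = (\<Sum>t\<in>UNIV. if P t then 1 else 0)"
  by (simp add: sum.If_cases)

lemma card_level_even:
  fixes x y w :: real
  assumes "real (N 0) = x" "\<And>t. t \<noteq> 0 \<Longrightarrow> real (N t) = y"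
  shows "real (card {t. real q - real (N t) = w}) =
    (if q - x = w then 1 else 0) + (real p - 1) * (if q - y = w then 1 else 0)"
proof -
  let ?f = "\<lambda>t. if real q - real (N t) = w then 1 else 0 :: real"
  have sq: "real (N t) = y" if "t \<in> Sq" for t using that assms(2)[of t] zero_notin_Sq by metis
  have "2 * (\<Sum>t\<in>UNIV. ?f t) = 2 * ?f 0 + (real p - 1) * ((if q - y = w then 1 else 0) + (if q - y = w then 1 else 0))"
    by (rule sum_split_Sq[where 'z = real, unfolded of_nat_id]) (use assms sq in auto)
  thus ?thesis unfolding card_eq_sum_indicator using assms(1) by (simp split: if_splits)
qed

lemma card_level_odd:
  fixes x y z w :: real
  assumes "\<And>t. t \<in> Sq \<Longrightarrow> N t = a" "\<And>t. t \<noteq> 0 \<Longrightarrow> t \<notin> Sq \<Longrightarrow> N t = b"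
    "real (N 0) = x" "{real a, real b} = {y, z}"
  shows "real (card {t. real q - real (N t) = w}) =
    (if q - x = w then 1 else 0) + (real p - 1) / 2 * (if q - y = w then 1 else 0)
      + (real p - 1) / 2 * (if q - z = w then 1 else 0)"
proof -
  let ?f = "\<lambda>t. if real q - real (N t) = w then 1 else 0 :: real"
  have "2 * (\<Sum>t\<in>UNIV. ?f t) = 2 * ?f 0 + (real p - 1) *
      ((if real q - real a = w then 1 else 0) + (if real q - real b = w then 1 else 0))"
    by (rule sum_split_Sq[where 'z = real, unfolded of_nat_id]) (use assms in auto)
  moreover have "(if real q - real a = w then 1 else 0) + (if real q - real b = w then 1 else 0) =
      (if q - y = w then 1 else 0) + (if q - z = w then 1 else 0 :: real)"
    using assms(4) by (auto simp: doubleton_eq_iff)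
  ultimately have "2 * (\<Sum>t\<in>UNIV. ?f t) = 2 * ?f 0 + (real p - 1) *
      ((if q - y = w then 1 else 0) + (if q - z = w then 1 else 0))" by (simp only:)
  thus ?thesis unfolding card_eq_sum_indicator using assms(3)
    by (simp only: ring_distribs) (simp add: field_simps)
qed

definition perp :: "'a set" where "perp = {c. \<forall>r\<in>Rad. tr m (c * r) = 0}"

text \<open>A double sum of characters over all c and all radical elements, evaluated in both
  orders.\<close>

lemma card_perp: "card perp * card Rad = q"
proof -
  have *: "(\<Sum>r\<in>Rad. psi (tr m (c * r))) = (if c \<in> perp then of_nat (card Rad) else 0)" for c
    unfolding perp_def mem_Collect_eq
    by (rule sum_psi_subgroup) (auto simp: Rad_def Lam_add ring_distribs tr_add)
  have "(\<Sum>c\<in>UNIV. \<Sum>r\<in>Rad. psi (tr m (c * r))) = (\<Sum>r\<in>Rad. \<Sum>c\<in>UNIV. psi (tr m (c * r)))"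
    by (rule sum.swap)
  also have "\<dots> = (\<Sum>r\<in>Rad. if r = 0 then of_nat q else 0)"
    by (simp only: sum_psi_tr_UNIV)
  also have "\<dots> = of_nat q" using Rad_0 by (simp add: sum.delta)
  finally have "(of_nat (card perp * card Rad) :: complex) = of_nat q"
    unfolding * by (simp add: sum.If_cases)
  thus ?thesis by (simp only: of_nat_eq_iff)
qed

text \<open>By symmetry of the polar form the values of \<open>Lam\<close> are orthogonal to its
  kernel. The fibres are cosets of the kernel, and counting gives equality.\<close>

lemma range_Lam: "range Lam = perp"
proof (rule card_subset_eq)
  show "range Lam \<subseteq> perp"
  proof
    fix c assume "c \<in> range Lam"
    then obtain x where "c = Lam x" by auto
    thus "c \<in> perp" using tr_Lam_sym[of _ x] by (auto simp: perp_def mult.commute Rad_def)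
  qed
  have "card (UNIV :: 'a set) \<le> card Rad * card (range Lam)"
  proof (rule card_le_mult_card_image)
    fix y assume "y \<in> range Lam"
    then obtain z where z: "y = Lam z" by auto
    have "bij_betw (\<lambda>x. x - z) {x \<in> UNIV. Lam x = y} Rad"
      by (rule bij_betwI[where g = "\<lambda>x. x + z"]) (auto simp: Rad_def Lam_diff Lam_add z)
    thus "card {x \<in> UNIV. Lam x = y} \<le> card Rad" by (simp add: bij_betw_same_card)
  qed auto
  hence "card perp * card Rad \<le> card (range Lam) * card Rad"
    using card_perp by (simp add: q_card mult.commute)
  hence "card perp \<le> card (range Lam)" using card_Rad_pos by simp
  moreover have "card (range Lam) \<le> card perp"
    by (rule card_mono) (use \<open>range Lam \<subseteq> perp\<close> in auto)
  ultimately show "card (range Lam) = card perp" by simp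
qed auto

lemma card_nonzeros: "card {x. f x \<noteq> (0 :: 'p mod_ring)} = q - card {x :: 'a. f x = 0}"
proof -
  have "{x. f x \<noteq> 0} = UNIV - {x. f x = 0}" by auto
  thus ?thesis by (simp add: card_Diff_subset q_card)
qed

text \<open>For c = Lam z, completing the square makes the word a translate of Q - Q(z) + h. As u =
  Q(z) is independent of h, varying h visits every level of Q exactly once.\<close>

lemma weight_perp:
  assumes "c \<in> perp"
  obtains u where "\<And>h. card {x. Q x + tr m (c * x) + h \<noteq> 0} = q - N (u - h)"
proof -
  obtain z where z: "c = Lam z" using assms range_Lam by auto
  have "card {x. Q x + tr m (c * x) + h = 0} = N (Q z - h)" for h
  proof -
    have eq: "Q x + tr m (c * x) + h = Q (x + z) - Q z + h" for x
      using polar[of z x] by (simp add: z mult.commute add.commute)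
    have "Q x + tr m (c * x) + h = 0 \<longleftrightarrow> Q (x + z) = Q z - h" for x
      by (simp only: eq diff_add_eq diff_eq_eq eq_diff_eq add_0)
    hence "bij_betw (\<lambda>x. x + z) {x. Q x + tr m (c * x) + h = 0} {x. Q x = Q z - h}"
      by (intro bij_betwI[where g = "\<lambda>x. x - z"]) auto
    thus ?thesis unfolding N_def by (rule bij_betw_same_card)
  qed
  thus ?thesis using that card_nonzeros by simp
qed

text \<open>A radical vector r on which c is nontrivial yields translations that preserve Q and
  shift the linear term by any amount. All levels are equally large, so the weight is the generic q
  - q/p.\<close>

lemma weight_not_perp:
  assumes "c \<notin> perp"
  shows "p * card {x. Q x + tr m (c * x) + h = 0} = q"
proof -
  obtain r where r: "r \<in> Rad" "tr m (c * r) \<noteq> 0" using assms by (auto simp: perp_def)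
  have *: "card {x. Q x + tr m (c * x) + u = 0} = card {x. Q x + tr m (c * x) + v = 0}" for u v
  proof -
    define a where "a = incl ((u - v) / tr m (c * r)) * r"
    \<comment> \<open>Symmetry of the polar form and nondegeneracy of the trace show that
      \<open>Lam\<close> commutes with prime field scalars at r, which puts the multiples of r into
      the radical.\<close>
    have "tr m (y * (incl t * Lam r)) = tr m (y * Lam (incl t * r))" for y t
    proof -
      have "tr m (y * Lam (incl t * r)) = tr m (incl t * (r * Lam y))"
        using tr_Lam_sym[of y "incl t * r"] by (simp add: mult_ac)
      also have "\<dots> = tr m (incl t * (y * Lam r))" using tr_Lam_sym[of y r] by (simp add: tr_scale)
      finally show ?thesis by (simp add: mult_ac)
    qed
    hence "tr m ((Lam (incl t * r) - incl t * Lam r) * y) = 0" for t y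
      by (simp add: ring_distribs tr_diff mult.commute)
    hence Ls: "Lam (incl t * r) = incl t * Lam r" for t
      using tr_nondegenerate[of m "Lam (incl t * r) - incl t * Lam r"] by simp
    have a: "a \<in> Rad" using r by (simp add: a_def Rad_def Ls)
    have "c * a = incl ((u - v) / tr m (c * r)) * (c * r)" by (simp add: a_def)
    hence ta: "tr m (c * a) = u - v" using r by (simp only: tr_scale Fix_m) simp
    have Qa: "Q (x + a) = Q x" for x
      using polar[of x a] tr_Lam_sym[of a x] a Q_Rad[OF a] by (simp add: Rad_def)
    have *: "Q (x + a) + tr m (c * (x + a)) + v = Q x + tr m (c * x) + u" for x
      by (simp add: Qa ring_distribs tr_add ta)
    have **: "Q (x - a) + tr m (c * (x - a)) + u = Q x + tr m (c * x) + v" for x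
      using *[of "x - a"] by simp
    have "bij_betw (\<lambda>x. x + a) {x. Q x + tr m (c * x) + u = 0} {x. Q x + tr m (c * x) + v = 0}"
      by (rule bij_betwI[where g = "\<lambda>x. x - a"])
         (auto simp: * **)
    thus ?thesis by (rule bij_betw_same_card)
  qed
  have "q = card (UNIV :: 'a set)" by (simp add: q_card)
  also have "\<dots> = (\<Sum>t\<in>UNIV. card {x. - (Q x + tr m (c * x)) = t})"
    using sum_fibres[of "\<lambda>_. 1::nat" "\<lambda>x. - (Q x + tr m (c * x))"] by simp
  also have "\<dots> = (\<Sum>t\<in>UNIV. card {x. Q x + tr m (c * x) + t = 0})"
    by (simp only: neg_eq_iff_add_eq_0)
  also have "\<dots> = p * card {x. Q x + tr m (c * x) + h = 0}"
    by (subst *[of _ h]) (simp add: p_card)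
  finally show ?thesis ..
qed

text \<open>Each of the q / card Rad elements of \<open>perp\<close> sees every level of Q once; any
  other c contributes p words of generic weight.\<close>

lemma weight_count_form:
  "real (card {(c, h). real (card {x. Q x + tr m (c * x) + h \<noteq> 0}) = w}) =
     real q / card Rad * card {t. real q - real (N t) = w}
     + (real q - real q / card Rad) * p * (if real q - real q / p = w then 1 else 0)"
proof -
  have le: "N t \<le> q" for t unfolding N_def q_card by (rule card_mono) auto
  have 1: "card {h. real (card {x. Q x + tr m (c * x) + h \<noteq> 0}) = w} = card {t. real q - real (N t) = w}"
    if c: "c \<in> perp" for c
  proof -
    obtain u where u: "\<And>h. card {x. Q x + tr m (c * x) + h \<noteq> 0} = q - N (u - h)"
      using weight_perp[OF c] by blast
    have "bij_betw (\<lambda>h. u - h) {h. real (card {x. Q x + tr m (c * x) + h \<noteq> 0}) = w} {t. real q - real (N t) = w}"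
      by (rule bij_betwI[where g = "\<lambda>h. u - h"]) (auto simp: u of_nat_diff le)
    thus ?thesis by (rule bij_betw_same_card)
  qed
  have 2: "card {h. real (card {x. Q x + tr m (c * x) + h \<noteq> 0}) = w} = p * (if real q - real q / p = w then 1 else 0)"
    if c: "c \<notin> perp" for c
  proof -
    have "real (card {x. Q x + tr m (c * x) + h \<noteq> 0}) = real q - real q / p" for h
    proof -
      have "real (p * card {x. Q x + tr m (c * x) + h = 0}) = real q"
        using weight_not_perp[OF c, of h] by (simp only:)
      hence "real (card {x. Q x + tr m (c * x) + h = 0}) = real q / p"
        using p_gt_1 by (simp add: field_simps)
      moreover have "card {x. Q x + tr m (c * x) + h = 0} \<le> q" unfolding q_card by (rule card_mono) auto
      ultimately show ?thesis by (simp add: card_nonzeros of_nat_diff)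
    qed
    thus ?thesis by (simp add: p_card)
  qed
  have cp: "real (card perp) = real q / card Rad"
    using card_perp card_Rad_pos
    by (metis nonzero_eq_divide_eq of_nat_0_less_iff of_nat_mult order_less_irrefl)
  have "card {(c, h). real (card {x. Q x + tr m (c * x) + h \<noteq> 0}) = w} =
    (\<Sum>c\<in>UNIV. if c \<in> perp then card {t. real q - real (N t) = w} else p * (if real q - real q / p = w then 1 else 0))"
    unfolding card_Collect_pair by (rule sum.cong) (auto simp: 1 2)
  also have "\<dots> = card perp * card {t. real q - real (N t) = w} + (q - card perp) * (p * (if real q - real q / p = w then 1 else 0))"
    by (simp add: sum.If_cases q_card Compl_eq_Diff_UNIV card_Diff_subset)
  finally have "real (card {(c, h). real (card {x. Q x + tr m (c * x) + h \<noteq> 0}) = w}) =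
     real (card perp) * card {t. real q - real (N t) = w} + real (q - card perp) * (p * (if real q - real q / p = w then 1 else 0))"
    by simp
  moreover have "card perp \<le> q" unfolding q_card by (rule card_mono) auto
  ultimately show ?thesis by (simp add: of_nat_diff cp)
qed

end

subsection \<open>The forms of the code\<close>

text \<open>Coordinates with respect to a basis; the dimension of the code will be read off from the
  number of its words.\<close>

lemma card_subspace:
  fixes S :: "('f::{field,finite} ^ 'n::finite) set"
  assumes "vec.subspace S"
  shows "card S = CARD('f) ^ vec.dim S"
proof -
  obtain B where B: "B \<subseteq> S" "vec.independent B" "S \<subseteq> vec.span B" "card B = vec.dim S"
    by (rule vec.basis_exists)
  have fin: "finite B" by simp
  have span: "vec.span B = S"
    by (rule subset_antisym[OF vec.span_minimal[OF B(1) assms] B(3)])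
  define \<Phi> where "\<Phi> u = (\<Sum>v\<in>B. u v *s v)" for u :: "'f ^ 'n \<Rightarrow> 'f"
  have "bij_betw \<Phi> (B \<rightarrow>\<^sub>E UNIV) S"
    unfolding bij_betw_def
  proof
    show "inj_on \<Phi> (B \<rightarrow>\<^sub>E UNIV)"
    proof (rule inj_onI)
      fix u v assume uv: "u \<in> B \<rightarrow>\<^sub>E UNIV" "v \<in> B \<rightarrow>\<^sub>E UNIV" "\<Phi> u = \<Phi> v"
      have "(\<Sum>x\<in>B. (u x - v x) *s x) = 0"
        using uv(3) by (simp add: \<Phi>_def vec.scale_left_diff_distrib sum_subtractf)
      hence "u x = v x" if "x \<in> B" for x
        using vec.independentD[OF B(2) fin subset_refl, of "\<lambda>x. u x - v x" x] that by auto
      thus "u = v" using uv by (intro PiE_ext) auto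
    qed
    show "\<Phi> ` (B \<rightarrow>\<^sub>E UNIV) = S"
    proof
      show "\<Phi> ` (B \<rightarrow>\<^sub>E UNIV) \<subseteq> S"
        using B assms by (auto simp: \<Phi>_def intro!: vec.subspace_sum vec.subspace_scale)
      show "S \<subseteq> \<Phi> ` (B \<rightarrow>\<^sub>E UNIV)"
      proof
        fix x assume "x \<in> S"
        hence "x \<in> vec.span B" using span by simp
        then obtain u where u: "x = (\<Sum>v\<in>B. u v *s v)"
          unfolding vec.span_finite[OF fin] by auto
        show "x \<in> \<Phi> ` (B \<rightarrow>\<^sub>E UNIV)"
        proof (rule image_eqI)
          show "x = \<Phi> (restrict u B)" unfolding u \<Phi>_def by (intro sum.cong) auto
        qed simp
      qed
    qed
  qed
  hence "card S = card (B \<rightarrow>\<^sub>E (UNIV :: 'f set))" by (simp add: bij_betw_same_card)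
  also have "\<dots> = CARD('f) ^ card B" using fin by (simp add: card_funcsetE)
  finally show ?thesis using B by simp
qed

locale kasami = odd_extension m p q base ext
  for m p q :: nat and base :: "'p::prime_card itself" and ext :: "'a::{field,finite} itself" +
  fixes s l d :: nat
  assumes m_eq: "m = 2 * s" and l_le: "l \<le> m - 1" and l_neq_s: "l \<noteq> s" and d_eq: "d = gcd s l"
begin

lemma s_pos: "s > 0" using m_pos m_eq by simp

lemma s_dvd_m: "s dvd m" using m_eq by simp

lemma d_pos: "d > 0" using d_eq s_pos by simp

lemma d_dvd: "d dvd s" "d dvd l" "d dvd m" using d_eq s_dvd_m by (auto intro: dvd_trans[of _ s])

lemma q_sq: "q = (p ^ s)\<^sup>2" by (simp add: q_eq m_eq power_mult mult.commute)

abbreviation tau :: "'a \<Rightarrow> 'a" where "tau \<equiv> fr s"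
abbreviation sg :: "'a \<Rightarrow> 'a" where "sg \<equiv> fr l"
abbreviation sgi :: "'a \<Rightarrow> 'a" where "sgi \<equiv> fr (m - l)"
abbreviation F :: "'a set" where "F \<equiv> Fix s"
abbreviation K :: "'a set" where "K \<equiv> Fix d"

lemma tau_tau [simp]: "tau (tau x) = x"
  using fr_m[of x] by (simp add: fr_fr m_eq mult_2)

lemma sg_sgi [simp]: "sg (sgi x) = x" "sgi (sg x) = x"
  using l_le by (simp_all add: fr_fr)

lemma fr_comm: "fr i (fr j x) = fr j (fr i x)"
  by (simp add: fr_fr add.commute)

lemma card_F: "card F = p ^ s" by (rule card_Fix[OF s_dvd_m])

lemma card_K: "card K = p ^ d" by (rule card_Fix[OF d_dvd(3)])

lemma K_F: "x \<in> K \<Longrightarrow> x \<in> F" using Fix_dvd[OF d_dvd(1)] by auto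

lemma sg_K: "x \<in> K \<Longrightarrow> sg x = x" using Fix_dvd[OF d_dvd(2)] by (auto simp: Fix_iff)

lemma norm_F: "x * tau x \<in> F" by (simp add: Fix_iff mult.commute)

lemma tr_m_eq: "tr m x = tr s (x + tau x)"
  using tr_double[of x s] by (simp add: m_eq[symmetric])

definition Qf :: "'a \<Rightarrow> 'a \<Rightarrow> 'a \<Rightarrow> 'p mod_ring" where
  "Qf a b x = tr s (a * (x * tau x)) + tr m (b * (x * sg x))"

text \<open>The factor of y in the polar form of \<open>Qf a b\<close>. The term with
  \<open>sgi\<close>, the inverse of \<open>sg\<close>, arises from the mixed term b x sg(y) when
  the Frobenius is taken off y under the trace.\<close>

definition Lm :: "'a \<Rightarrow> 'a \<Rightarrow> 'a \<Rightarrow> 'a" where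
  "Lm a b x = a * tau x + b * sg x + sgi (b * x)"

definition R :: "'a \<Rightarrow> 'a \<Rightarrow> 'a set" where "R a b = {x. Lm a b x = 0}"

definition S :: "'a \<Rightarrow> 'a \<Rightarrow> complex" where "S a b = (\<Sum>x\<in>UNIV. psi (Qf a b x))"

lemma quadratic_form_Qf:
  assumes a: "a \<in> F"
  shows "quadratic_form m p q (Qf a b) (Lm a b)"
proof unfold_locales
  fix x y :: 'a and t :: "'p mod_ring"
  \<comment> \<open>The mixed part of a x tau(x) is w + tau(w), and its trace from degree s is the
    trace of w from degree m.\<close>
  define w where "w = a * tau x * y"
  have ta: "tau a = a" using a by (simp add: Fix_iff)
  have F: "a * (x * tau x) \<in> F" "a * (y * tau y) \<in> F" "w + tau w \<in> F"
    using norm_F a by (auto simp: Fix_iff w_def)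
  have "a * ((x + y) * tau (x + y)) = a * (x * tau x) + a * (y * tau y) + (w + tau w)"
    by (simp add: w_def ta algebra_simps)
  hence 1: "tr s (a * ((x + y) * tau (x + y))) = tr s (a * (x * tau x)) + tr s (a * (y * tau y)) + tr m w"
    unfolding tr_m_eq using F by (simp add: tr_add Fix_add)
  have "b * ((x + y) * sg (x + y)) = b * (x * sg x) + b * (y * sg y) + b * sg x * y + b * x * sg y"
    by (simp add: algebra_simps)
  hence 2: "tr m (b * ((x + y) * sg (x + y))) =
      tr m (b * (x * sg x)) + tr m (b * (y * sg y)) + tr m (b * sg x * y) + tr m (b * x * sg y)"
    by (simp only: tr_add Fix_m)
  have "sgi (b * x * sg y) = sgi (b * x) * y" by simp
  hence 3: "tr m (b * x * sg y) = tr m (sgi (b * x) * y)" by (metis tr_fr Fix_m)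
  have "y * Lm a b x = w + b * sg x * y + sgi (b * x) * y"
    by (simp add: Lm_def w_def algebra_simps)
  hence "tr m (y * Lm a b x) = tr m w + tr m (b * sg x * y) + tr m (sgi (b * x) * y)"
    by (simp only: tr_add Fix_m)
  thus "Qf a b (x + y) = Qf a b x + Qf a b y + tr m (y * Lm a b x)"
    using 1 2 3 by (simp add: Qf_def)
  have "tr s (a * (incl t * x * tau (incl t * x))) = tr s (incl (t * t) * (a * (x * tau x)))"
    by (simp add: mult_ac)
  also have "\<dots> = t * t * tr s (a * (x * tau x))" using F by (simp only: tr_scale)
  finally have 1: "tr s (a * (incl t * x * tau (incl t * x))) = t * t * tr s (a * (x * tau x))" .
  have "tr m (b * (incl t * x * sg (incl t * x))) = tr m (incl (t * t) * (b * (x * sg x)))"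
    by (simp add: mult_ac)
  also have "\<dots> = t * t * tr m (b * (x * sg x))" by (simp only: tr_scale Fix_m)
  finally show "Qf a b (incl t * x) = t\<^sup>2 * Qf a b x"
    using 1 by (simp add: Qf_def power2_eq_square ring_distribs)
  show "Lm a b (x + y) = Lm a b x + Lm a b y"
    by (simp add: Lm_def algebra_simps)
qed

lemma Rad_eq: "a \<in> F \<Longrightarrow> quadratic_form.Rad (Lm a b) = R a b"
  using quadratic_form.Rad_def[OF quadratic_form_Qf] by (auto simp: R_def)

lemma T_eq: "a \<in> F \<Longrightarrow> quadratic_form.T p (Qf a b) = S a b"
  using quadratic_form.T_def[OF quadratic_form_Qf] by (auto simp: S_def)

lemma S_cnj_S: "a \<in> F \<Longrightarrow> S a b * cnj (S a b) = of_nat (q * card (R a b))"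
  using quadratic_form.T_cnj_T[OF quadratic_form_Qf[of a b]] by (simp only: T_eq Rad_eq)

lemma R_0: "0 \<in> R a b" by (simp add: R_def Lm_def)

lemma card_R_pos: "card (R a b) > 0" using R_0 by (auto simp: card_gt_0_iff)

definition V :: "'a \<Rightarrow> 'a \<Rightarrow> real \<Rightarrow> real" where
  "V a b w = real (card {(c, h). real (card {x. Qf a b x + tr m (c * x) + h \<noteq> 0}) = w})"

text \<open>
  V a b w counts the pairs (c, h) whose word has weight w. It equals W r e eps w if the radical
  has order r with q r = p^(2e) and the exponential sum is eps p^e, and W_odd r e w if
  q r = p^(2e+1).
\<close>

definition W :: "nat \<Rightarrow> nat \<Rightarrow> real \<Rightarrow> real \<Rightarrow> real" where
  "W r e eps w = real q / r * ((if real q - (real q / p + eps * (real p - 1) * real p ^ e / p) = w then 1 else 0)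
      + (real p - 1) * (if real q - (real q / p - eps * real p ^ e / p) = w then 1 else 0))
    + (real q - real q / r) * p * (if real q - real q / p = w then 1 else 0)"

definition W_odd :: "nat \<Rightarrow> nat \<Rightarrow> real \<Rightarrow> real" where
  "W_odd r e w = real q / r * ((if real q - real q / p = w then 1 else 0)
      + (real p - 1) / 2 * (if real q - (real q / p + real p ^ e) = w then 1 else 0)
      + (real p - 1) / 2 * (if real q - (real q / p - real p ^ e) = w then 1 else 0))
    + (real q - real q / r) * p * (if real q - real q / p = w then 1 else 0)"

lemma S_even:
  assumes "a \<in> F" "q * card (R a b) = p ^ (2 * e)"
  obtains eps :: int where "eps \<in> {1, -1}" "S a b = of_int (eps * int p ^ e)"
    "V a b = W (card (R a b)) e eps"
    "int (card {x. Qf a b x = 0}) - int (card {x. Qf a b x = 1}) = eps * int p ^ e"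
proof -
  interpret f: quadratic_form m p q base ext "Qf a b" "Lm a b" by (rule quadratic_form_Qf[OF assms(1)])
  have "q * card f.Rad = p ^ (2 * e)" using assms Rad_eq by simp
  from f.even_rank[OF this] obtain eps :: int where eps: "eps \<in> {1, -1}" "f.T = of_int (eps * int p ^ e)"
    "real (f.N 0) = real q / p + eps * (real p - 1) * real p ^ e / p"
    "\<And>t. t \<noteq> 0 \<Longrightarrow> real (f.N t) = real q / p - eps * real p ^ e / p"
    "int (f.N 0) - int (f.N 1) = eps * int p ^ e" by blast
  have "V a b w = W (card (R a b)) e eps w" for w
  proof -
    have "real (card {t. real q - real (f.N t) = w}) =
        (if real q - (real q / p + eps * (real p - 1) * real p ^ e / p) = w then 1 else 0)
        + (real p - 1) * (if real q - (real q / p - eps * real p ^ e / p) = w then 1 else 0)"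
      by (rule f.card_level_even[OF eps(3)]) (rule eps(4))
    thus ?thesis unfolding V_def W_def f.weight_count_form Rad_eq[OF assms(1)] by (simp only:)
  qed
  hence "V a b = W (card (R a b)) e eps" by (rule ext)
  moreover have "S a b = of_int (eps * int p ^ e)" using eps(2) T_eq[OF assms(1)] by (simp only:)
  moreover have "int (card {x. Qf a b x = 0}) - int (card {x. Qf a b x = 1}) = eps * int p ^ e"
    using eps(5) by (simp only: f.N_def)
  ultimately show ?thesis using that[OF eps(1)] by blast
qed

text \<open>A value of S found by other means identifies the sign that \<open>S_even\<close> leaves
  open.\<close>

lemma V_even:
  assumes "a \<in> F" "q * card (R a b) = p ^ (2 * e)" "S a b = of_int (eps * int p ^ e)"
  shows "V a b = W (card (R a b)) e eps"
proof -
  obtain eps' :: int where *: "S a b = of_int (eps' * int p ^ e)" "V a b = W (card (R a b)) e eps'"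
    using S_even[OF assms(1,2)] by blast
  have "eps * int p ^ e = eps' * int p ^ e" using *(1) assms(3) by (simp only: of_int_eq_iff)
  thus ?thesis using *(2) p_gt_1 by simp
qed

lemma V_odd:
  assumes "a \<in> F" "q * card (R a b) = p ^ (2 * e + 1)"
  shows "V a b = W_odd (card (R a b)) e"
proof
  fix w
  interpret f: quadratic_form m p q base ext "Qf a b" "Lm a b" by (rule quadratic_form_Qf[OF assms(1)])
  have "q * card f.Rad = p ^ (2 * e + 1)" using assms Rad_eq by simp
  thus "V a b w = W_odd (card (R a b)) e w"
  proof (rule f.odd_rank)
    fix x y
    assume xy: "\<And>t. t \<in> Sq \<Longrightarrow> f.N t = x" "\<And>t. t \<noteq> 0 \<Longrightarrow> t \<notin> Sq \<Longrightarrow> f.N t = y"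
      "real (f.N 0) = real q / p" "{real x, real y} = {real q / p + real p ^ e, real q / p - real p ^ e}"
    have "real (card {t. real q - real (f.N t) = w}) = (if real q - real q / p = w then 1 else 0)
      + (real p - 1) / 2 * (if real q - (real q / p + real p ^ e) = w then 1 else 0)
      + (real p - 1) / 2 * (if real q - (real q / p - real p ^ e) = w then 1 else 0)"
      by (rule f.card_level_odd[OF _ _ xy(3,4)]) (use xy in auto)
    thus ?thesis unfolding V_def W_odd_def f.weight_count_form Rad_eq[OF assms(1)] by (simp only:)
  qed
qed

section \<open>The zero pair, scaling of x, and incidences with radicals\<close>

lemma Qf_0_0: "Qf 0 0 x = 0" by (simp add: Qf_def)

lemma R_0_0: "R 0 0 = UNIV" by (simp add: R_def Lm_def)

lemma S_0_0: "S 0 0 = of_nat q" by (simp add: S_def Qf_0_0 q_card)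

text \<open>The zero form has radical order q and sum q = p^m, so it fits the even pattern with e =
  m and sign 1.\<close>

lemma V_0_0: "V 0 0 = W q m 1"
proof -
  have "V 0 0 = W (card (R 0 0)) m (of_int 1)"
    by (rule V_even) (simp_all add: R_0_0 S_0_0 q_card[symmetric] q_eq mult_2 power_add)
  thus ?thesis by (simp add: R_0_0 q_card[symmetric])
qed

text \<open>Scaling the argument becomes an action on coefficient pairs, under which a stays in F
  because x tau(x) is a norm. The radical order and S are constant along it.\<close>

lemma Qf_scale: "Qf a b (x * y) = Qf (a * (x * tau x)) (b * (x * sg x)) y"
  by (simp add: Qf_def mult_ac)

lemma Lm_scale: "Lm (a * (x * tau x)) (b * (x * sg x)) y = x * Lm a b (x * y)"
  by (simp add: Lm_def algebra_simps)

lemma S_scale: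
  assumes "x \<noteq> 0"
  shows "S (a * (x * tau x)) (b * (x * sg x)) = S a b"
proof -
  have "bij_betw ((*) x) UNIV UNIV"
    by (rule bij_betwI[where g = "\<lambda>y. y / x"]) (use assms in auto)
  from sum.reindex_bij_betw[OF this, of "\<lambda>y. psi (Qf a b y)"] show ?thesis
    by (simp add: S_def Qf_scale)
qed

lemma R_scale:
  assumes "x \<noteq> 0"
  shows "y \<in> R (a * (x * tau x)) (b * (x * sg x)) \<longleftrightarrow> x * y \<in> R a b"
  using assms by (simp add: R_def Lm_scale)

lemma card_R_scale:
  assumes "x \<noteq> 0"
  shows "card (R (a * (x * tau x)) (b * (x * sg x))) = card (R a b)"
proof -
  have "bij_betw ((*) x) (R (a * (x * tau x)) (b * (x * sg x))) (R a b)"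
    by (rule bij_betwI[where g = "\<lambda>y. y / x"]) (use assms in \<open>auto simp: R_scale\<close>)
  thus ?thesis by (rule bij_betw_same_card)
qed

definition P :: "('a \<times> 'a) set" where "P = F \<times> UNIV - {(0, 0)}"

lemma P_iff: "(a, b) \<in> P \<longleftrightarrow> a \<in> F \<and> (a, b) \<noteq> (0, 0)" by (simp add: P_def)

lemma card_P: "card P = p ^ s * q - 1"
  unfolding P_def by (subst card_Diff_singleton) (auto simp: card_cartesian_product card_F q_card)

lemma real_card_P: "real (card P) = (real p ^ s) ^ 3 - 1"
proof -
  have "1 \<le> p ^ s * q" using p_gt_1 by (simp add: q_eq Suc_le_eq)
  hence "real (card P) = real p ^ s * real q - 1" by (simp add: card_P of_nat_diff)
  thus ?thesis by (simp add: q_sq power2_eq_square power3_eq_cube)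
qed

text \<open>Double counting of forms and nonzero radical elements x; the subtracted 1 accounts for x
  = 0. Rescaling by x permutes P and moves x to 1, so all q - 1 inner sums agree.\<close>

lemma incidence:
  fixes g :: "'a \<times> 'a \<Rightarrow> complex"
  assumes "\<And>x a b. x \<noteq> 0 \<Longrightarrow> g (a * (x * tau x), b * (x * sg x)) = g (a, b)"
  shows "(\<Sum>(a, b)\<in>P. (of_nat (card (R a b)) - 1) * g (a, b)) =
    (of_nat q - 1) * (\<Sum>(a, b)\<in>{(a, b) \<in> P. 1 \<in> R a b}. g (a, b))"
proof -
  have c: "of_nat (card (R a b)) - 1 = (\<Sum>x\<in>UNIV - {0}. if x \<in> R a b then 1 else 0 :: complex)" for a b
  proof -
    have "(\<Sum>x\<in>UNIV - {0}. if x \<in> R a b then 1 else 0 :: complex) = of_nat (card (R a b - {0}))"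
      by (simp add: sum.If_cases Diff_eq Int_commute)
    also have "card (R a b - {0}) = card (R a b) - 1"
      using R_0 by (simp add: card_Diff_singleton)
    finally show ?thesis using card_R_pos[of a b] by (simp add: of_nat_diff)
  qed
  have "(\<Sum>(a, b)\<in>P. (of_nat (card (R a b)) - 1) * g (a, b)) =
      (\<Sum>ab\<in>P. \<Sum>x\<in>UNIV - {0}. (if x \<in> R (fst ab) (snd ab) then 1 else 0) * g ab)"
    unfolding c by (simp add: sum_distrib_right case_prod_beta)
  also have "\<dots> = (\<Sum>x\<in>UNIV - {0}. \<Sum>ab\<in>P. (if x \<in> R (fst ab) (snd ab) then 1 else 0) * g ab)"
    by (rule sum.swap)
  also have "\<dots> = (\<Sum>x\<in>UNIV - {0 :: 'a}. \<Sum>ab\<in>P. (if 1 \<in> R (fst ab) (snd ab) then 1 else 0) * g ab)"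
  proof (rule sum.cong[OF refl])
    fix x :: 'a assume "x \<in> UNIV - {0}"
    hence x: "x \<noteq> 0" by simp
    have n: "x * tau x \<noteq> 0" "x * sg x \<noteq> 0" using x by auto
    have bij: "bij_betw (\<lambda>(a, b). (a * (x * tau x), b * (x * sg x))) P P"
      by (rule bij_betwI[where g = "\<lambda>(a, b). (a / (x * tau x), b / (x * sg x))"])
         (use n in \<open>auto simp: P_iff intro!: Fix_mult Fix_divide norm_F\<close>)
    show "(\<Sum>ab\<in>P. (if x \<in> R (fst ab) (snd ab) then 1 else 0) * g ab) =
        (\<Sum>ab\<in>P. (if 1 \<in> R (fst ab) (snd ab) then 1 else 0) * g ab)"
      by (subst sum.reindex_bij_betw[OF bij, symmetric]) (rule sum.cong, auto simp: R_scale x assms)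
  qed
  also have "\<dots> = (of_nat q - 1) * (\<Sum>ab\<in>P. (if 1 \<in> R (fst ab) (snd ab) then 1 else 0) * g ab)"
    using q_eq p_gt_1 by (simp add: card_Diff_singleton q_card[symmetric] of_nat_diff)
  also have "(\<Sum>ab\<in>P. (if 1 \<in> R (fst ab) (snd ab) then 1 else 0) * g ab) =
      (\<Sum>(a, b)\<in>{(a, b) \<in> P. 1 \<in> R a b}. g (a, b))"
    by (simp add: if_distrib if_distribR cong: if_cong)
       (auto simp: sum.inter_filter[symmetric] intro!: sum.cong)
  finally show ?thesis .
qed

text \<open>The sum over b kills every x with x sg(x) nonzero, so only x = 0 contributes.\<close>

lemma sum_S: "(\<Sum>(a, b)\<in>F \<times> UNIV. S a b) = of_nat (p ^ s * q)"
proof -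
  have *: "(\<Sum>b\<in>UNIV. psi (tr m (b * y))) = (if y = 0 then of_nat q else 0)" for y
  proof -
    have "Fix m = UNIV" by auto
    thus ?thesis using sum_psi_tr[of m y] by (simp add: mult.commute q_eq)
  qed
  have "(\<Sum>(a, b)\<in>F \<times> UNIV. S a b) = (\<Sum>x\<in>UNIV. \<Sum>(a, b)\<in>F \<times> UNIV. psi (Qf a b x))"
    unfolding S_def case_prod_beta by (rule sum.swap)
  also have "\<dots> = (\<Sum>x\<in>UNIV. \<Sum>a\<in>F. \<Sum>b\<in>UNIV. psi (tr s (a * (x * tau x))) * psi (tr m (b * (x * sg x))))"
    by (simp add: sum.cartesian_product[symmetric] Qf_def psi_add)
  also have "\<dots> = (\<Sum>x\<in>UNIV. \<Sum>a\<in>F. psi (tr s (a * (x * tau x))) * (if x = 0 then of_nat q else 0))"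
    by (simp add: sum_distrib_left[symmetric] *)
  also have "\<dots> = (\<Sum>x\<in>UNIV. if x = (0::'a) then of_nat (p ^ s * q) else 0)"
    by (rule sum.cong) (auto simp: card_F)
  also have "\<dots> = of_nat (p ^ s * q)" by (simp add: sum.delta)
  finally show ?thesis .
qed

lemma sum_P: "f (0, 0) + (\<Sum>ab\<in>P. f ab) = (\<Sum>ab\<in>F \<times> UNIV. f ab)" for f :: "'a \<times> 'a \<Rightarrow> 'z::comm_monoid_add"
  unfolding P_def by (rule sum.remove[symmetric]) auto

section \<open>The code as a vector space and the count of its words\<close>

definition word :: "'a \<Rightarrow> 'a \<Rightarrow> 'a \<Rightarrow> 'p mod_ring \<Rightarrow> ('p mod_ring, 'a) vec" where
  "word a b c h = kasami_word s l a b c h"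

lemma word_nth: "word a b c h $ x = Qf a b x + tr m (c * x) + h"
proof -
  have x: "x ^ (p ^ k + 1) = x * fr k x" for k by (simp add: fr_def)
  moreover have "tr m (b * (x * sg x) + c * x) = tr m (b * (x * sg x)) + tr m (c * x)"
    by (simp add: tr_add)
  ultimately show ?thesis
    by (simp only: word_def kasami_word_def p_card[symmetric] m_eq[symmetric] Qf_def x vec_lambda_beta add.assoc)
qed

definition code :: "('p mod_ring, 'a) vec set" where "code = kasami_code s l"

lemma code_eq: "code = (\<lambda>(a, b, c, h). word a b c h) ` (F \<times> UNIV)"
  unfolding code_def kasami_code_def word_def[symmetric] p_card[symmetric] subfield_of_order_def
  by (auto simp: Fix_def fr_def image_iff) blast

lemma word_add: "a \<in> F \<Longrightarrow> a' \<in> F \<Longrightarrow> word a b c h + word a' b' c' h' = word (a + a') (b + b') (c + c') (h + h')"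
  using norm_F by (simp add: vec_eq_iff word_nth Qf_def ring_distribs tr_add Fix_mult)

lemma word_scale:
  assumes "a \<in> F"
  shows "t *s word a b c h = word (incl t * a) (incl t * b) (incl t * c) (t * h)"
proof -
  have "tr s (incl t * a * (x * tau x)) = t * tr s (a * (x * tau x))" for x
    using tr_scale[of "a * (x * tau x)" s t] assms norm_F by (simp add: Fix_mult mult.assoc)
  moreover have "tr m (incl t * y * z) = t * tr m (y * z)" for y z
    using tr_scale[of "y * z" m t] by (simp add: mult.assoc)
  ultimately show ?thesis by (simp add: vec_eq_iff word_nth Qf_def ring_distribs)
qed

lemma subspace_code: "vec.subspace code"
  unfolding vec.subspace_def
proof (intro conjI ballI allI)
  have "word 0 0 0 0 = 0" by (simp add: vec_eq_iff word_nth Qf_def)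
  thus "0 \<in> code" unfolding code_eq by (force simp: image_iff)
next
  fix u v assume "u \<in> code" "v \<in> code"
  then obtain a b c h a' b' c' h' where "a \<in> F" "a' \<in> F" "u = word a b c h" "v = word a' b' c' h'"
    unfolding code_eq by auto
  thus "u + v \<in> code" unfolding code_eq
    by (intro image_eqI[where x = "(a + a', b + b', c + c', h + h')"]) (auto simp: word_add)
next
  fix t u assume "u \<in> code"
  then obtain a b c h where "a \<in> F" "u = word a b c h" unfolding code_eq by auto
  thus "t *s u \<in> code" unfolding code_eq
    by (intro image_eqI[where x = "(incl t * a, incl t * b, incl t * c, t * h)"]) (auto simp: word_scale)
qed

text \<open>Comparing x with -x separates the even part, the form, from the odd part, the linear
  term. A form that vanishes identically has full radical, which the last hypothesis excludes
  outside (0, 0).\<close>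

lemma word_eq_0:
  assumes "a \<in> F" "word a b c h = 0" "\<And>a b. (a, b) \<in> P \<Longrightarrow> card (R a b) < q"
  shows "a = 0 \<and> b = 0 \<and> c = 0 \<and> h = 0"
proof -
  interpret f: quadratic_form m p q base ext "Qf a b" "Lm a b" by (rule quadratic_form_Qf[OF assms(1)])
  have *: "Qf a b x + tr m (c * x) + h = 0" for x
    using assms(2) by (metis word_nth zero_index)
  have h: "h = 0" using *[of 0] by simp
  have **: "Qf a b x + tr m (c * x) = 0" "Qf a b x - tr m (c * x) = 0" for x
    using *[of x] *[of "- x"] by (simp_all add: h tr_minus)
  have "2 * Qf a b x = 0" for x using **[of x] by (simp only: mult_2) (simp add: eq_neg_iff_add_eq_0)
  hence Q: "Qf a b x = 0" for x by simp
  hence "tr m (c * x) = 0" for x using ** by simp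
  hence c: "c = 0" using tr_nondegenerate[of m c] by simp
  have "tr m (Lm a b x * y) = 0" for x y using f.polar[of x y] by (simp add: Q mult.commute)
  hence "Lm a b x = 0" for x using tr_nondegenerate[of m "Lm a b x"] by simp
  hence "R a b = UNIV" by (simp add: R_def)
  hence "card (R a b) = q" by (simp add: q_card)
  hence "(a, b) \<notin> P" using assms(3) by fastforce
  thus ?thesis using assms(1) h c by (simp add: P_iff)
qed

lemma inj_word:
  assumes "\<And>a b. (a, b) \<in> P \<Longrightarrow> card (R a b) < q"
  shows "inj_on (\<lambda>(a, b, c, h). word a b c h) (F \<times> UNIV)"
proof (rule inj_onI)
  fix u v
  assume uv: "u \<in> F \<times> UNIV" "v \<in> F \<times> UNIV"
    "(case u of (a, b, c, h) \<Rightarrow> word a b c h) = (case v of (a, b, c, h) \<Rightarrow> word a b c h)"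
  obtain a b c h where u: "u = (a, b, c, h)" by (cases u) auto
  obtain a' b' c' h' where v: "v = (a', b', c', h')" by (cases v) auto
  have *: "a \<in> F" "a' \<in> F" "word a b c h = word a' b' c' h'" using uv by (auto simp: u v)
  have "word (a - a') (b - b') (c - c') (h - h') + word a' b' c' h' = word a b c h"
    using * by (subst word_add) auto
  hence "word (a - a') (b - b') (c - c') (h - h') = 0" using * by simp
  from word_eq_0[OF _ this assms] * show "u = v" by (auto simp: u v)
qed

lemma dim_code:
  assumes "\<And>a b. (a, b) \<in> P \<Longrightarrow> card (R a b) < q"
  shows "vec.dim code = 5 * s + 1"
proof -
  have "card code = card (F \<times> (UNIV :: ('a \<times> 'a \<times> 'p mod_ring) set))"
    unfolding code_eq by (rule card_image[OF inj_word[OF assms]])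
  also have "\<dots> = p ^ s * (q * (q * p))"
    by (simp add: card_cartesian_product card_F q_card[symmetric] p_card[symmetric] flip: UNIV_Times_UNIV)
  also have "\<dots> = p ^ (5 * s + 1)" by (simp add: q_eq m_eq power_add[symmetric] power_Suc2[symmetric] del: power_Suc)
  finally have "p ^ vec.dim code = p ^ (5 * s + 1)"
    using card_subspace[OF subspace_code] by (simp add: p_card[symmetric])
  thus ?thesis using p_gt_1 by (simp only: power_inject_exp)
qed

text \<open>The pair (0, 0) is split off since its radical is everything. The weight w is an
  arbitrary real, so that the count can be compared with a table also away from the
  integers.\<close>

lemma card_weight:
  assumes "\<And>a b. (a, b) \<in> P \<Longrightarrow> card (R a b) < q"
  shows "real (card {v \<in> code. real (hamming_weight v) = w}) = W q m 1 w + (\<Sum>(a, b)\<in>P. V a b w)"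
proof -
  let ?wt = "\<lambda>a b c h. real (card {x. Qf a b x + tr m (c * x) + h \<noteq> 0})"
  have "{v \<in> code. real (hamming_weight v) = w} =
      (\<lambda>(a, b, c, h). word a b c h) ` {(a, b, c, h). a \<in> F \<and> ?wt a b c h = w}" (is "_ = _ ` ?A")
    unfolding code_eq hamming_weight_def by (auto simp: word_nth image_iff) blast
  moreover have "inj_on (\<lambda>(a, b, c, h). word a b c h) ?A"
    by (rule inj_on_subset[OF inj_word[OF assms]]) auto
  ultimately have "card {v \<in> code. real (hamming_weight v) = w} = card ?A" by (simp add: card_image)
  also have "\<dots> = card (Sigma (F \<times> UNIV) (\<lambda>(a, b). {(c, h). ?wt a b c h = w}))"
    by (rule bij_betw_same_card[of "\<lambda>(a, b, c, h). ((a, b), (c, h))"],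
        rule bij_betwI[where g = "\<lambda>((a, b), (c, h)). (a, b, c, h)"]) auto
  also have "\<dots> = (\<Sum>(a, b)\<in>F \<times> UNIV. card {(c, h). ?wt a b c h = w})"
    by (subst card_SigmaI) (auto intro!: sum.cong)
  finally have "real (card {v \<in> code. real (hamming_weight v) = w}) = (\<Sum>(a, b)\<in>F \<times> UNIV. V a b w)"
    by (simp add: V_def case_prod_beta)
  also have "\<dots> = V 0 0 w + (\<Sum>(a, b)\<in>P. V a b w)"
    using sum_P[of "\<lambda>(a, b). V a b w"] by simp
  finally show ?thesis by (simp add: V_0_0)
qed

end

section \<open>Symmetric and antisymmetric parts; sign counts from sums of S\<close>

context kasami
begin

text \<open>Eigenspaces for 1 and -1 of the involution that \<open>fr k\<close> induces on
  \<open>Fix (2 * k)\<close>. Used with k = s to split sums and with k = d to count the elements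
  negated by \<open>fr d\<close>.\<close>

lemma bij_Fix_anti_Fix:
  "bij_betw (\<lambda>(u, z). u + z) (Fix k \<times> {z. fr k z = - z}) (Fix (2 * k))"
proof -
  have two: "(x + x) / 2 = x" for x :: 'a by (simp only: mult_2[symmetric]) simp
  show ?thesis
  proof (rule bij_betwI[where g = "\<lambda>x. ((x + fr k x) / 2, (x - fr k x) / 2)"])
    have fix2: "x \<in> Fix (2 * k) \<longleftrightarrow> fr k (fr k x) = x" for x by (simp add: Fix_iff fr_fr mult_2)
    show "(\<lambda>(u, z). u + z) \<in> Fix k \<times> {z. fr k z = - z} \<rightarrow> Fix (2 * k)"
    proof clarify
      fix u z assume "u \<in> Fix k" "fr k z = - z"
      moreover from this have "fr k u = u" by (simp only: Fix_iff)
      ultimately show "u + z \<in> Fix (2 * k)" by (simp add: fix2)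
    qed
    show "(\<lambda>x. ((x + fr k x) / 2, (x - fr k x) / 2)) \<in> Fix (2 * k) \<rightarrow> Fix k \<times> {z. fr k z = - z}"
      by (auto simp: Fix_iff fr_fr mult_2 add.commute minus_divide_left)
    show "(case ((x + fr k x) / 2, (x - fr k x) / 2) of (u, z) \<Rightarrow> u + z) = x" for x
      by (simp add: add_divide_distrib[symmetric] two)
  qed (auto simp: Fix_iff two)
qed

definition Alt :: "'a set" where "Alt = {z. tau z = - z}"

lemma sum_decompose: "(\<Sum>x\<in>UNIV. f x) = (\<Sum>u\<in>F. \<Sum>z\<in>Alt. f (u + z))"
proof -
  have "Fix m = UNIV" by auto
  hence "Fix (2 * s) = UNIV" by (simp only: m_eq)
  hence "bij_betw (\<lambda>(u, z). u + z) (F \<times> Alt) UNIV"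
    using bij_Fix_anti_Fix[of s] by (simp add: Alt_def)
  from sum.reindex_bij_betw[OF this, of f] show ?thesis
    by (simp add: sum.cartesian_product case_prod_beta)
qed

text \<open>V is an affine function of the sign, and the sign is Re S / p^e. Summing shows that the
  total of S alone decides how often each sign occurs.\<close>

lemma sum_V_even:
  assumes A: "A \<subseteq> P" "\<And>a b. (a, b) \<in> A \<Longrightarrow> card (R a b) = r" "q * r = p ^ (2 * e)"
    and \<sigma>: "(\<Sum>(a, b)\<in>A. S a b) = of_real \<sigma>"
  shows "(\<Sum>(a, b)\<in>A. V a b w) =
    (real (card A) + \<sigma> / real p ^ e) / 2 * W r e 1 w + (real (card A) - \<sigma> / real p ^ e) / 2 * W r e (- 1) w"
proof -
  have "V a b w = (1 + Re (S a b) / real p ^ e) / 2 * W r e 1 w + (1 - Re (S a b) / real p ^ e) / 2 * W r e (- 1) w"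
    if ab: "(a, b) \<in> A" for a b
  proof -
    have a: "a \<in> F" using ab A(1) by (auto simp: P_iff)
    have r: "card (R a b) = r" using A(2) ab by auto
    obtain eps :: int where eps: "eps \<in> {1, -1}" "S a b = of_int (eps * int p ^ e)" "V a b = W r e eps"
      using S_even[OF a, of b e] A(3) by (auto simp only: r)
    have "Re (S a b) = eps * real p ^ e" unfolding eps(2) by simp
    hence "Re (S a b) / real p ^ e = eps" using p_gt_1 by simp
    thus ?thesis using eps(1,3) by auto
  qed
  hence "(\<Sum>(a, b)\<in>A. V a b w) = (\<Sum>(a, b)\<in>A. (1 + Re (S a b) / real p ^ e) / 2 * W r e 1 w
      + (1 - Re (S a b) / real p ^ e) / 2 * W r e (- 1) w)"
    by (intro sum.cong) auto
  also have "\<dots> = ((\<Sum>(a, b)\<in>A. 1) + (\<Sum>(a, b)\<in>A. Re (S a b)) / real p ^ e) / 2 * W r e 1 w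
      + ((\<Sum>(a, b)\<in>A. 1) - (\<Sum>(a, b)\<in>A. Re (S a b)) / real p ^ e) / 2 * W r e (- 1) w"
    by (simp add: sum.distrib sum_subtractf sum_distrib_right sum_divide_distrib case_prod_beta
        add_divide_distrib diff_divide_distrib ring_distribs)
  also have "(\<Sum>(a, b)\<in>A. Re (S a b)) = Re (\<Sum>(a, b)\<in>A. S a b)" by (simp add: case_prod_beta)
  also have "(\<Sum>(a, b)\<in>A. 1) = real (card A)" by (simp add: case_prod_beta)
  finally show ?thesis by (simp add: \<sigma>)
qed

end

subsection \<open>The case $d' = d$\<close>

text \<open>The condition says d' = d, because gcd (s + l, 2 l) equals gcd (s + l, 2 s).\<close>

locale kasami_eq = kasami m p q base ext s l d
  for m p q :: nat and base :: "'p::prime_card itself" and ext :: "'a::{field,finite} itself" and s l d +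
  assumes gcd_eq: "gcd (s + l) m = d"
begin

lemma in_K_if_rho_fixed: "tau (sg x) = x \<Longrightarrow> x \<in> K"
  using Fix_eq_gcd[of "s + l"] gcd_eq by (metis Fix_iff fr_fr)

text \<open>Such an x is fixed by the composition of \<open>tau\<close> and \<open>sg\<close>, hence
  lies in K, where \<open>sg\<close> is trivial; so x = -x. For d' = 2d there are p^d such
  elements.\<close>

lemma eq_0_if_anti_fixed:
  assumes "sg x = - x" "tau x = - x"
  shows "x = 0"
proof -
  have "x \<in> K" using assms by (intro in_K_if_rho_fixed) simp
  hence "x = - x" using sg_K assms by metis
  hence "2 * x = 0" by (simp only: mult_2) (metis add.right_inverse)
  thus ?thesis by simp
qed

text \<open>1 is in the radical exactly if a + b + sgi b = 0. As a is fixed by \<open>tau\<close>,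
  the difference b - tau b is negated by both \<open>sg\<close> and \<open>tau\<close>, so it is
  0.\<close>

lemma one_in_R_iff:
  assumes "a \<in> F"
  shows "1 \<in> R a b \<longleftrightarrow> b \<in> F \<and> a = - (b + sgi b)"
proof
  assume "1 \<in> R a b"
  hence "a + (b + sgi b) = 0" by (simp add: R_def Lm_def add.assoc)
  hence a: "a = - (b + sgi b)" by (simp only: eq_neg_iff_add_eq_0)
  have "tau a = a" using assms by (simp add: Fix_iff)
  hence "- (tau b + tau (sgi b)) = - (b + sgi b)" by (simp only: a fr_minus fr_add)
  hence "tau b + tau (sgi b) = b + sgi b" by (simp only: neg_equal_iff_equal)
  hence "sgi (b - tau b) = - (b - tau b)" by (simp add: fr_comm[of "m - l"] algebra_simps)
  hence "sg (sgi (b - tau b)) = sg (- (b - tau b))" by (simp only:)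
  hence "b - tau b = - sg (b - tau b)" by (simp only: sg_sgi fr_minus)
  hence "sg (b - tau b) = - (b - tau b)" by (metis minus_minus)
  moreover have "tau (b - tau b) = - (b - tau b)" by simp
  ultimately have "b - tau b = 0" by (rule eq_0_if_anti_fixed)
  thus "b \<in> F \<and> a = - (b + sgi b)" using a by (simp add: Fix_iff)
qed (simp add: R_def Lm_def)

text \<open>The norm of u + z is u^2 - z^2. Under the trace \<open>sgi b\<close> times this becomes
  b times its image under \<open>sg\<close>, and the mixed products u sg(u) and z sg(z) complete two
  squares.\<close>

lemma Qf_decompose:
  assumes b: "b \<in> F" and u: "u \<in> F" and z: "z \<in> Alt"
  shows "Qf (- (b + sgi b)) b (u + z) = tr s (- b * (sg u - u)\<^sup>2) + tr s (b * (sg z + z)\<^sup>2)"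
proof -
  define y where "y = u\<^sup>2 - z\<^sup>2"
  have t: "tau b = b" "tau u = u" "tau z = - z" "tau (sg u) = sg u" "tau (sg z) = - sg z"
    using assms by (auto simp: Fix_iff Alt_def fr_comm[of s])
  have "tau (sg z + z) = - (sg z + z)" using t by simp
  hence sq: "tau ((sg z + z)\<^sup>2) = (sg z + z)\<^sup>2" by (simp only: fr_power power2_minus)
  hence F: "y \<in> F" "b * y \<in> F" "b * sg y \<in> F" "b * (u * sg u + z * sg z) \<in> F"
    "b * (sg u - u)\<^sup>2 \<in> F" "b * (sg z + z)\<^sup>2 \<in> F" "sgi b * y \<in> F"
    using t by (simp_all only: Fix_iff fr_mult sq, simp_all add: y_def fr_power fr_comm[of s "m - l"])
  have "(u + z) * tau (u + z) = y" by (simp add: t y_def algebra_simps power2_eq_square)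
  moreover have "tr s (sgi b * y) = tr s (b * sg y)"
    using tr_fr[of "sgi b * y" s l] F by simp
  ultimately have 1: "tr s (- (b + sgi b) * ((u + z) * tau (u + z))) = - tr s (b * y) - tr s (b * sg y)"
    using F by (simp add: ring_distribs tr_diff tr_minus Fix_minus)
  define w where "w = b * (u * sg u + z * sg z)"
  have "b * ((u + z) * sg (u + z)) + tau (b * ((u + z) * sg (u + z))) = w + w"
    by (simp add: t w_def algebra_simps)
  hence "tr m (b * ((u + z) * sg (u + z))) = tr s w + tr s w"
    using F by (simp only: tr_m_eq w_def tr_add)
  hence "Qf (- (b + sgi b)) b (u + z) = - tr s (b * y) - tr s (b * sg y) + (tr s w + tr s w)"
    using 1 by (simp add: Qf_def)
  also have "\<dots> = tr s (- (b * y) - b * sg y + (w + w))"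
    using F[folded w_def] by (simp only: tr_add tr_diff tr_minus Fix_add Fix_diff Fix_minus)
  also have "- (b * y) - b * sg y + (w + w) = - b * (sg u - u)\<^sup>2 + b * (sg z + z)\<^sup>2"
    by (simp add: y_def w_def fr_power algebra_simps power2_eq_square)
  also have "tr s \<dots> = tr s (- b * (sg u - u)\<^sup>2) + tr s (b * (sg z + z)\<^sup>2)"
    using F by (simp add: tr_add tr_diff tr_minus Fix_add Fix_diff Fix_minus)
  finally show ?thesis .
qed

text \<open>The Gauss sum of the one-variable form tr(beta k^2) on K; the argument beta will be
  1/b.\<close>

definition fK :: "'a \<Rightarrow> complex" where "fK \<beta> = (\<Sum>k\<in>K. psi (tr s (k * k * \<beta>)))"

lemma sum_K_tr:
  assumes "h \<in> F"
  shows "(\<Sum>k\<in>K. psi (tr s (k * h))) = (if \<forall>k\<in>K. tr s (k * h) = 0 then of_nat (p ^ d) else 0)"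
proof -
  have F: "k * h \<in> F" if "k \<in> K" for k using K_F[OF that] assms by auto
  have "(\<Sum>k\<in>K. psi (tr s (k * h))) = (if \<forall>k\<in>K. tr s (k * h) = 0 then of_nat (card K) else 0)"
    by (rule sum_psi_subgroup) (auto simp: ring_distribs F tr_add)
  thus ?thesis by (simp only: card_K)
qed

lemma sum_F_tr: "x \<in> F \<Longrightarrow> (\<Sum>h\<in>F. psi (tr s (x * h))) = (if x = 0 then of_nat (p ^ s) else 0)"
  by (rule sum_psi_tr[OF s_dvd_m])

lemma card_annihilator: "card {h \<in> F. \<forall>k\<in>K. tr s (k * h) = 0} * p ^ d = p ^ s" (is "card ?H * _ = _")
proof -
  have "(\<Sum>h\<in>F. \<Sum>k\<in>K. psi (tr s (k * h))) = (\<Sum>k\<in>K. \<Sum>h\<in>F. psi (tr s (k * h)))"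
    by (rule sum.swap)
  also have "\<dots> = (\<Sum>k\<in>K. if k = 0 then of_nat (p ^ s) else 0)"
    by (rule sum.cong[OF refl]) (simp only: sum_F_tr K_F)
  also have "\<dots> = of_nat (p ^ s)" by (simp add: sum.delta)
  also have "(\<Sum>h\<in>F. \<Sum>k\<in>K. psi (tr s (k * h))) = (\<Sum>h\<in>F. if \<forall>k\<in>K. tr s (k * h) = 0 then of_nat (p ^ d) else 0)"
    by (rule sum.cong[OF refl]) (rule sum_K_tr)
  also have "\<dots> = (\<Sum>h\<in>?H. of_nat (p ^ d))" by (rule sum.inter_filter[symmetric]) simp
  also have "\<dots> = of_nat (card ?H * p ^ d)" by simp
  finally show ?thesis by (simp only: of_nat_eq_iff)
qed

text \<open>The kernel of \<open>sg\<close> minus the identity on F is K, because d = gcd s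
  l.\<close>

lemma card_sg_fibre:
  assumes "u \<in> F"
  shows "card {v \<in> F. sg v - v = sg u - u} = p ^ d"
proof -
  have "bij_betw (\<lambda>v. v - u) {v \<in> F. sg v - v = sg u - u} K"
  proof (rule bij_betwI[where g = "\<lambda>k. k + u"])
    show "(\<lambda>v. v - u) \<in> {v \<in> F. sg v - v = sg u - u} \<rightarrow> K"
    proof
      fix v assume v: "v \<in> {v \<in> F. sg v - v = sg u - u}"
      hence "tau (v - u) = v - u" using assms by (simp add: Fix_iff)
      moreover have "sg (v - u) = v - u" using v by (simp add: algebra_simps)
      ultimately show "v - u \<in> K" unfolding d_eq Fix_iff by (rule fr_gcd_fix)
    qed
    show "(\<lambda>k. k + u) \<in> K \<rightarrow> {v \<in> F. sg v - v = sg u - u}"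
      using assms by (auto simp: sg_K K_F Fix_add)
  qed auto
  thus ?thesis using card_K by (simp add: bij_betw_same_card)
qed

text \<open>An additive Hilbert 90: elements of K are fixed by \<open>sg\<close>, so the image is
  orthogonal to K under the trace, and a comparison of cardinalities gives equality.\<close>

lemma image_sg_minus: "(\<lambda>u. sg u - u) ` F = {h \<in> F. \<forall>k\<in>K. tr s (k * h) = 0}" (is "?I = ?H")
proof (rule card_subset_eq)
  show sub: "?I \<subseteq> ?H"
  proof (intro subsetI, elim imageE, simp only: mem_Collect_eq, intro conjI ballI)
    fix u k assume u: "u \<in> F" and k: "k \<in> K"
    have ku: "k * u \<in> F" "k * sg u \<in> F" using u K_F[OF k] by auto
    have "tr s (k * (sg u - u)) = tr s (k * sg u) - tr s (k * u)"
      using ku by (simp add: ring_distribs tr_diff)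
    also have "tr s (k * sg u) = tr s (k * u)"
      using tr_fr[OF ku(1), of l] k by (simp add: sg_K)
    finally show "tr s (k * (sg u - u)) = 0" by simp
  qed auto
  have "card F \<le> p ^ d * card ?I"
    by (rule card_le_mult_card_image) (auto simp: card_sg_fibre)
  hence "card ?H * p ^ d \<le> card ?I * p ^ d" using card_annihilator card_F by (simp add: mult.commute)
  hence "card ?H \<le> card ?I" using p_gt_1 by simp
  moreover have "card ?I \<le> card ?H" using sub by (intro card_mono) auto
  ultimately show "card ?I = card ?H" by simp
qed auto

text \<open>The characters given by K detect membership in the image, and the sum over them supplies
  the factor p^d, which is the size of a fibre.\<close>

lemma sum_sg_minus:
  fixes g :: "'a \<Rightarrow> complex"
  shows "(\<Sum>u\<in>F. g (sg u - u)) = (\<Sum>k\<in>K. \<Sum>h\<in>F. psi (tr s (k * h)) * g h)"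
proof -
  have "(\<Sum>u\<in>F. g (sg u - u)) = (\<Sum>h\<in>(\<lambda>u. sg u - u) ` F. \<Sum>u\<in>{u \<in> F. sg u - u = h}. g (sg u - u))"
    by (rule sum.group[symmetric]) auto
  also have "\<dots> = (\<Sum>h\<in>(\<lambda>u. sg u - u) ` F. of_nat (p ^ d) * g h)"
  proof (rule sum.cong[OF refl])
    fix h assume "h \<in> (\<lambda>u. sg u - u) ` F"
    then obtain v where "v \<in> F" "h = sg v - v" by auto
    hence "card {u \<in> F. sg u - u = h} = p ^ d" using card_sg_fibre by simp
    moreover have "(\<Sum>u\<in>{u \<in> F. sg u - u = h}. g (sg u - u)) = (\<Sum>u\<in>{u \<in> F. sg u - u = h}. g h)"
      by (rule sum.cong) auto
    ultimately show "(\<Sum>u\<in>{u \<in> F. sg u - u = h}. g (sg u - u)) = of_nat (p ^ d) * g h" by simp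
  qed
  also have "\<dots> = (\<Sum>h\<in>F. if \<forall>k\<in>K. tr s (k * h) = 0 then of_nat (p ^ d) * g h else 0)"
    unfolding image_sg_minus by (rule sum.inter_filter) simp
  also have "\<dots> = (\<Sum>h\<in>F. (\<Sum>k\<in>K. psi (tr s (k * h))) * g h)"
    by (rule sum.cong[OF refl]) (simp add: sum_K_tr)
  also have "\<dots> = (\<Sum>k\<in>K. \<Sum>h\<in>F. psi (tr s (k * h)) * g h)"
    unfolding sum_distrib_right by (rule sum.swap)
  finally show ?thesis .
qed

text \<open>Every fibre of the norm has at most p^s + 1 elements, as roots of a polynomial. Since q
  - 1 = (p^s - 1)(p^s + 1), a smaller fibre would make the total too small.\<close>

lemma card_norm_fibre:
  assumes "c \<in> F" "c \<noteq> 0"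
  shows "card {x. x * tau x = c} = p ^ s + 1"
proof -
  have le: "card {x. x * tau x = c} \<le> p ^ s + 1" for c
    using card_power_eq_le[of "p ^ s + 1" c] by (simp add: fr_def)
  have "card (UNIV - {0::'a}) = (\<Sum>c\<in>F - {0}. card {x \<in> UNIV - {0}. x * tau x = c})"
  proof -
    have "(\<lambda>x. x * tau x) ` (UNIV - {0}) \<subseteq> F - {0}" using norm_F by auto
    from sum.group[OF _ _ this, of "\<lambda>_. 1::nat"] show ?thesis by simp
  qed
  also have "\<dots> = (\<Sum>c\<in>F - {0}. card {x. x * tau x = c})"
    by (intro sum.cong arg_cong[of _ _ card]) auto
  finally have sum: "(\<Sum>c\<in>F - {0}. card {x. x * tau x = c}) = q - 1"
    by (simp add: card_Diff_singleton q_card)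
  have cF: "card (F - {0}) = p ^ s - 1" by (simp add: card_Diff_singleton card_F)
  have "q - 1 = (p ^ s - 1) * (p ^ s + 1)"
    by (simp add: q_sq power2_eq_square algebra_simps)
  show ?thesis
  proof (rule ccontr)
    assume "\<not> ?thesis"
    hence "card {x. x * tau x = c} < p ^ s + 1" using le[of c] by simp
    hence "(\<Sum>c\<in>F - {0}. card {x. x * tau x = c}) < (\<Sum>c\<in>F - {0}. p ^ s + 1)"
      using assms le by (intro sum_strict_mono_ex1) auto
    thus False using sum cF \<open>q - 1 = _\<close> by simp
  qed
qed

text \<open>Nonzero norms are hit p^s + 1 times, but 0 only once. Taking p^s off at c = 0 leaves a
  full character sum, which vanishes.\<close>

lemma sum_norm:
  assumes b: "b \<in> F" "b \<noteq> 0"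
  shows "(\<Sum>x\<in>UNIV. psi (tr s (b * (x * tau x)))) = - of_nat (p ^ s)"
proof -
  have "(\<Sum>x\<in>UNIV. psi (tr s (b * (x * tau x)))) = (\<Sum>c\<in>F. \<Sum>x\<in>{x \<in> UNIV. x * tau x = c}. psi (tr s (b * (x * tau x))))"
    by (rule sum.group[symmetric]) (auto simp: norm_F)
  also have "\<dots> = (\<Sum>c\<in>F. of_nat (card {x. x * tau x = c}) * psi (tr s (b * c)))"
    by (rule sum.cong) (auto simp flip: sum_constant intro!: sum.cong)
  also have "\<dots> = (\<Sum>c\<in>F. of_nat (p ^ s + 1) * psi (tr s (b * c)) - (if c = 0 then of_nat (p ^ s) else 0))"
  proof (rule sum.cong[OF refl])
    fix c assume c: "c \<in> F"
    have "{x :: 'a. x * tau x = 0} = {0}" by auto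
    thus "of_nat (card {x. x * tau x = c}) * psi (tr s (b * c)) =
        of_nat (p ^ s + 1) * psi (tr s (b * c)) - (if c = 0 then of_nat (p ^ s) else 0)"
      using card_norm_fibre[OF c] by auto
  qed
  also have "\<dots> = of_nat (p ^ s + 1) * (\<Sum>c\<in>F. psi (tr s (b * c))) - of_nat (p ^ s)"
    by (simp add: sum_subtractf sum_distrib_left sum.delta)
  finally show ?thesis using b by (simp add: sum_F_tr)
qed

text \<open>By \<open>eq_0_if_anti_fixed\<close> the map z to sg z + z is injective on
  \<open>Alt\<close>, hence a permutation of it.\<close>

lemma sum_Alt_shift:
  fixes g :: "'a \<Rightarrow> complex"
  shows "(\<Sum>z\<in>Alt. g (sg z + z)) = (\<Sum>z\<in>Alt. g z)"
proof -
  have inj: "inj_on (\<lambda>z. sg z + z) Alt"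
  proof (rule inj_onI)
    fix x y assume xy: "x \<in> Alt" "y \<in> Alt" "sg x + x = sg y + y"
    have "sg (x - y) = - (x - y)" using xy(3) by (simp add: algebra_simps)
    moreover have "tau (x - y) = - (x - y)" using xy by (simp add: Alt_def)
    ultimately have "x - y = 0" by (rule eq_0_if_anti_fixed)
    thus "x = y" by simp
  qed
  moreover have "(\<lambda>z. sg z + z) ` Alt \<subseteq> Alt" by (auto simp: Alt_def fr_comm[of s])
  ultimately have "bij_betw (\<lambda>z. sg z + z) Alt Alt"
    by (simp add: bij_betw_def endo_inj_surj)
  from sum.reindex_bij_betw[OF this, of g] show ?thesis .
qed

lemma complete_square:
  assumes b: "b \<in> F" "b \<noteq> 0" and k: "k \<in> F"
  shows "(\<Sum>h\<in>F. psi (tr s (k * h)) * psi (tr s (- b * h\<^sup>2))) =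
    psi (tr s ((k / 2) * (k / 2) * (1 / b))) * (\<Sum>h\<in>F. psi (tr s (- b * h\<^sup>2)))"
proof -
  \<comment> \<open>The vertex of k h - b h^2.\<close>
  define c where "c = k / (2 * b)"
  have c: "c \<in> F" using assms unfolding c_def by auto
  have e: "k * (h + c) + - b * (h + c)\<^sup>2 = (k / 2) * (k / 2) * (1 / b) + - b * h\<^sup>2" for h
  proof -
    have k: "k = 2 * b * c" using b by (simp add: c_def)
    show ?thesis unfolding k using b by (simp add: power2_eq_square algebra_simps)
  qed
  have "bij_betw (\<lambda>h. h + c) F F"
    by (rule bij_betwI[where g = "\<lambda>h. h - c"]) (use c in auto)
  from sum.reindex_bij_betw[OF this, of "\<lambda>h. psi (tr s (k * h)) * psi (tr s (- b * h\<^sup>2))"]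
  have "(\<Sum>h\<in>F. psi (tr s (k * h)) * psi (tr s (- b * h\<^sup>2))) =
      (\<Sum>h\<in>F. psi (tr s (k * (h + c))) * psi (tr s (- b * (h + c)\<^sup>2)))" by simp
  also have "\<dots> = (\<Sum>h\<in>F. psi (tr s ((k / 2) * (k / 2) * (1 / b))) * psi (tr s (- b * h\<^sup>2)))"
  proof (rule sum.cong[OF refl])
    fix h assume h: "h \<in> F"
    have F: "k * (h + c) \<in> F" "- b * (h + c)\<^sup>2 \<in> F" "(k / 2) * (k / 2) * (1 / b) \<in> F" "- b * h\<^sup>2 \<in> F"
      using assms c h by (auto intro!: Fix_mult Fix_minus Fix_add Fix_power Fix_divide)
    show "psi (tr s (k * (h + c))) * psi (tr s (- b * (h + c)\<^sup>2)) =
        psi (tr s ((k / 2) * (k / 2) * (1 / b))) * psi (tr s (- b * h\<^sup>2))"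
      unfolding psi_add[symmetric] tr_add[OF F(1,2), symmetric] tr_add[OF F(3,4), symmetric] e ..
  qed
  finally show ?thesis by (simp add: sum_distrib_left)
qed

text \<open>Neither the quadratic sum over F nor the one over \<open>Alt\<close> is evaluated: since
  -b (u^2 - z^2) is -b times the norm of u + z, their product is the norm sum -p^s. What remains is
  the sum over K, produced by the non-injectivity of u to sg u - u.\<close>

lemma S_eq_fK:
  assumes b: "b \<in> F" "b \<noteq> 0"
  shows "S (- (b + sgi b)) b = - of_nat (p ^ s) * fK (1 / b)"
proof -
  let ?G = "\<Sum>h\<in>F. psi (tr s (- b * h\<^sup>2))" and ?A = "\<Sum>z\<in>Alt. psi (tr s (b * z\<^sup>2))"
  have "S (- (b + sgi b)) b = (\<Sum>u\<in>F. \<Sum>z\<in>Alt. psi (tr s (- b * (sg u - u)\<^sup>2)) * psi (tr s (b * (sg z + z)\<^sup>2)))"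
    unfolding S_def sum_decompose by (intro sum.cong refl) (simp only: Qf_decompose[OF b(1)] psi_add)
  also have "\<dots> = (\<Sum>u\<in>F. psi (tr s (- b * (sg u - u)\<^sup>2))) * (\<Sum>z\<in>Alt. psi (tr s (b * (sg z + z)\<^sup>2)))"
    by (simp only: sum_product)
  also have "(\<Sum>z\<in>Alt. psi (tr s (b * (sg z + z)\<^sup>2))) = ?A"
    by (rule sum_Alt_shift[of "\<lambda>z. psi (tr s (b * z\<^sup>2))"])
  also have "(\<Sum>u\<in>F. psi (tr s (- b * (sg u - u)\<^sup>2))) = (\<Sum>k\<in>K. \<Sum>h\<in>F. psi (tr s (k * h)) * psi (tr s (- b * h\<^sup>2)))"
    by (rule sum_sg_minus[of "\<lambda>h. psi (tr s (- b * h\<^sup>2))"])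
  also have "\<dots> = (\<Sum>k\<in>K. psi (tr s ((k / 2) * (k / 2) * (1 / b))) * ?G)"
    by (rule sum.cong[OF refl]) (rule complete_square[OF b K_F])
  also have "\<dots> = (\<Sum>k\<in>K. psi (tr s ((k / 2) * (k / 2) * (1 / b)))) * ?G"
    by (simp only: sum_distrib_right)
  also have "(\<Sum>k\<in>K. psi (tr s ((k / 2) * (k / 2) * (1 / b)))) = fK (1 / b)"
  proof -
    have "bij_betw (\<lambda>k. k / 2) K K"
      by (rule bij_betwI[where g = "\<lambda>k. 2 * k"]) (auto intro!: Fix_mult Fix_divide)
    from sum.reindex_bij_betw[OF this, of "\<lambda>k. psi (tr s (k * k * (1 / b)))"] show ?thesis
      by (simp only: fK_def)
  qed
  also have "fK (1 / b) * ?G * ?A = fK (1 / b) * (?G * ?A)" by (simp only: mult.assoc)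
  also have "?G * ?A = (\<Sum>u\<in>F. \<Sum>z\<in>Alt. psi (tr s (- b * ((u + z) * tau (u + z)))))"
    unfolding sum_product
  proof (intro sum.cong refl)
    fix u z assume uz: "u \<in> F" "z \<in> Alt"
    have F: "- b * u\<^sup>2 \<in> F" "b * z\<^sup>2 \<in> F"
      using b uz by (auto simp: Fix_iff Alt_def fr_power)
    have "- b * ((u + z) * tau (u + z)) = - b * u\<^sup>2 + b * z\<^sup>2"
      using uz by (simp add: Fix_iff Alt_def algebra_simps power2_eq_square)
    thus "psi (tr s (- b * u\<^sup>2)) * psi (tr s (b * z\<^sup>2)) = psi (tr s (- b * ((u + z) * tau (u + z))))"
      by (simp only: psi_add tr_add[OF F])
  qed
  also have "\<dots> = (\<Sum>x\<in>UNIV. psi (tr s (- b * (x * tau x))))" by (rule sum_decompose[symmetric])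
  also have "\<dots> = - of_nat (p ^ s)" by (rule sum_norm) (use b in auto)
  finally show ?thesis by simp
qed

text \<open>The substitution u = k - j, v = k + j, invertible because 2 is, factors k^2 -
  j^2.\<close>

lemma fK_cnj:
  assumes "\<beta> \<in> F"
  shows "fK \<beta> * cnj (fK \<beta>) = (\<Sum>u\<in>K. \<Sum>v\<in>K. psi (tr s (v * (u * \<beta>))))"
proof -
  have two: "(x + x) / 2 = x" for x :: 'a by (simp only: mult_2[symmetric]) simp
  have bij: "bij_betw (\<lambda>(k, j). (k - j, k + j)) (K \<times> K) (K \<times> K)"
  proof (rule bij_betwI[where g = "\<lambda>(u, v). ((u + v) / 2, (v - u) / 2)"])
    fix x :: "'a \<times> 'a"
    show "(\<lambda>(u, v). ((u + v) / 2, (v - u) / 2)) ((\<lambda>(k, j). (k - j, k + j)) x) = x"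
      by (auto simp: case_prod_beta two prod_eq_iff)
    have "(a + b) / 2 - (b - a) / 2 = a" "(a + b) / 2 + (b - a) / 2 = b" for a b :: 'a
      by (simp_all add: diff_divide_distrib[symmetric] add_divide_distrib[symmetric] two)
    thus "(\<lambda>(k, j). (k - j, k + j)) ((\<lambda>(u, v). ((u + v) / 2, (v - u) / 2)) x) = x"
      by (auto simp: case_prod_beta prod_eq_iff)
  qed (auto intro!: Fix_divide)
  have "fK \<beta> * cnj (fK \<beta>) = (\<Sum>(k, j)\<in>K \<times> K. psi (tr s (k * k * \<beta>)) * cnj (psi (tr s (j * j * \<beta>))))"
    by (simp add: fK_def sum_product sum.cartesian_product)
  also have "\<dots> = (\<Sum>(k, j)\<in>K \<times> K. psi (tr s ((k + j) * ((k - j) * \<beta>))))"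
  proof (rule sum.cong[OF refl], clarify)
    fix k j assume kj: "k \<in> K" "j \<in> K"
    have F: "k * k * \<beta> \<in> F" "j * j * \<beta> \<in> F" using kj[THEN K_F] assms by (auto intro!: Fix_mult)
    have "(k + j) * ((k - j) * \<beta>) = k * k * \<beta> - j * j * \<beta>" by (simp add: algebra_simps)
    thus "psi (tr s (k * k * \<beta>)) * cnj (psi (tr s (j * j * \<beta>))) = psi (tr s ((k + j) * ((k - j) * \<beta>)))"
      by (simp only: tr_diff[OF F] psi_diff)
  qed
  also have "\<dots> = (\<Sum>(u, v)\<in>K \<times> K. psi (tr s (v * (u * \<beta>))))"
    using sum.reindex_bij_betw[OF bij, of "\<lambda>(u, v). psi (tr s (v * (u * \<beta>)))"] by (simp add: case_prod_beta)
  finally show ?thesis by (simp add: sum.cartesian_product)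
qed

text \<open>K is a field, so if u beta is orthogonal to K for one nonzero u, then so is beta, and
  every term of \<open>fK\<close> is 1. Otherwise only u = 0 survives in
  \<open>fK_cnj\<close>.\<close>

lemma fK_cases:
  assumes \<beta>: "\<beta> \<in> F"
  shows "fK \<beta> * cnj (fK \<beta>) = of_nat (p ^ d) \<or> fK \<beta> = of_nat (p ^ d)"
proof (cases "\<exists>u\<in>K - {0}. \<forall>v\<in>K. tr s (v * (u * \<beta>)) = 0")
  case True
  then obtain u where u: "u \<in> K" "u \<noteq> 0" "\<And>v. v \<in> K \<Longrightarrow> tr s (v * (u * \<beta>)) = 0" by auto
  have "tr s (k * k * \<beta>) = 0" if "k \<in> K" for k
  proof -
    have "k * k / u \<in> K" using that u by auto
    from u(3)[OF this] show ?thesis using u(2) by (simp add: mult.assoc)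
  qed
  hence "fK \<beta> = of_nat (p ^ d)" by (simp add: fK_def card_K)
  thus ?thesis ..
next
  case False
  have "fK \<beta> * cnj (fK \<beta>) = (\<Sum>u\<in>K. if u = 0 then of_nat (p ^ d) else 0)"
    unfolding fK_cnj[OF \<beta>]
  proof (rule sum.cong[OF refl])
    fix u assume u: "u \<in> K"
    hence "(\<Sum>v\<in>K. psi (tr s (v * (u * \<beta>)))) = (if \<forall>v\<in>K. tr s (v * (u * \<beta>)) = 0 then of_nat (p ^ d) else 0)"
      using \<beta> K_F[OF u] by (intro sum_K_tr) auto
    also have "(\<forall>v\<in>K. tr s (v * (u * \<beta>)) = 0) \<longleftrightarrow> u = 0" using False u by auto
    finally show "(\<Sum>v\<in>K. psi (tr s (v * (u * \<beta>)))) = (if u = 0 then of_nat (p ^ d) else 0)" .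
  qed
  also have "\<dots> = of_nat (p ^ d)" by (simp add: sum.delta)
  finally show ?thesis ..
qed

lemma sum_fK: "(\<Sum>\<beta>\<in>F - {0}. fK \<beta>) = of_nat (p ^ s) - of_nat (p ^ d)"
proof -
  have "(\<Sum>\<beta>\<in>F. fK \<beta>) = (\<Sum>k\<in>K. \<Sum>\<beta>\<in>F. psi (tr s (k * k * \<beta>)))"
    unfolding fK_def by (rule sum.swap)
  also have "\<dots> = (\<Sum>k\<in>K. if k = 0 then of_nat (p ^ s) else 0)"
    by (rule sum.cong[OF refl]) (simp add: sum_F_tr K_F Fix_mult)
  also have "\<dots> = of_nat (p ^ s)" by (simp add: sum.delta)
  finally show ?thesis by (simp add: sum_diff1 fK_def card_K)
qed

text \<open>Summation over beta leaves the 2 p^d - 1 pairs with u v = 0; the square of p^d removes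
  the term beta = 0.\<close>

lemma sum_fK_cnj:
  "(\<Sum>\<beta>\<in>F - {0}. fK \<beta> * cnj (fK \<beta>)) = of_nat (p ^ s) * (2 * of_nat (p ^ d) - 1) - of_nat (p ^ d) * of_nat (p ^ d)"
proof -
  have "(\<Sum>\<beta>\<in>F. fK \<beta> * cnj (fK \<beta>)) = (\<Sum>\<beta>\<in>F. \<Sum>u\<in>K. \<Sum>v\<in>K. psi (tr s (v * (u * \<beta>))))"
    by (rule sum.cong[OF refl]) (rule fK_cnj)
  also have "\<dots> = (\<Sum>u\<in>K. \<Sum>\<beta>\<in>F. \<Sum>v\<in>K. psi (tr s (v * (u * \<beta>))))" by (rule sum.swap)
  also have "\<dots> = (\<Sum>u\<in>K. \<Sum>v\<in>K. \<Sum>\<beta>\<in>F. psi (tr s (v * u * \<beta>)))"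
    by (rule sum.cong[OF refl]) (subst sum.swap, simp only: mult.assoc)
  also have "\<dots> = (\<Sum>u\<in>K. \<Sum>v\<in>K. if v * u = 0 then of_nat (p ^ s) else 0)"
    by (intro sum.cong refl sum_F_tr) (auto intro: K_F)
  also have "\<dots> = (\<Sum>u\<in>K. if u = 0 then of_nat (p ^ d) * of_nat (p ^ s) else of_nat (p ^ s))"
    by (rule sum.cong[OF refl]) (auto simp: card_K)
  also have "\<dots> = of_nat (p ^ d) * of_nat (p ^ s) + (\<Sum>u\<in>K - {0}. of_nat (p ^ s))"
    by (subst sum.remove[of _ 0]) auto
  also have "\<dots> = of_nat (p ^ s) * (2 * of_nat (p ^ d) - 1)"
    using p_gt_1 by (simp add: card_Diff_singleton card_K of_nat_diff algebra_simps)
  finally show ?thesis by (simp add: sum_diff1 fK_def card_K)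
qed

text \<open>Compare the squared absolute value of S, which is q times the radical order, with
  \<open>S_eq_fK\<close>: the factor p^s has square q.\<close>

lemma norm_sum_R:
  assumes b: "b \<in> F" "b \<noteq> 0"
  shows "of_nat (card (R (- (b + sgi b)) b)) = fK (1 / b) * cnj (fK (1 / b))"
proof -
  have a: "- (b + sgi b) \<in> F" using b by (intro Fix_minus Fix_add Fix_fr)
  have "of_nat (q * card (R (- (b + sgi b)) b)) = of_nat q * (fK (1 / b) * cnj (fK (1 / b)))"
    unfolding S_cnj_S[OF a, symmetric] S_eq_fK[OF b]
    by (simp add: q_sq power2_eq_square)
  thus ?thesis using q_eq p_gt_1 by simp
qed

lemma radical_cases:
  assumes "(a, b) \<in> P"
  shows "card (R a b) = 1 \<or> card (R a b) = p ^ d \<or> card (R a b) = p ^ (2 * d) \<and> S a b = - of_nat (p ^ (s + d))"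
proof (cases "R a b = {0}")
  case False
  then obtain x where x: "x \<in> R a b" "x \<noteq> 0" using R_0 by blast
  define a' b' where "a' = a * (x * tau x)" and "b' = b * (x * sg x)"
  have a': "a' \<in> F" using assms norm_F by (auto simp: a'_def P_iff)
  have "1 \<in> R a' b'" unfolding a'_def b'_def using x by (simp add: R_scale)
  hence b': "b' \<in> F" "a' = - (b' + sgi b')" using one_in_R_iff[OF a'] by auto
  \<comment> \<open>Otherwise a' would vanish too, and with it the original pair.\<close>
  have "b' \<noteq> 0" using assms x b'(2) by (auto simp: a'_def b'_def P_iff)
  have R: "of_nat (card (R a b)) = fK (1 / b') * cnj (fK (1 / b'))"
    using norm_sum_R[OF b'(1) \<open>b' \<noteq> 0\<close>] card_R_scale[OF x(2), of a b]
    by (simp only: b'(2)[symmetric]) (simp only: a'_def b'_def)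
  have S: "S a b = - of_nat (p ^ s) * fK (1 / b')"
    using S_eq_fK[OF b'(1) \<open>b' \<noteq> 0\<close>] S_scale[OF x(2), of a b]
    by (simp only: b'(2)[symmetric]) (simp only: a'_def b'_def)
  have "1 / b' \<in> F" using b' by auto
  from fK_cases[OF this] show ?thesis
  proof (elim disjE)
    assume "fK (1 / b') * cnj (fK (1 / b')) = of_nat (p ^ d)"
    hence "card (R a b) = p ^ d" using R by (simp only: of_nat_eq_iff)
    thus ?thesis by simp
  next
    assume f: "fK (1 / b') = of_nat (p ^ d)"
    have "of_nat (card (R a b)) = (of_nat (p ^ (2 * d)) :: complex)"
      using R by (simp add: f mult_2 power_add)
    hence "card (R a b) = p ^ (2 * d)" by (simp only: of_nat_eq_iff)
    moreover have "S a b = - of_nat (p ^ (s + d))" using S by (simp add: f power_add)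
    ultimately show ?thesis by simp
  qed
qed simp

lemma sum_one_in_R:
  fixes g :: "'a \<times> 'a \<Rightarrow> complex"
  shows "(\<Sum>(a, b)\<in>{(a, b) \<in> P. 1 \<in> R a b}. g (a, b)) = (\<Sum>b\<in>F - {0}. g (- (b + sgi b), b))"
proof -
  have "bij_betw (\<lambda>b. (- (b + sgi b), b)) (F - {0}) {(a, b) \<in> P. 1 \<in> R a b}"
  proof (rule bij_betwI[where g = snd])
    show "(\<lambda>b. (- (b + sgi b), b)) \<in> F - {0} \<rightarrow> {(a, b) \<in> P. 1 \<in> R a b}"
    proof
      fix b assume b: "b \<in> F - {0}"
      have a: "- (b + sgi b) \<in> F" using b by (intro Fix_minus Fix_add Fix_fr) auto
      have "1 \<in> R (- (b + sgi b)) b" using one_in_R_iff[OF a, of b] b by blast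
      thus "(- (b + sgi b), b) \<in> {(a, b) \<in> P. 1 \<in> R a b}" using a b unfolding P_iff by blast
    qed
    show "snd \<in> {(a, b) \<in> P. 1 \<in> R a b} \<rightarrow> F - {0}"
    proof
      fix ab assume "ab \<in> {(a, b) \<in> P. 1 \<in> R a b}"
      then obtain a b where ab: "ab = (a, b)" "(a, b) \<in> P" "1 \<in> R a b" by auto
      hence "a \<in> F" by (simp add: P_iff)
      from one_in_R_iff[OF this, of b] ab(3) have "b \<in> F" "a = - (b + sgi b)" by auto
      thus "snd ab \<in> F - {0}" using ab by (auto simp: P_iff)
    qed
    fix ab assume "ab \<in> {(a, b) \<in> P. 1 \<in> R a b}"
    then obtain a b where ab: "ab = (a, b)" "(a, b) \<in> P" "1 \<in> R a b" by auto
    hence "a \<in> F" by (simp add: P_iff)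
    from one_in_R_iff[OF this, of b] ab show "(- (snd ab + sgi (snd ab)), snd ab) = ab" by simp
  qed simp
  from sum.reindex_bij_betw[OF this, of g] show ?thesis by (simp add: case_prod_beta)
qed

lemma sum_inverse_F: "(\<Sum>b\<in>F - {0}. g (1 / b)) = (\<Sum>b\<in>F - {0}. g b)" for g :: "'a \<Rightarrow> complex"
proof -
  have "bij_betw (\<lambda>b. 1 / b) (F - {0}) (F - {0})"
    by (rule bij_betwI[where g = "\<lambda>b. 1 / b"]) auto
  from sum.reindex_bij_betw[OF this, of g] show ?thesis .
qed

text \<open>This and the next two lemmas are \<open>incidence\<close> with weights 1, radical order
  and S. On the pairs with 1 in the radical, indexed by b, the weights become 1, the squared
  absolute value of \<open>fK (1 / b)\<close>, and -p^s times \<open>fK (1 / b)\<close>.\<close>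

lemma moment_1: "(\<Sum>(a, b)\<in>P. of_nat (card (R a b)) - 1) = (of_nat q - 1) * (of_nat (p ^ s) - 1 :: complex)"
proof -
  have "(\<Sum>(a, b)\<in>P. (of_nat (card (R a b)) - 1) * 1) = (of_nat q - 1) * (\<Sum>b\<in>F - {0}. 1 :: complex)"
    using incidence[of "\<lambda>_. 1"] unfolding sum_one_in_R[of "\<lambda>_. 1"] by simp
  thus ?thesis using p_gt_1 by (simp add: card_Diff_singleton card_F of_nat_diff)
qed

lemma moment_2: "(\<Sum>(a, b)\<in>P. (of_nat (card (R a b)) - 1) * of_nat (card (R a b))) =
  (of_nat q - 1) * (of_nat (p ^ s) * (2 * of_nat (p ^ d) - 1) - of_nat (p ^ d) * of_nat (p ^ d) :: complex)"
proof -
  let ?g = "\<lambda>ab. of_nat (card (R (fst ab) (snd ab))) :: complex"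
  have "(\<Sum>(a, b)\<in>P. (of_nat (card (R a b)) - 1) * ?g (a, b)) = (of_nat q - 1) * (\<Sum>b\<in>F - {0}. ?g (- (b + sgi b), b))"
    unfolding sum_one_in_R[of ?g, symmetric] by (rule incidence[of ?g]) (simp add: card_R_scale)
  also have "(\<Sum>b\<in>F - {0}. ?g (- (b + sgi b), b)) = (\<Sum>b\<in>F - {0}. fK (1 / b) * cnj (fK (1 / b)))"
    by (rule sum.cong[OF refl], simp only: fst_conv snd_conv, rule norm_sum_R) auto
  also have "\<dots> = (\<Sum>b\<in>F - {0}. fK b * cnj (fK b))"
    by (rule sum_inverse_F[of "\<lambda>b. fK b * cnj (fK b)"])
  finally show ?thesis unfolding sum_fK_cnj by (simp only: fst_conv snd_conv)
qed

lemma moment_3: "(\<Sum>(a, b)\<in>P. (of_nat (card (R a b)) - 1) * S a b) =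
  (of_nat q - 1) * (- of_nat (p ^ s) * (of_nat (p ^ s) - of_nat (p ^ d)))"
proof -
  let ?g = "\<lambda>ab. S (fst ab) (snd ab)"
  have "(\<Sum>(a, b)\<in>P. (of_nat (card (R a b)) - 1) * ?g (a, b)) = (of_nat q - 1) * (\<Sum>b\<in>F - {0}. ?g (- (b + sgi b), b))"
    unfolding sum_one_in_R[of ?g, symmetric] by (rule incidence[of ?g]) (simp add: S_scale)
  also have "(\<Sum>b\<in>F - {0}. ?g (- (b + sgi b), b)) = (\<Sum>b\<in>F - {0}. - of_nat (p ^ s) * fK (1 / b))"
    by (rule sum.cong[OF refl], simp only: fst_conv snd_conv, rule S_eq_fK) auto
  also have "\<dots> = - of_nat (p ^ s) * (\<Sum>b\<in>F - {0}. fK (1 / b))" by (simp only: sum_distrib_left)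
  also have "(\<Sum>b\<in>F - {0}. fK (1 / b)) = (\<Sum>b\<in>F - {0}. fK b)" by (rule sum_inverse_F)
  finally show ?thesis unfolding sum_fK by (simp only: fst_conv snd_conv)
qed

section \<open>Sizes of the strata of equal radical order and sums of S over them\<close>

definition Pk :: "nat \<Rightarrow> ('a \<times> 'a) set" where "Pk k = {(a, b) \<in> P. card (R a b) = p ^ (k * d)}"

lemma Pk_iff: "(a, b) \<in> Pk k \<longleftrightarrow> (a, b) \<in> P \<and> card (R a b) = p ^ (k * d)"
  by (simp add: Pk_def)

lemma sum_P_split: "(\<Sum>ab\<in>P. f ab) = (\<Sum>ab\<in>Pk 0. f ab) + (\<Sum>ab\<in>Pk 1. f ab) + (\<Sum>ab\<in>Pk 2. f ab)"
  for f :: "'a \<times> 'a \<Rightarrow> 'z::comm_monoid_add"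
proof -
  have inj: "p ^ (j * d) = p ^ (k * d) \<longleftrightarrow> j = k" for j k
    using p_gt_1 d_pos by (simp add: power_inject_exp)
  have "P = Pk 0 \<union> Pk 1 \<union> Pk 2" using radical_cases by (auto simp: Pk_def)
  moreover have disj: "Pk j \<inter> Pk k = {}" if "j \<noteq> k" for j k
    using inj that unfolding Pk_def by (auto simp: disjoint_iff)
  hence "(Pk 0 \<union> Pk 1) \<inter> Pk 2 = {}" "Pk 0 \<inter> Pk 1 = {}" by (simp_all add: Int_Un_distrib2)
  ultimately show ?thesis by (simp add: sum.union_disjoint)
qed

lemma S_Pk_2: "(a, b) \<in> Pk 2 \<Longrightarrow> S a b = - of_nat (p ^ (s + d))"
  using radical_cases[of a b] p_gt_1 d_pos
  by (auto simp: Pk_iff power_inject_exp[of p _ 0, simplified])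

lemma rank_counts:
  defines "Q \<equiv> real p ^ d" and "y \<equiv> real p ^ s"
  shows "real (card (Pk 2)) = (y\<^sup>2 - 1) * (y / Q - 1) / (Q\<^sup>2 - 1)"
    and "real (card (Pk 1)) = (y\<^sup>2 - 1) * (y / Q)"
    and "real (card (Pk 0)) = y ^ 3 - 1 - card (Pk 1) - card (Pk 2)"
    and "(\<Sum>(a, b)\<in>Pk 2. S a b) = of_real (- y * Q * card (Pk 2))"
    and "(\<Sum>(a, b)\<in>Pk 1. S a b) = of_real 0"
    and "(\<Sum>(a, b)\<in>Pk 0. S a b) = of_real (y\<^sup>2 * (y - 1) + y * Q * card (Pk 2))"
proof -
  let ?n = "\<lambda>k. card (Pk k)"
  have Q: "Q > 1" unfolding Q_def using p_gt_1 d_pos by (simp add: one_less_power)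
  have q: "real q = y\<^sup>2" by (simp add: q_sq y_def)
  have sumk: "(\<Sum>(a, b)\<in>Pk k. f (card (R a b)) a b) = (\<Sum>(a, b)\<in>Pk k. f (p ^ (k * d)) a b)" for k and f :: "nat \<Rightarrow> 'a \<Rightarrow> 'a \<Rightarrow> complex"
    by (rule sum.cong) (auto simp: Pk_iff)
  have const: "(\<Sum>(a, b)\<in>A. c) = of_real (real (card A)) * (c :: complex)" for A :: "('a \<times> 'a) set" and c
    by (simp add: case_prod_beta)
  have pk: "of_nat (p ^ (0 * d)) = (of_real 1 :: complex)" "of_nat (p ^ (1 * d)) = (of_real Q :: complex)"
    "of_nat (p ^ (2 * d)) = (of_real (Q\<^sup>2) :: complex)" "of_nat q = (of_real (y\<^sup>2) :: complex)"
    "of_nat (p ^ s) = (of_real y :: complex)" "of_nat (p ^ d) = (of_real Q :: complex)"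
    by (simp_all add: Q_def y_def q_sq power_mult[symmetric] mult.commute)
  have E1: "(Q - 1) * ?n 1 + (Q\<^sup>2 - 1) * ?n 2 = (y\<^sup>2 - 1) * (y - 1)"
  proof -
    have "of_real (?n 0) * (of_real 1 - 1) + of_real (?n 1) * (of_real Q - 1) + of_real (?n 2) * (of_real (Q\<^sup>2) - 1)
        = (of_real (y\<^sup>2) - 1) * (of_real y - 1 :: complex)"
      using moment_1 unfolding sum_P_split sumk[of "\<lambda>n a b. of_nat n - 1"] const pk .
    hence "of_real (real (?n 0) * (1 - 1) + ?n 1 * (Q - 1) + ?n 2 * (Q\<^sup>2 - 1)) = (of_real ((y\<^sup>2 - 1) * (y - 1)) :: complex)"
      by (simp only: of_real_add of_real_mult of_real_diff of_real_1)
    hence "real (?n 0) * (1 - 1) + ?n 1 * (Q - 1) + ?n 2 * (Q\<^sup>2 - 1) = (y\<^sup>2 - 1) * (y - 1)" by (simp only: of_real_eq_iff)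
    thus ?thesis by (simp add: mult.commute)
  qed
  have E2: "(Q - 1) * Q * ?n 1 + (Q\<^sup>2 - 1) * Q\<^sup>2 * ?n 2 = (y\<^sup>2 - 1) * (y * (2 * Q - 1) - Q * Q)"
  proof -
    have "of_real (?n 0) * ((of_real 1 - 1) * of_real 1) + of_real (?n 1) * ((of_real Q - 1) * of_real Q)
        + of_real (?n 2) * ((of_real (Q\<^sup>2) - 1) * of_real (Q\<^sup>2))
        = (of_real (y\<^sup>2) - 1) * (of_real y * (2 * of_real Q - 1) - of_real Q * of_real Q :: complex)"
      using moment_2 unfolding sum_P_split sumk[of "\<lambda>n a b. (of_nat n - 1) * of_nat n"] const pk .
    hence "of_real (real (?n 0) * ((1 - 1) * 1) + ?n 1 * ((Q - 1) * Q) + ?n 2 * ((Q\<^sup>2 - 1) * Q\<^sup>2))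
        = (of_real ((y\<^sup>2 - 1) * (y * (2 * Q - 1) - Q * Q)) :: complex)"
      by (simp only: of_real_add of_real_mult of_real_diff of_real_1 of_real_numeral)
    hence "real (?n 0) * ((1 - 1) * 1) + ?n 1 * ((Q - 1) * Q) + ?n 2 * ((Q\<^sup>2 - 1) * Q\<^sup>2) = (y\<^sup>2 - 1) * (y * (2 * Q - 1) - Q * Q)"
      by (simp only: of_real_eq_iff)
    thus ?thesis by (simp add: mult_ac)
  qed
  have Q2: "Q\<^sup>2 - 1 > 0" using Q by (simp add: one_less_power)
  \<comment> \<open>E2 minus Q times E1 eliminates the size of \<open>Pk 1\<close>;
    \<open>Pk 0\<close> is absent from both because its weight is 1 - 1.\<close>
  have "Q * (Q\<^sup>2 - 1) * (Q - 1) * ?n 2 =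
      ((Q - 1) * Q * ?n 1 + (Q\<^sup>2 - 1) * Q\<^sup>2 * ?n 2) - Q * ((Q - 1) * ?n 1 + (Q\<^sup>2 - 1) * ?n 2)"
    by (simp add: algebra_simps power2_eq_square)
  also have "\<dots> = (y\<^sup>2 - 1) * (y - Q) * (Q - 1)"
    unfolding E1 E2 by (simp add: algebra_simps power2_eq_square)
  finally have "Q * (Q\<^sup>2 - 1) * (Q - 1) * ?n 2 = (y\<^sup>2 - 1) * (y - Q) * (Q - 1)" .
  hence "Q * (Q\<^sup>2 - 1) * ?n 2 = (y\<^sup>2 - 1) * (y - Q)" using Q by simp
  hence "(Q\<^sup>2 - 1) * ?n 2 = (y\<^sup>2 - 1) * (y - Q) / Q"
    using Q by (simp add: eq_divide_eq mult_ac)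
  also have "\<dots> = (y\<^sup>2 - 1) * (y / Q - 1)" using Q by (simp add: diff_divide_distrib right_diff_distrib)
  finally have n2': "(Q\<^sup>2 - 1) * ?n 2 = (y\<^sup>2 - 1) * (y / Q - 1)" .
  thus "real (?n 2) = (y\<^sup>2 - 1) * (y / Q - 1) / (Q\<^sup>2 - 1)"
    using Q2 by (simp add: eq_divide_eq mult.commute)
  have "(Q - 1) * ?n 1 = (Q - 1) * ((y\<^sup>2 - 1) * (y / Q))"
    using E1 unfolding n2' using Q by (simp add: field_simps)
  moreover have "Q - 1 \<noteq> 0" using Q by simp
  ultimately show "real (?n 1) = (y\<^sup>2 - 1) * (y / Q)" by (metis mult_left_cancel)
  have "card P = ?n 0 + ?n 1 + ?n 2" using sum_P_split[of "\<lambda>_. 1::nat"] by simp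
  moreover have "real (card P) = y ^ 3 - 1" by (simp only: real_card_P y_def)
  ultimately show "real (card (Pk 0)) = y ^ 3 - 1 - card (Pk 1) - card (Pk 2)" by simp
  show S2: "(\<Sum>(a, b)\<in>Pk 2. S a b) = of_real (- y * Q * ?n 2)"
  proof -
    have "(\<Sum>(a, b)\<in>Pk 2. S a b) = (\<Sum>(a, b)\<in>Pk 2. - of_nat (p ^ (s + d)))"
      by (rule sum.cong) (auto simp: S_Pk_2)
    thus ?thesis by (simp add: case_prod_beta y_def Q_def power_add mult_ac)
  qed
  show S1: "(\<Sum>(a, b)\<in>Pk 1. S a b) = of_real 0"
  proof -
    have f: "(\<Sum>(a, b)\<in>A. c * S a b) = c * (\<Sum>(a, b)\<in>A. S a b)" for A c
      by (simp add: case_prod_beta sum_distrib_left)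
    have "(of_real 1 - 1) * (\<Sum>(a, b)\<in>Pk 0. S a b) + (of_real Q - 1) * (\<Sum>(a, b)\<in>Pk 1. S a b)
        + (of_real (Q\<^sup>2) - 1) * (\<Sum>(a, b)\<in>Pk 2. S a b)
        = (of_real (y\<^sup>2) - 1) * (- of_real y * (of_real y - of_real Q))"
      using moment_3 unfolding sum_P_split sumk[of "\<lambda>n a b. (of_nat n - 1) * S a b"] f pk .
    hence "of_real (Q - 1) * (\<Sum>(a, b)\<in>Pk 1. S a b) + of_real (Q\<^sup>2 - 1) * (\<Sum>(a, b)\<in>Pk 2. S a b)
        = of_real ((y\<^sup>2 - 1) * (- y * (y - Q)))"
      by simp
    also have "of_real (Q\<^sup>2 - 1) * (\<Sum>(a, b)\<in>Pk 2. S a b) = of_real (- y * Q * ((Q\<^sup>2 - 1) * ?n 2))"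
      unfolding S2 by (simp add: mult_ac)
    \<comment> \<open>\<open>Pk 2\<close> already accounts for the whole third moment, so the signs
      on \<open>Pk 1\<close> cancel.\<close>
    also have "- y * Q * ((Q\<^sup>2 - 1) * ?n 2) = (y\<^sup>2 - 1) * (- y * (y - Q))"
      unfolding n2' using Q by (simp add: field_simps)
    finally have "of_real (Q - 1) * (\<Sum>(a, b)\<in>Pk 1. S a b) = 0" by simp
    moreover have "of_real (Q - 1) \<noteq> (0 :: complex)" using Q by (simp only: of_real_eq_0_iff)
    ultimately show ?thesis by (simp only: mult_eq_0_iff of_real_0) blast
  qed
  \<comment> \<open>Only the total over all pairs sees \<open>Pk 0\<close>; the leading q is the
    contribution of the zero pair.\<close>
  have "of_nat q + ((\<Sum>(a, b)\<in>Pk 0. S a b) + (\<Sum>(a, b)\<in>Pk 1. S a b) + (\<Sum>(a, b)\<in>Pk 2. S a b)) = of_nat (p ^ s * q)"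
    using sum_S sum_P[of "\<lambda>(a, b). S a b"] by (simp add: sum_P_split S_0_0)
  hence "(\<Sum>(a, b)\<in>Pk 0. S a b) = of_nat (p ^ s) * of_nat q - of_nat q - of_real (- y * Q * ?n 2)"
    unfolding S1 S2 of_nat_mult by (simp add: algebra_simps)
  thus "(\<Sum>(a, b)\<in>Pk 0. S a b) = of_real (y\<^sup>2 * (y - 1) + y * Q * ?n 2)"
    unfolding pk by (simp add: algebra_simps)
qed

end

subsection \<open>The case $d' = 2d$\<close>

locale kasami_two = kasami m p q base ext s l d
  for m p q :: nat and base :: "'p::prime_card itself" and ext :: "'a::{field,finite} itself" and s l d +
  assumes gcd_eq: "gcd (s + l) m = 2 * d"
begin

abbreviation L :: "'a set" where "L \<equiv> Fix (2 * d)"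

text \<open>2d divides s + l while s/d and l/d are not both even, so both are odd. For i = 0 one
  would have s = d and l at least 3d, which exceeds m - 1.\<close>

lemma odd_multiples:
  obtains i j where "s = d + 2 * d * i" "l = d + 2 * d * j" "i > 0"
proof -
  obtain s' where s': "s = d * s'" using d_dvd by auto
  obtain l' where l': "l = d * l'" using d_dvd by auto
  have "2 * d dvd s + l" using gcd_eq gcd_dvd1 by metis
  hence "even (s' + l')" using d_pos by (simp add: s' l' distrib_left[symmetric] mult.commute[of 2])
  moreover have "\<not> (even s' \<and> even l')"
  proof
    assume "even s' \<and> even l'"
    hence "d * 2 dvd s" "d * 2 dvd l" unfolding s' l' by (auto intro: mult_dvd_mono)
    hence "d * 2 dvd d * 1" using d_eq by simp
    thus False using d_pos by (simp only: nat_mult_dvd_cancel1) simp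
  qed
  ultimately have "odd s'" "odd l'" by auto
  then obtain i j where ij: "s' = 2 * i + 1" "l' = 2 * j + 1" by (auto elim!: oddE)
  have sl: "s = d + 2 * d * i" "l = d + 2 * d * j" by (simp_all add: s' l' ij algebra_simps)
  moreover have "i > 0"
  proof (rule ccontr)
    assume "\<not> i > 0"
    hence "s = d" "m = 2 * d" using sl m_eq by auto
    hence "j \<noteq> 0" using sl l_neq_s by auto
    hence "2 * d \<le> 2 * d * j" by (cases j) auto
    hence "l \<ge> 3 * d" using sl by linarith
    thus False using l_le \<open>m = 2 * d\<close> d_pos by linarith
  qed
  ultimately show ?thesis using that by blast
qed

lemma three_d_le: "3 * d \<le> s"
proof -
  obtain i j where ij: "s = d + 2 * d * i" "l = d + 2 * d * j" "i > 0" by (rule odd_multiples)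
  hence "2 * d \<le> 2 * d * i" by (cases i) auto
  thus ?thesis using ij by linarith
qed

lemma L_fr:
  assumes "x \<in> L"
  shows "fr (d + 2 * d * i) x = fr d x"
proof -
  have "fr (2 * d * i) x = x" using assms by (intro fr_mult_fix[of "2 * d"]) (simp add: Fix_iff)
  thus ?thesis by (simp add: fr_fr[symmetric])
qed

lemma L_tau: "x \<in> L \<Longrightarrow> tau x = fr d x" and L_sg: "x \<in> L \<Longrightarrow> sg x = fr d x"
  by (metis L_fr odd_multiples)+

lemma L_sgi: "x \<in> L \<Longrightarrow> sgi x = fr d x"
proof -
  assume x: "x \<in> L"
  have "fr d x \<in> L" using x by (rule Fix_fr)
  hence "sg (fr d x) = fr d (fr d x)" by (rule L_sg)
  also have "\<dots> = x" using x by (simp add: fr_fr Fix_iff mult_2)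
  finally show ?thesis by (metis sg_sgi(2))
qed

lemma in_L_iff: "x \<in> L \<longleftrightarrow> tau (sg x) = x"
  using Fix_eq_gcd[of "s + l"] gcd_eq by (metis Fix_iff fr_fr)

lemma two_d_dvd: "2 * d dvd m" using d_dvd m_eq by auto

lemma card_L: "card L = p ^ (2 * d)" by (rule card_Fix[OF two_d_dvd])

text \<open>s and l are odd multiples of d, so \<open>tau\<close>, \<open>sg\<close> and
  \<open>sgi\<close> all restrict to \<open>fr d\<close> on L. Hence \<open>Lm\<close> is semilinear
  over L and its kernel is an L-space.\<close>

lemma Lm_L: "x \<in> L \<Longrightarrow> Lm a b (x * y) = fr d x * Lm a b y"
  by (simp add: Lm_def L_tau L_sg L_sgi algebra_simps)

lemma R_L: "x \<in> L \<Longrightarrow> y \<in> R a b \<Longrightarrow> x * y \<in> R a b"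
  by (simp add: R_def Lm_L)

lemma R_add: "x \<in> R a b \<Longrightarrow> y \<in> R a b \<Longrightarrow> x + y \<in> R a b"
proof -
  have "Lm a b (x + y) = Lm a b x + Lm a b y" by (simp add: Lm_def algebra_simps)
  thus "x \<in> R a b \<Longrightarrow> y \<in> R a b \<Longrightarrow> x + y \<in> R a b" by (simp add: R_def)
qed

text \<open>
  For x and y in the radical, eliminating a from the two equations leaves a semilinear
  equation for the alternating expression D. Its solutions form an L-line, which bounds the
  L-dimension of the radical by 2.
\<close>

lemma radical_elimination:
  assumes "x \<in> R a b" "y \<in> R a b"
  defines "D \<equiv> tau (sg x) * y - x * tau (sg y)"
  shows "sg b * tau (sg D) = b * D"
proof -
  have x: "a * tau x = - (b * sg x + sgi (b * x))" and y: "a * tau y = - (b * sg y + sgi (b * y))"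
    using assms by (simp_all only: eq_neg_iff_add_eq_0 R_def Lm_def mem_Collect_eq add.assoc)
  have "(b * sg x + sgi (b * x)) * tau y = - (a * tau x) * tau y" unfolding x by simp
  also have "\<dots> = - (a * tau y) * tau x" by simp
  also have "\<dots> = (b * sg y + sgi (b * y)) * tau x" unfolding y by simp
  finally have "sg ((b * sg x + sgi (b * x)) * tau y) = sg ((b * sg y + sgi (b * y)) * tau x)" by (rule arg_cong)
  hence "(sg b * sg (sg x) + b * x) * sg (tau y) = (sg b * sg (sg y) + b * y) * sg (tau x)"
    by (simp only: fr_mult fr_add sg_sgi)
  moreover have "tau (sg (tau (sg z))) = sg (sg z)" for z
    by (metis fr_comm tau_tau)
  ultimately show ?thesis
    by (simp add: D_def fr_comm[of s l] algebra_simps)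
qed

lemma radical_cases:
  assumes P: "(a, b) \<in> P"
  shows "card (R a b) = 1 \<or> card (R a b) = p ^ (2 * d) \<or> card (R a b) = p ^ (4 * d)"
proof (cases "R a b = {0}")
  case False
  then obtain x where x: "x \<in> R a b" "x \<noteq> 0" using R_0 by blast
  \<comment> \<open>For b = 0 only a tau(x) remains, with a nonzero, and this has no nonzero
    zero.\<close>
  have b: "b \<noteq> 0" using x P by (auto simp: R_def Lm_def P_iff)
  define D where "D y = tau (sg x) * y - x * tau (sg y)" for y
  have D0: "y / x \<in> L" if "D y = 0" for y
    using that x(2) unfolding in_L_iff D_def by (simp add: field_simps)
  show ?thesis
  proof (cases "\<exists>y\<in>R a b. D y \<noteq> 0")
    case False
    have "bij_betw (\<lambda>u. u * x) L (R a b)"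
      by (rule bij_betwI[where g = "\<lambda>y. y / x"]) (use x False D0 in \<open>auto intro: R_L\<close>)
    hence "card (R a b) = p ^ (2 * d)" using card_L by (simp add: bij_betw_same_card)
    thus ?thesis by simp
  next
    case True
    then obtain y where y: "y \<in> R a b" "D y \<noteq> 0" by auto
    have DL: "D (u * z) = u * D z" if "u \<in> L" for u z
      using that unfolding in_L_iff D_def by (simp add: algebra_simps)
    have Dadd: "D (u + v) = D u + D v" for u v by (simp add: D_def algebra_simps)
    have Dx: "D x = 0" by (simp add: D_def)
    \<comment> \<open>D z and D y satisfy the same semilinear equation; multiplying crosswise
      cancels its coefficients, so the quotient is fixed by the composition of \<open>tau\<close>
      and \<open>sg\<close>.\<close>
    have quot: "D z / D y \<in> L" if z: "z \<in> R a b" for z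
    proof -
      have "sg b * tau (sg (D z)) = b * D z" "sg b * tau (sg (D y)) = b * D y"
        unfolding D_def by (rule radical_elimination[OF x(1)], fact)+
      hence "(sg b * tau (sg (D z))) * (b * D y) = (b * D z) * (sg b * tau (sg (D y)))" by simp
      hence "tau (sg (D z)) * D y = D z * tau (sg (D y))" using b by simp
      thus ?thesis using y(2) unfolding in_L_iff by (simp add: field_simps)
    qed
    have "bij_betw (\<lambda>(u, v). u * x + v * y) (L \<times> L) (R a b)"
    \<comment> \<open>D is L-linear and vanishes at x, so it reads off the coordinate along y; the
      rest has D = 0 and is an L-multiple of x.\<close>
    proof (rule bij_betwI[where g = "\<lambda>z. ((z - D z / D y * y) / x, D z / D y)"])
      show "(\<lambda>(u, v). u * x + v * y) \<in> L \<times> L \<rightarrow> R a b"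
        using x y by (auto intro!: R_add R_L)
      show "(\<lambda>z. ((z - D z / D y * y) / x, D z / D y)) \<in> R a b \<rightarrow> L \<times> L"
      proof
        fix z assume z: "z \<in> R a b"
        have "D (z - D z / D y * y + D z / D y * y) = D (z - D z / D y * y) + D z / D y * D y"
          unfolding Dadd DL[OF quot[OF z]] ..
        hence "D (z - D z / D y * y) = 0" using y(2) by simp
        thus "((z - D z / D y * y) / x, D z / D y) \<in> L \<times> L" using D0 quot[OF z] by simp
      qed
      fix uv assume "uv \<in> L \<times> L"
      then obtain u v where uv: "uv = (u, v)" "u \<in> L" "v \<in> L" by auto
      have "D (u * x + v * y) = v * D y" using uv by (simp add: Dadd DL Dx)
      thus "(\<lambda>z. ((z - D z / D y * y) / x, D z / D y)) (case uv of (u, v) \<Rightarrow> u * x + v * y) = uv"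
        using uv x y by simp
    next
      fix z assume "z \<in> R a b"
      show "(case ((z - D z / D y * y) / x, D z / D y) of (u, v) \<Rightarrow> u * x + v * y) = z"
        using x by simp
    qed
    hence "card (R a b) = card (L \<times> L)" by (simp add: bij_betw_same_card)
    hence "card (R a b) = p ^ (4 * d)" by (simp add: card_cartesian_product card_L power_add[symmetric])
    thus ?thesis by simp
  qed
qed simp

text \<open>The kernel of the norm from L to K.\<close>

definition U :: "'a set" where "U = {u. u * fr d u = 1}"

lemma card_U: "card U = p ^ d + 1"
proof -
  have "p ^ (2 * d) = p ^ d * p ^ d" by (simp add: mult_2 power_add)
  hence "(p ^ d + 1) * (p ^ d - 1) = p ^ (2 * d) - 1" by (simp add: algebra_simps)
  hence "p ^ d + 1 dvd p ^ (2 * d) - 1" by (metis dvd_triv_left)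
  also obtain k where "m = 2 * d * k" using two_d_dvd by auto
  hence "p ^ (2 * d) - 1 dvd q - 1"
    unfolding q_eq using minus_one_dvd_power_minus_one[of "p ^ (2 * d)" k] by (simp add: power_mult)
  finally have "p ^ d + 1 dvd CARD('a) - 1" by (simp only: q_card)
  from card_power_eq_one[OF this] show ?thesis by (simp add: U_def fr_def)
qed

lemma U_L:
  assumes "u \<in> U"
  shows "u \<in> L"
proof -
  have "fr d (u * fr d u) = 1" using assms by (simp add: U_def del: fr_mult)
  hence "fr d u * fr d (fr d u) = u * fr d u" using assms by (simp add: U_def)
  moreover have "fr d u \<noteq> 0" using assms by (auto simp: U_def)
  ultimately have "fr d (fr d u) = u" by (simp add: mult.commute)
  thus ?thesis by (simp add: Fix_iff fr_fr mult_2)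
qed

text \<open>On U both scaling factors of \<open>Qf_scale\<close> are u fr d u = 1.\<close>

lemma Qf_U:
  assumes "u \<in> U"
  shows "Qf a b (u * x) = Qf a b x"
  using assms U_L[OF assms] by (simp add: Qf_scale L_tau L_sg U_def)

text \<open>The group U acts freely on the nonzero vectors, which determines the sign of S modulo the order of U.\<close>

lemma S_eq:
  assumes P: "(a, b) \<in> P" and k: "card (R a b) = p ^ (2 * k * d)"
  shows "S a b = of_int ((- 1) ^ Suc k * int p ^ (s + k * d))"
proof -
  have a: "a \<in> F" using P by (simp add: P_iff)
  have "q * card (R a b) = p ^ (2 * (s + k * d))"
    unfolding k by (simp add: q_eq m_eq power_add[symmetric] algebra_simps)
  from S_even[OF a this] obtain eps :: int where eps: "eps \<in> {1, -1}"
    "S a b = of_int (eps * int p ^ (s + k * d))"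
    "int (card {x. Qf a b x = 0}) - int (card {x. Qf a b x = 1}) = eps * int p ^ (s + k * d)"
    by blast
  have U: "1 \<in> U" "0 \<notin> U" "\<And>u v. u \<in> U \<Longrightarrow> v \<in> U \<Longrightarrow> u * v \<in> U" "\<And>u. u \<in> U \<Longrightarrow> inverse u \<in> U"
  proof -
    fix u v assume uv: "u \<in> U" "v \<in> U"
    have "u * v * fr d (u * v) = (u * fr d u) * (v * fr d v)" by simp
    also have "\<dots> = 1" using uv by (simp add: U_def)
    finally show "u * v \<in> U" by (simp only: U_def mem_Collect_eq)
  next
    fix u assume "u \<in> U"
    thus "inverse u \<in> U" by (simp add: U_def inverse_eq_divide)
  qed (auto simp: U_def)
  \<comment> \<open>The zero vector is the one element outside the free orbits; it yields the 1 in
    the congruence below.\<close>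
  have "card U dvd card ({x. Qf a b x = 0} - {0})"
    by (rule card_dvd_card_if_mult_closed) (use U Qf_U in auto)
  moreover have "card {x. Qf a b x = 0} = Suc (card ({x. Qf a b x = 0} - {0}))"
    by (rule card.remove) (auto simp: Qf_def)
  moreover have "card U dvd card {x. Qf a b x = 1}"
    by (rule card_dvd_card_if_mult_closed) (use U Qf_U in \<open>auto simp: Qf_def\<close>)
  ultimately obtain x y where "card {x. Qf a b x = 0} = Suc (card U * x)" "card {x. Qf a b x = 1} = card U * y"
    by (auto elim!: dvdE)
  hence "eps * int p ^ (s + k * d) - 1 = int (card U) * (int x - int y)"
    using eps(3) by (simp add: algebra_simps)
  hence 1: "[eps * int p ^ (s + k * d) = 1] (mod (int p ^ d + 1))"
    by (simp add: cong_iff_dvd_diff card_U add.commute)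
  obtain i j where ij: "s = d + 2 * d * i" "l = d + 2 * d * j" "i > 0" by (rule odd_multiples)
  \<comment> \<open>s is an odd multiple of d and p^d is -1 modulo p^d + 1, so the parity of k
    decides the residue.\<close>
  have "s + k * d = d * (2 * i + Suc k)" by (simp add: ij algebra_simps)
  hence "int p ^ (s + k * d) = (int p ^ d) ^ (2 * i + Suc k)" by (simp only: power_mult)
  moreover have "[int p ^ d = - 1] (mod (int p ^ d + 1))" by (simp add: cong_iff_dvd_diff)
  hence "[(int p ^ d) ^ (2 * i + Suc k) = (- 1) ^ (2 * i + Suc k)] (mod (int p ^ d + 1))" by (rule cong_pow)
  ultimately have "[int p ^ (s + k * d) = (- 1) ^ Suc k] (mod (int p ^ d + 1))"
    by (simp add: power_add power_mult)
  hence "[eps * int p ^ (s + k * d) = eps * (- 1) ^ Suc k] (mod (int p ^ d + 1))" by (rule cong_scalar_left)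
  hence "[eps * (- 1) ^ Suc k = 1] (mod (int p ^ d + 1))" using 1 cong_trans cong_sym by blast
  hence dvd: "int p ^ d + 1 dvd eps * (- 1) ^ Suc k - 1" by (simp only: cong_iff_dvd_diff)
  \<comment> \<open>The modulus is at least 4, hence it tells 1 from -1.\<close>
  have "p ^ 1 \<le> p ^ d" using p_gt_1 d_pos by (intro power_increasing) auto
  hence "3 \<le> p ^ d" using p_ge_3 by simp
  hence "int 3 \<le> int (p ^ d)" by (simp only: of_nat_le_iff)
  hence big: "int p ^ d + 1 \<ge> 4" by simp
  have "eps = (- 1) ^ Suc k"
  proof (rule ccontr)
    assume ne: "eps \<noteq> (- 1) ^ Suc k"
    have "(- 1 :: int) ^ Suc k = 1 \<or> (- 1 :: int) ^ Suc k = - 1" by (cases "even k") auto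
    hence "eps * (- 1) ^ Suc k = - 1" using ne eps(1) by auto
    hence "int p ^ d + 1 dvd - 2" using dvd by simp
    hence "int p ^ d + 1 dvd 2" by simp
    hence "int p ^ d + 1 \<le> 2" by (rule zdvd_imp_le) simp
    thus False using big by simp
  qed
  thus ?thesis using eps(2) by simp
qed

text \<open>Both conditions together put z into L, where each of them says fr d z = -z; these z form
  a complement of K in L.\<close>

lemma card_anti_fixed: "card {z. sg z = - z \<and> tau z = - z} = p ^ d"
proof -
  have "{z. sg z = - z \<and> tau z = - z} = {z. fr d z = - z}"
  proof (intro Collect_cong iffI)
    fix z assume z: "sg z = - z \<and> tau z = - z"
    hence "z \<in> L" by (simp add: in_L_iff)
    thus "fr d z = - z" using z L_tau by simp
  next
    fix z assume z: "fr d z = - z"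
    hence "z \<in> L" by (simp add: Fix_iff mult_2 fr_fr[symmetric])
    thus "sg z = - z \<and> tau z = - z" using z L_tau L_sg by simp
  qed
  moreover have "card (K \<times> {z. fr d z = - z}) = card L"
    using bij_Fix_anti_Fix[of d] by (rule bij_betw_same_card)
  hence "p ^ d * card {z. fr d z = - z} = p ^ (2 * d)"
    by (simp only: card_cartesian_product card_K card_L)
  hence "p ^ d * card {z. fr d z = - z} = p ^ d * p ^ d" by (simp only: mult_2 power_add)
  hence "card {z. fr d z = - z} = p ^ d" using p_gt_1 by simp
  ultimately show ?thesis by simp
qed

text \<open>These b are the ones for which some a in F puts 1 into the radical. Writing b = u + z,
  the symmetric part is free and z must be negated by \<open>sg\<close>.\<close>

lemma card_sgi_fixed: "card {b. b + sgi b \<in> F} = p ^ s * p ^ d"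
proof -
  have *: "(u + z) + sgi (u + z) \<in> F \<longleftrightarrow> sg z = - z" if "u \<in> F" "z \<in> Alt" for u z
  proof -
    have u: "u + sgi u \<in> F" using that by auto
    have z: "tau (z + sgi z) = - (z + sgi z)" using that by (simp add: Alt_def fr_comm[of s])
    have "(u + z) + sgi (u + z) \<in> F \<longleftrightarrow> (u + sgi u) + (z + sgi z) \<in> F" by (simp add: ac_simps)
    also have "\<dots> \<longleftrightarrow> z + sgi z \<in> F" using u by (metis Fix_add Fix_diff add_diff_cancel_left')
    also have "\<dots> \<longleftrightarrow> z + sgi z = 0"
    proof
      assume "z + sgi z \<in> F"
      hence "z + sgi z = - (z + sgi z)" using z by (metis Fix_iff)
      hence "2 * (z + sgi z) = 0" by (simp only: mult_2) (metis add.right_inverse)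
      thus "z + sgi z = 0" by (metis mult_eq_0_iff two_neq_0)
    qed simp
    also have "\<dots> \<longleftrightarrow> sg (z + sgi z) = 0" by (simp del: fr_add)
    also have "\<dots> \<longleftrightarrow> sg z = - z" by (simp add: eq_neg_iff_add_eq_0)
    finally show ?thesis .
  qed
  have "card {b. b + sgi b \<in> F} = (\<Sum>b\<in>UNIV. if b + sgi b \<in> F then 1 else 0)" by (simp add: sum.If_cases)
  also have "\<dots> = (\<Sum>u\<in>F. \<Sum>z\<in>Alt. if (u + z) + sgi (u + z) \<in> F then 1 else 0)" by (rule sum_decompose)
  also have "\<dots> = (\<Sum>u\<in>F. \<Sum>z\<in>Alt. if sg z = - z then 1 else 0)"
    by (intro sum.cong refl) (simp only: *)
  also have "\<dots> = p ^ s * card {z \<in> Alt. sg z = - z}"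
    by (simp add: card_F sum.If_cases Int_def)
  also have "{z \<in> Alt. sg z = - z} = {z. sg z = - z \<and> tau z = - z}" by (auto simp: Alt_def)
  finally show ?thesis by (simp add: card_anti_fixed)
qed

lemma moment_1: "(\<Sum>(a, b)\<in>P. of_nat (card (R a b)) - 1) = (of_nat q - 1) * (of_nat (p ^ s) * of_nat (p ^ d) - 1 :: complex)"
proof -
  have "bij_betw snd {(a, b) \<in> P. 1 \<in> R a b} ({b. b + sgi b \<in> F} - {0})"
  proof (rule bij_betwI[where g = "\<lambda>b. (- (b + sgi b), b)"])
    have 1: "1 \<in> R a b \<longleftrightarrow> a = - (b + sgi b)" for a b
      by (simp only: eq_neg_iff_add_eq_0) (simp add: R_def Lm_def add.assoc)
    have F: "- x \<in> F \<longleftrightarrow> x \<in> F" for x by (metis Fix_minus minus_minus)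
    show "snd \<in> {(a, b) \<in> P. 1 \<in> R a b} \<rightarrow> {b. b + sgi b \<in> F} - {0}"
    proof
      fix ab assume "ab \<in> {(a, b) \<in> P. 1 \<in> R a b}"
      then obtain b where "ab = (- (b + sgi b), b)" "(- (b + sgi b), b) \<in> P" unfolding 1 by auto
      thus "snd ab \<in> {b. b + sgi b \<in> F} - {0}" using F[of "b + sgi b"] by (auto simp: P_iff)
    qed
    show "(\<lambda>b. (- (b + sgi b), b)) \<in> {b. b + sgi b \<in> F} - {0} \<rightarrow> {(a, b) \<in> P. 1 \<in> R a b}"
    proof
      fix b assume b: "b \<in> {b. b + sgi b \<in> F} - {0}"
      hence "- (b + sgi b) \<in> F" using F by blast
      thus "(- (b + sgi b), b) \<in> {(a, b) \<in> P. 1 \<in> R a b}" using b unfolding 1 P_iff by blast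
    qed
    fix ab assume "ab \<in> {(a, b) \<in> P. 1 \<in> R a b}"
    thus "(- (snd ab + sgi (snd ab)), snd ab) = ab" unfolding 1 by auto
  qed simp
  hence "card {(a, b) \<in> P. 1 \<in> R a b} = card ({b. b + sgi b \<in> F} - {0})" by (rule bij_betw_same_card)
  also have "\<dots> = p ^ s * p ^ d - 1" by (subst card_Diff_singleton) (simp_all add: card_sgi_fixed)
  finally have c: "card {(a, b) \<in> P. 1 \<in> R a b} = p ^ s * p ^ d - 1" .
  have "1 \<le> p ^ s * p ^ d" using p_gt_1 by (simp add: Suc_le_eq)
  hence "(\<Sum>(a, b)\<in>{(a, b) \<in> P. 1 \<in> R a b}. 1 :: complex) = of_nat (p ^ s) * of_nat (p ^ d) - 1"
    using c by (simp add: case_prod_beta of_nat_diff)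
  thus ?thesis using incidence[of "\<lambda>_. 1"] by (simp only: mult_1_right)
qed

definition Pk :: "nat \<Rightarrow> ('a \<times> 'a) set" where "Pk k = {(a, b) \<in> P. card (R a b) = p ^ (2 * k * d)}"

lemma Pk_iff: "(a, b) \<in> Pk k \<longleftrightarrow> (a, b) \<in> P \<and> card (R a b) = p ^ (2 * k * d)"
  by (simp add: Pk_def)

lemma sum_P_split: "(\<Sum>ab\<in>P. f ab) = (\<Sum>ab\<in>Pk 0. f ab) + (\<Sum>ab\<in>Pk 1. f ab) + (\<Sum>ab\<in>Pk 2. f ab)"
  for f :: "'a \<times> 'a \<Rightarrow> 'z::comm_monoid_add"
proof -
  have inj: "p ^ (2 * j * d) = p ^ (2 * k * d) \<longleftrightarrow> j = k" for j k
    using p_gt_1 d_pos by (simp add: power_inject_exp)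
  have "P = Pk 0 \<union> Pk 1 \<union> Pk 2" using radical_cases by (auto simp: Pk_def)
  moreover have disj: "Pk j \<inter> Pk k = {}" if "j \<noteq> k" for j k
    using inj that unfolding Pk_def by (auto simp: disjoint_iff)
  hence "(Pk 0 \<union> Pk 1) \<inter> Pk 2 = {}" "Pk 0 \<inter> Pk 1 = {}" by (simp_all add: Int_Un_distrib2)
  ultimately show ?thesis by (simp add: sum.union_disjoint)
qed

lemma sum_S_Pk: "(\<Sum>(a, b)\<in>Pk k. S a b) = of_real ((- 1) ^ Suc k * real p ^ (s + k * d) * card (Pk k))"
proof -
  have "(\<Sum>(a, b)\<in>Pk k. S a b) = (\<Sum>(a, b)\<in>Pk k. of_int ((- 1) ^ Suc k * int p ^ (s + k * d)))"
    by (rule sum.cong) (auto simp: Pk_iff S_eq simp del: of_int_mult)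
  thus ?thesis by (simp add: case_prod_beta)
qed

lemma sum_V_Pk: "(\<Sum>(a, b)\<in>Pk k. V a b w) = card (Pk k) * W (p ^ (2 * k * d)) (s + k * d) ((- 1) ^ Suc k) w"
proof -
  have "V a b w = W (p ^ (2 * k * d)) (s + k * d) ((- 1) ^ Suc k) w" if "(a, b) \<in> Pk k" for a b
  proof -
    have ab: "(a, b) \<in> P" "card (R a b) = p ^ (2 * k * d)" using that by (auto simp: Pk_iff)
    have "q * card (R a b) = p ^ (2 * (s + k * d))"
      unfolding ab(2) by (simp add: q_eq m_eq power_add[symmetric] algebra_simps)
    from V_even[OF _ this S_eq[OF ab]] ab(1) have "V a b = W (card (R a b)) (s + k * d) (of_int ((- 1) ^ Suc k))"
      by (simp add: P_iff)
    thus ?thesis by (simp add: ab(2))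
  qed
  hence "(\<Sum>(a, b)\<in>Pk k. V a b w) = (\<Sum>(a, b)\<in>Pk k. W (p ^ (2 * k * d)) (s + k * d) ((- 1) ^ Suc k) w)"
    by (intro sum.cong) auto
  thus ?thesis by (simp add: case_prod_beta)
qed

lemma rank_counts:
  defines "Q \<equiv> real p ^ d" and "y \<equiv> real p ^ s"
  shows "real (card (Pk 2)) = (y\<^sup>2 - 1) * (y / Q - 1) / ((Q\<^sup>2 - 1) * (Q + 1))"
    and "(Q + 1) * real (card (Pk 1)) = (y\<^sup>2 - 1) * (y + 1) + (Q\<^sup>2 - 1) * card (Pk 2)"
    and "real (card (Pk 0)) = y ^ 3 - 1 - card (Pk 1) - card (Pk 2)"
proof -
  let ?n = "\<lambda>k. real (card (Pk k))"
  have Q: "Q > 1" unfolding Q_def using p_gt_1 d_pos by (simp add: one_less_power)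
  have y: "y > 0" unfolding y_def using p_gt_1 by simp
  have q: "real q = y\<^sup>2" by (simp add: q_sq y_def)
  have sumk: "(\<Sum>(a, b)\<in>Pk k. f (card (R a b)) a b) = (\<Sum>(a, b)\<in>Pk k. f (p ^ (2 * k * d)) a b)" for k and f :: "nat \<Rightarrow> 'a \<Rightarrow> 'a \<Rightarrow> complex"
    by (rule sum.cong) (auto simp: Pk_iff)
  have const: "(\<Sum>(a, b)\<in>A. c) = of_real (real (card A)) * (c :: complex)" for A :: "('a \<times> 'a) set" and c
    by (simp add: case_prod_beta)
  have pk: "of_nat (p ^ (2 * 0 * d)) = (of_real 1 :: complex)" "of_nat (p ^ (2 * 1 * d)) = (of_real (Q\<^sup>2) :: complex)"
    "of_nat (p ^ (2 * 2 * d)) = (of_real (Q ^ 4) :: complex)" "of_nat q = (of_real (y\<^sup>2) :: complex)"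
    "of_nat (p ^ s) = (of_real y :: complex)" "of_nat (p ^ d) = (of_real Q :: complex)"
    by (simp_all add: Q_def y_def q_sq power_mult[symmetric] mult.commute)
  have E1: "(Q\<^sup>2 - 1) * ?n 1 + (Q ^ 4 - 1) * ?n 2 = (y\<^sup>2 - 1) * (y * Q - 1)"
  proof -
    have "of_real (?n 0) * (of_real 1 - 1) + of_real (?n 1) * (of_real (Q\<^sup>2) - 1) + of_real (?n 2) * (of_real (Q ^ 4) - 1)
        = (of_real (y\<^sup>2) - 1) * (of_real y * of_real Q - 1 :: complex)"
      using moment_1 unfolding sum_P_split sumk[of "\<lambda>n a b. of_nat n - 1"] const pk .
    hence "of_real (?n 0 * (1 - 1) + ?n 1 * (Q\<^sup>2 - 1) + ?n 2 * (Q ^ 4 - 1)) = (of_real ((y\<^sup>2 - 1) * (y * Q - 1)) :: complex)"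
      by (simp only: of_real_add of_real_mult of_real_diff of_real_1)
    hence "?n 0 * (1 - 1) + ?n 1 * (Q\<^sup>2 - 1) + ?n 2 * (Q ^ 4 - 1) = (y\<^sup>2 - 1) * (y * Q - 1)" by (simp only: of_real_eq_iff)
    thus ?thesis by (simp add: mult.commute)
  qed
  have "card P = card (Pk 0) + card (Pk 1) + card (Pk 2)" using sum_P_split[of "\<lambda>_. 1::nat"] by simp
  moreover have "real (card P) = y ^ 3 - 1" by (simp only: real_card_P y_def)
  ultimately show n0: "?n 0 = y ^ 3 - 1 - ?n 1 - ?n 2" by simp
  \<comment> \<open>On \<open>Pk k\<close> the sum S is constant, with sign alternating in k, so the
    total of S is a third linear equation for the sizes.\<close>
  have "of_nat q + ((\<Sum>(a, b)\<in>Pk 0. S a b) + (\<Sum>(a, b)\<in>Pk 1. S a b) + (\<Sum>(a, b)\<in>Pk 2. S a b)) = of_nat (p ^ s * q)"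
    using sum_S sum_P[of "\<lambda>(a, b). S a b"] by (simp add: sum_P_split S_0_0)
  hence "of_real (y\<^sup>2 + (- y * ?n 0 + y * Q * ?n 1 - y * Q\<^sup>2 * ?n 2)) = (of_real (y * y\<^sup>2) :: complex)"
    unfolding sum_S_Pk of_nat_mult pk
    by (simp add: power_add y_def Q_def power_mult[symmetric] mult.commute)
  hence "y\<^sup>2 + (- y * ?n 0 + y * Q * ?n 1 - y * Q\<^sup>2 * ?n 2) = y * y\<^sup>2" by (simp only: of_real_eq_iff)
  hence "y * ((Q + 1) * ?n 1) = y * ((y\<^sup>2 - 1) * (y + 1) + (Q\<^sup>2 - 1) * ?n 2)"
    unfolding n0 by (simp add: algebra_simps power2_eq_square power3_eq_cube)
  thus n1: "(Q + 1) * ?n 1 = (y\<^sup>2 - 1) * (y + 1) + (Q\<^sup>2 - 1) * ?n 2"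
    using y by (metis mult_left_cancel order_less_irrefl)
  \<comment> \<open>E1 minus Q - 1 times the equation for \<open>?n 1\<close> leaves only
    \<open>?n 2\<close>.\<close>
  have "Q * ((Q\<^sup>2 - 1) * (Q + 1) * ?n 2) =
      ((Q\<^sup>2 - 1) * ?n 1 + (Q ^ 4 - 1) * ?n 2) - (Q - 1) * ((Q + 1) * ?n 1) + (Q - 1) * (Q\<^sup>2 - 1) * ?n 2"
    by (simp add: algebra_simps power2_eq_square power4_eq_xxxx)
  also have "\<dots> = (y\<^sup>2 - 1) * (y - Q)"
    unfolding E1 n1 by (simp add: algebra_simps power2_eq_square)
  finally have "(Q\<^sup>2 - 1) * (Q + 1) * ?n 2 = (y\<^sup>2 - 1) * (y - Q) / Q"
    using Q by (simp add: eq_divide_eq mult_ac)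
  also have "\<dots> = (y\<^sup>2 - 1) * (y / Q - 1)" using Q by (simp add: diff_divide_distrib right_diff_distrib)
  finally have "(Q\<^sup>2 - 1) * (Q + 1) * ?n 2 = (y\<^sup>2 - 1) * (y / Q - 1)" .
  hence "?n 2 * ((Q\<^sup>2 - 1) * (Q + 1)) = (y\<^sup>2 - 1) * (y / Q - 1)" by (simp only: mult.commute)
  moreover have "Q\<^sup>2 - 1 > 0" using Q by (simp add: one_less_power)
  hence "(Q\<^sup>2 - 1) * (Q + 1) \<noteq> 0" using Q by (intro no_zero_divisors) linarith+
  ultimately show "?n 2 = (y\<^sup>2 - 1) * (y / Q - 1) / ((Q\<^sup>2 - 1) * (Q + 1))"
    by (subst nonzero_eq_divide_eq)
qed

lemma card_R_less:
  assumes "(a, b) \<in> P"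
  shows "card (R a b) < q"
proof -
  have "p ^ (4 * d) < p ^ m" using three_d_le d_pos m_eq p_gt_1 by (intro power_strict_increasing) auto
  moreover have "p ^ (2 * d) < p ^ m" using three_d_le d_pos m_eq p_gt_1 by (intro power_strict_increasing) auto
  moreover have "1 < p ^ m" using p_gt_1 m_pos by (metis one_less_power)
  ultimately show ?thesis using radical_cases[OF assms] unfolding q_eq by auto
qed

end

subsection \<open>The weight distribution\<close>

text \<open>Tables and weight counts both become linear combinations of \<open>ind w x\<close> at
  the same few points x, so it suffices to match coefficients, even if some points coincide.\<close>

definition ind :: "real \<Rightarrow> real \<Rightarrow> real" where "ind w x = (if x = w then 1 else 0)"

lemma table_count_Cons: "table_count ((x, k) # T) w = k * ind w x + table_count T w"
  and table_count_Nil: "table_count [] w = 0"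
  by (auto simp: table_count_def ind_def)

lemma power_pred: "n > 0 \<Longrightarrow> x \<noteq> 0 \<Longrightarrow> x ^ (n - 1) = x ^ n / (x :: real)"
  by (simp add: power_diff)

text \<open>The tables print factored weights. These forms isolate the product g x, which will be
  p^(m-1), and leave the generic weight plus a correction.\<close>

lemma weight_expansions:
  fixes g x P :: real
  shows "g * (P - 1) * (x + 1) = (P - 1) * (g * x) + (P - 1) * g"
    and "g * (P - 1) * (x - 1) = (P - 1) * (g * x) - (P - 1) * g"
    and "g * (x * P - x + 1) = (P - 1) * (g * x) + g"
    and "g * (x * P - x - 1) = (P - 1) * (g * x) - g"
  by (simp_all add: algebra_simps)

text \<open>With y = p^s and Y = p^(s-d), the left sides are the numbers of pairs with trivial
  radical and S positive or negative, as \<open>sum_V_even\<close> gives them; the right sides are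
  factored as in the tables.\<close>

lemma two_sign_counts:
  fixes Q Y n2 :: real
  assumes Q: "Q > 1" and y: "y = Q * Y" and n2: "n2 = (y\<^sup>2 - 1) * (Y - 1) / (Q\<^sup>2 - 1)"
  shows "(y ^ 3 - 1 - (y\<^sup>2 - 1) * Y - n2 + (y * (y - 1) + Q * n2)) / 2 = Q * (y + 1) * (y\<^sup>2 - 1) / (2 * (Q + 1))"
      (is "?X / 2 = _")
    and "(y ^ 3 - 1 - (y\<^sup>2 - 1) * Y - n2 - (y * (y - 1) + Q * n2)) / 2 = Q * (y\<^sup>2 - 2 * (Q * Y\<^sup>2) + 1) * (y - 1) / (2 * (Q - 1))"
      (is "?Z / 2 = _")
proof -
  have "Q * Q > 1 * 1" using Q by (intro mult_strict_mono) auto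
  hence "Q\<^sup>2 - 1 \<noteq> 0" by (simp add: power2_eq_square)
  hence "(Q\<^sup>2 - 1) * n2 = (y\<^sup>2 - 1) * (Y - 1)" unfolding n2 by simp
  moreover have "(Q + 1) * (Q - 1) = Q\<^sup>2 - 1" by (simp add: power2_eq_square algebra_simps)
  ultimately have n: "(Q + 1) * (Q - 1) * n2 = (y\<^sup>2 - 1) * (Y - 1)" by simp
  have "(Q + 1) * ?X = (Q + 1) * (y ^ 3 - 1 - (y\<^sup>2 - 1) * Y + y * (y - 1)) + (Q + 1) * (Q - 1) * n2"
    by (simp add: algebra_simps)
  also have "\<dots> = Q * (y + 1) * (y\<^sup>2 - 1)"
    unfolding n unfolding y by (simp add: algebra_simps power2_eq_square power3_eq_cube)
  finally have *: "(Q + 1) * ?X = Q * (y + 1) * (y\<^sup>2 - 1)" .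
  have nz: "Q + 1 \<noteq> 0" "Q - 1 \<noteq> 0" using Q by auto
  show "?X / 2 = Q * (y + 1) * (y\<^sup>2 - 1) / (2 * (Q + 1))"
    by (simp only: *[symmetric] mult.commute[of 2] mult_divide_mult_cancel_left[OF nz(1)])
  have "(Q - 1) * ?Z = (Q - 1) * (y ^ 3 - 1 - (y\<^sup>2 - 1) * Y - y * (y - 1)) - (Q + 1) * (Q - 1) * n2"
    by (simp add: algebra_simps)
  also have "\<dots> = Q * (y\<^sup>2 - 2 * (Q * Y\<^sup>2) + 1) * (y - 1)"
    unfolding n unfolding y by (simp add: algebra_simps power2_eq_square power3_eq_cube)
  finally have **: "(Q - 1) * ?Z = Q * (y\<^sup>2 - 2 * (Q * Y\<^sup>2) + 1) * (y - 1)" .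
  show "?Z / 2 = Q * (y\<^sup>2 - 2 * (Q * Y\<^sup>2) + 1) * (y - 1) / (2 * (Q - 1))"
    unfolding **[symmetric] by (simp only: mult.commute[of 2] mult_divide_mult_cancel_left[OF nz(2)])
qed

context kasami
begin

lemma W_ind: "W r e eps w = real q / r * (ind w (real q - real q / p - eps * (real p - 1) * real p ^ e / p)
      + (real p - 1) * ind w (real q - real q / p + eps * real p ^ e / p))
    + (real q - real q / r) * p * ind w (real q - real q / p)"
  unfolding W_def ind_def diff_diff_eq[symmetric] diff_diff_eq2 by (simp add: add_diff_eq diff_add_eq)

lemma W_plus: "W r e 1 w = real q / r * (ind w (real q - real q / p - (real p - 1) * (real p ^ e / p))
      + (real p - 1) * ind w (real q - real q / p + real p ^ e / p))
    + (real q - real q / r) * p * ind w (real q - real q / p)"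
  by (simp add: W_ind)

lemma W_minus: "W r e (- 1) w = real q / r * (ind w (real q - real q / p + (real p - 1) * (real p ^ e / p))
      + (real p - 1) * ind w (real q - real q / p - real p ^ e / p))
    + (real q - real q / r) * p * ind w (real q - real q / p)"
proof -
  have "real q - real q / p - (- 1) * (real p - 1) * real p ^ e / p = real q - real q / p + (real p - 1) * (real p ^ e / p)"
    "real q - real q / p + (- 1) * real p ^ e / p = real q - real q / p - real p ^ e / p"
    using p_gt_1 by (simp_all add: field_simps)
  thus ?thesis by (simp only: W_ind)
qed

lemma W_zero_form:
  "W q m 1 w = ind w 0 + (real p - 1) * ind w (real q) + (real q - 1) * p * ind w (real q - real q / p)"
proof -
  have pm: "real p ^ m = real q" by (simp add: q_eq)
  have e: "real q - real q / p - 1 * (real p - 1) * real q / p = 0" "real q - real q / p + 1 * real q / p = real q"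
    using p_gt_1 by (simp_all add: field_simps)
  have "real q > 0" using q_eq p_gt_1 by simp
  thus ?thesis unfolding W_ind pm e by simp
qed

lemma W_odd_ind: "W_odd r e w = real q / r * (ind w (real q - real q / p)
      + (real p - 1) / 2 * ind w (real q - real q / p - real p ^ e)
      + (real p - 1) / 2 * ind w (real q - real q / p + real p ^ e))
    + (real q - real q / r) * p * ind w (real q - real q / p)"
  unfolding W_odd_def ind_def diff_diff_eq[symmetric] diff_diff_eq2 by (simp add: add_diff_eq diff_add_eq)

text \<open>Equality for all real w also yields the second conjunct, since no word has a weight
  outside 0, ..., n.\<close>

lemma has_weight_distributionI:
  assumes "\<And>w. real (card {v \<in> code. real (hamming_weight v) = w}) = table_count T w"
  shows "has_weight_distribution code T"
  unfolding has_weight_distribution_def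
proof (intro conjI allI impI)
  fix i
  have "weight_count code i = card {v \<in> code. real (hamming_weight v) = real i}"
    unfolding weight_count_def by (simp only: of_nat_eq_iff)
  thus "real (weight_count code i) = table_count T (real i)" using assms[of "real i"] by (simp only:)
next
  fix w assume w: "w \<notin> real ` {0..code_length code}"
  have "hamming_weight v \<le> code_length code" for v :: "('p mod_ring, 'a) vec"
    unfolding hamming_weight_def code_length_def by (rule card_mono) auto
  hence "{v \<in> code. real (hamming_weight v) = w} = {}" using w by auto
  thus "table_count T w = 0" using assms[of w] by (simp only: card.empty of_nat_0)
qed

end

section \<open>The tables for d' = d\<close>

context kasami_eq
begin

text \<open>If d = s, as for l = 0, then p^(2d) = q; the case is excluded by the count of
  \<open>Pk 2\<close>, which is then 0.\<close>

lemma card_R_less: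
  assumes "(a, b) \<in> P"
  shows "card (R a b) < q"
proof -
  have q: "p ^ k < q" if "k < m" for k
    unfolding q_eq using p_gt_1 that by (intro power_strict_increasing) auto
  have d: "d \<le> s" using d_dvd(1) s_pos by (rule dvd_imp_le)
  consider "card (R a b) = p ^ 0" | "card (R a b) = p ^ d" | "(a, b) \<in> Pk 2"
    using radical_cases[OF assms] assms by (auto simp: Pk_iff)
  thus ?thesis
  proof cases
    case 3
    have "d < s"
    proof (rule ccontr)
      assume "\<not> d < s"
      hence "card (Pk 2) = 0" using rank_counts(1) d p_gt_1 by simp
      thus False using 3 by simp
    qed
    hence "2 * d < m" by (simp only: m_eq)
    thus ?thesis using 3 q[of "2 * d"] by (simp add: Pk_iff)
  next
    case 2
    have "d < m" unfolding m_eq using d s_pos by linarith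
    thus ?thesis using 2 q[of d] by simp
  qed (use q[of 0] m_pos in simp)
qed

text \<open>\<open>Pk 0\<close> is split by the sign of S, and \<open>Pk 2\<close> has constant S.
  \<open>Pk 1\<close> stays a sum because its forms have odd or even rank according to the parity of
  d.\<close>

lemma weights_eq:
  fixes w :: real
  defines "Q \<equiv> real p ^ d" and "y \<equiv> real p ^ s" and "Y \<equiv> real p ^ (s - d)"
  shows "real (card {v \<in> code. real (hamming_weight v) = w}) = W q m 1 w
    + Q * (y + 1) * (y\<^sup>2 - 1) / (2 * (Q + 1)) * W 1 s 1 w
    + Q * (y\<^sup>2 - 2 * (Q * Y\<^sup>2) + 1) * (y - 1) / (2 * (Q - 1)) * W 1 s (- 1) w
    + (\<Sum>(a, b)\<in>Pk 1. V a b w)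
    + (y\<^sup>2 - 1) * (Y - 1) / (Q\<^sup>2 - 1) * W (p ^ (2 * d)) (s + d) (- 1) w"
proof -
  have d: "d \<le> s" using d_dvd(1) s_pos by (rule dvd_imp_le)
  have Q: "Q > 1" unfolding Q_def using p_gt_1 d_pos by (simp add: one_less_power)
  have y0: "y > 0" unfolding y_def using p_gt_1 by simp
  have y: "y = Q * Y" unfolding y_def Q_def Y_def using d by (simp add: power_add[symmetric])
  hence Y: "y / Q = Y" using Q by simp
  note counts = rank_counts[folded Q_def y_def, unfolded Y]
  define n2 where "n2 = real (card (Pk 2))"
  have n2: "n2 = (y\<^sup>2 - 1) * (Y - 1) / (Q\<^sup>2 - 1)" unfolding n2_def by (rule counts(1))
  have n0: "real (card (Pk 0)) = y ^ 3 - 1 - (y\<^sup>2 - 1) * Y - n2"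
    using counts(3) unfolding counts(2) n2_def[symmetric] .
  have F: "a \<in> F" if "(a, b) \<in> Pk k" for a b k using that by (simp add: Pk_iff P_iff)
  have "(\<Sum>(a, b)\<in>Pk 0. V a b w) =
      (real (card (Pk 0)) + (y\<^sup>2 * (y - 1) + y * Q * n2) / real p ^ s) / 2 * W 1 s 1 w
      + (real (card (Pk 0)) - (y\<^sup>2 * (y - 1) + y * Q * n2) / real p ^ s) / 2 * W 1 s (- 1) w"
  proof (rule sum_V_even)
    show "q * 1 = p ^ (2 * s)" by (simp add: q_sq power_mult[symmetric] mult.commute)
    show "(\<Sum>(a, b)\<in>Pk 0. S a b) = of_real (y\<^sup>2 * (y - 1) + y * Q * n2)"
      unfolding n2_def by (rule counts(6))
  qed (auto simp: Pk_iff)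
  also have "(y\<^sup>2 * (y - 1) + y * Q * n2) / real p ^ s = y * (y - 1) + Q * n2"
    unfolding y_def[symmetric] using y0 by (simp add: field_simps power2_eq_square)
  finally have 0: "(\<Sum>(a, b)\<in>Pk 0. V a b w) = Q * (y + 1) * (y\<^sup>2 - 1) / (2 * (Q + 1)) * W 1 s 1 w
      + Q * (y\<^sup>2 - 2 * (Q * Y\<^sup>2) + 1) * (y - 1) / (2 * (Q - 1)) * W 1 s (- 1) w"
    unfolding n0 two_sign_counts[OF Q y n2] .
  have "V a b w = W (p ^ (2 * d)) (s + d) (- 1) w" if ab: "(a, b) \<in> Pk 2" for a b
  proof -
    have R: "card (R a b) = p ^ (2 * d)" using ab by (simp add: Pk_iff)
    have "V a b = W (card (R a b)) (s + d) (of_int (- 1))"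
    proof (rule V_even[OF F[OF ab]])
      show "q * card (R a b) = p ^ (2 * (s + d))"
        by (simp add: R q_sq power_mult[symmetric] power_add[symmetric] algebra_simps)
      show "S a b = of_int (- 1 * int p ^ (s + d))" using S_Pk_2[OF ab] by simp
    qed
    thus ?thesis by (simp add: R)
  qed
  hence "(\<Sum>(a, b)\<in>Pk 2. V a b w) = (\<Sum>(a, b)\<in>Pk 2. W (p ^ (2 * d)) (s + d) (- 1) w)"
    by (intro sum.cong) auto
  hence 2: "(\<Sum>(a, b)\<in>Pk 2. V a b w) = n2 * W (p ^ (2 * d)) (s + d) (- 1) w"
    by (simp add: case_prod_beta n2_def)
  have "real (card {v \<in> code. real (hamming_weight v) = w}) = W q m 1 w + (\<Sum>(a, b)\<in>P. V a b w)"
    by (rule card_weight[OF card_R_less])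
  thus ?thesis unfolding sum_P_split 0 2 n2 by (simp only: add_ac)
qed

lemma card_weight_eq_table_count:
  shows "odd d \<Longrightarrow> real (card {v \<in> code. real (hamming_weight v) = w}) = table_count (table_d_odd p m s d) w"
    and "even d \<Longrightarrow> real (card {v \<in> code. real (hamming_weight v) = w}) = table_count (table_d_even p m s d) w"
proof -
  define P Q where "P = real p" and "Q = P ^ d"
  \<comment> \<open>With s = d + t the exponents become sums of multiples of d and t, so the powers
    turn into monomials in Q and Y and truncated subtraction disappears.\<close>
  define t where "t = s - d"
  define Y where "Y = P ^ t"
  define K1 where "K1 = Q * (Q * Y + 1) * (Q\<^sup>2 * Y\<^sup>2 - 1) / (2 * (Q + 1))"
  define K2 where "K2 = Q * (Q\<^sup>2 * Y\<^sup>2 - 2 * (Q * Y\<^sup>2) + 1) * (Q * Y - 1) / (2 * (Q - 1))"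
  define n2 where "n2 = (Q\<^sup>2 * Y\<^sup>2 - 1) * (Y - 1) / (Q\<^sup>2 - 1)"
  \<comment> \<open>The generic weight q - q/p. Apart from 0 and q, every weight is A up to a
    correction term.\<close>
  define A where "A = Q\<^sup>2 * Y\<^sup>2 - Q\<^sup>2 * Y\<^sup>2 / P"
  \<comment> \<open>q p^d is p^(2e) for even d and p^(2e+1) for odd d.\<close>
  define e where "e = s + d div 2"
  have d: "d \<le> s" using d_dvd(1) s_pos by (rule dvd_imp_le)
  have s: "s = d + t" and m: "m = 2 * d + 2 * t" using d m_eq by (simp_all add: t_def)
  have P: "P > 1" "P \<noteq> 0" using p_gt_1 by (auto simp: P_def)
  have Q: "Q > 1" unfolding Q_def using P d_pos by (simp add: one_less_power)
  hence Q2: "Q\<^sup>2 - 1 > 0" by (simp add: one_less_power)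
  have PQ: "P ^ (a * d + b * t) = Q ^ a * Y ^ b" for a b
    by (simp add: Q_def Y_def power_add power_mult mult.commute[of _ d] mult.commute[of _ t])
  have PQ1: "P ^ (a * d + b * t - 1) = Q ^ a * Y ^ b / P" if "a > 0" for a b
    using that d_pos P by (subst power_pred) (simp_all add: PQ)
  have y: "P ^ s = Q * Y" using PQ[of 1 1] by (simp add: s)
  have q: "real q = Q\<^sup>2 * Y\<^sup>2" by (simp add: q_sq y[unfolded P_def] power_mult_distrib)
  have pw: "P ^ (m - 1) = Q\<^sup>2 * Y\<^sup>2 / P" "P ^ (s - 1) = Q * Y / P" "P ^ m = Q\<^sup>2 * Y\<^sup>2"
    "P ^ (m + d) = Q ^ 3 * Y\<^sup>2" "P ^ (m - d) = Q * Y\<^sup>2" "P ^ (3 * s - 2 * d) = Q * Y ^ 3"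
    "P ^ (m - 2 * d) = Y\<^sup>2" "P ^ (2 * d) = Q\<^sup>2" "P ^ (s - d) = Y"
    "P ^ (3 * s - d) = Q\<^sup>2 * Y ^ 3" "P ^ (3 * s - 3 * d) = Y ^ 3" "P ^ (3 * s - 2 * d - 1) = Q * Y ^ 3 / P"
    using PQ1[of 2 2] PQ1[of 1 1] PQ[of 2 2] PQ[of 3 2] PQ[of 1 2] PQ[of 1 3] PQ[of 0 2]
      PQ[of 2 0] PQ[of 0 1] PQ[of 2 3] PQ[of 0 3] PQ1[of 1 3]
    by (simp_all add: s m)
  have pw': "P ^ (s + d - 1) = Q\<^sup>2 * Y / P" "P ^ (s + d) = Q\<^sup>2 * Y"
    using PQ1[of 2 1] PQ[of 2 1] by (simp_all add: s mult_2 add_ac)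
  have n1: "real (card (Pk 1)) = (Q\<^sup>2 * Y\<^sup>2 - 1) * Y"
    using rank_counts(2) Q unfolding P_def[symmetric] Q_def[symmetric] y by (simp add: power_mult_distrib)
  have L: "real (card {v \<in> code. real (hamming_weight v) = w}) = W q m 1 w + K1 * W 1 s 1 w + K2 * W 1 s (- 1) w
      + (\<Sum>(a, b)\<in>Pk 1. V a b w) + n2 * W (p ^ (2 * d)) (s + d) (- 1) w"
    using weights_eq[of w] unfolding P_def[symmetric] Q_def[symmetric] t_def[symmetric] Y_def[symmetric] y
      power_mult_distrib K1_def K2_def n2_def by simp
  define x0 xq xA where "x0 = ind w 0" and "xq = ind w (Q\<^sup>2 * Y\<^sup>2)" and "xA = ind w A"
  define a1 b1 a2 b2 where "a1 = ind w (A - (P - 1) * (Q * Y / P))" and "b1 = ind w (A + Q * Y / P)"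
    and "a2 = ind w (A + (P - 1) * (Q * Y / P))" and "b2 = ind w (A - Q * Y / P)"
  define a3 b3 where "a3 = ind w (A + (P - 1) * (Q\<^sup>2 * Y / P))" and "b3 = ind w (A - Q\<^sup>2 * Y / P)"
  have W1: "W q m 1 w = x0 + (P - 1) * xq + (Q\<^sup>2 * Y\<^sup>2 - 1) * P * xA"
    unfolding W_zero_form P_def[symmetric] q x0_def xq_def xA_def A_def ..
  have Wp: "W 1 s 1 w = Q\<^sup>2 * Y\<^sup>2 * (a1 + (P - 1) * b1)"
    and Wn: "W 1 s (- 1) w = Q\<^sup>2 * Y\<^sup>2 * (a2 + (P - 1) * b2)"
    unfolding W_plus W_minus P_def[symmetric] q y a1_def b1_def a2_def b2_def A_def by simp_all
  have rs: "real (p ^ (2 * d)) = Q\<^sup>2" "real (p ^ d) = Q"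
    using pw(8) by (simp_all add: P_def Q_def)
  have qr: "Q\<^sup>2 * Y\<^sup>2 / Q\<^sup>2 = Y\<^sup>2" "Q\<^sup>2 * Y\<^sup>2 / Q = Q * Y\<^sup>2"
    using Q by (simp_all add: power2_eq_square)
  have W2: "W (p ^ (2 * d)) (s + d) (- 1) w = Y\<^sup>2 * (a3 + (P - 1) * b3) + (Q\<^sup>2 * Y\<^sup>2 - Y\<^sup>2) * P * xA"
    unfolding W_minus rs P_def[symmetric] q qr pw' a3_def b3_def xA_def A_def ..
  have wt: "(P - 1) * (Q\<^sup>2 * Y\<^sup>2 / P - Q * Y / P) = A - (P - 1) * (Q * Y / P)"
    "Q\<^sup>2 * Y\<^sup>2 / P * (P - 1) + Q * Y / P = A + Q * Y / P"
    "(P - 1) * (Q\<^sup>2 * Y\<^sup>2 / P + Q * Y / P) = A + (P - 1) * (Q * Y / P)"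
    "Q\<^sup>2 * Y\<^sup>2 / P * (P - 1) - Q * Y / P = A - Q * Y / P"
    "Q\<^sup>2 * Y / P * (P - 1) * (Y + 1) = A + (P - 1) * (Q\<^sup>2 * Y / P)"
    "Q\<^sup>2 * Y\<^sup>2 / P * (P - 1) - Q\<^sup>2 * Y / P = A - Q\<^sup>2 * Y / P"
    "Q\<^sup>2 * Y\<^sup>2 / P * (P - 1) = A"
    using P by (simp_all add: A_def field_simps power2_eq_square)
  have c1: "Q ^ 3 * Y\<^sup>2 * (Q * Y + 1) * (Q\<^sup>2 * Y\<^sup>2 - 1) / (2 * (Q + 1)) = Q\<^sup>2 * Y\<^sup>2 * K1"
    and c1': "Q ^ 3 * Y\<^sup>2 * (P - 1) * (Q * Y + 1) * (Q\<^sup>2 * Y\<^sup>2 - 1) / (2 * (Q + 1)) = (P - 1) * (Q\<^sup>2 * Y\<^sup>2 * K1)"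
    by (simp_all add: K1_def power2_eq_square power3_eq_cube mult_ac)
  have c2: "Q ^ 3 * Y\<^sup>2 * (Q\<^sup>2 * Y\<^sup>2 - 2 * (Q * Y\<^sup>2) + 1) * (Q * Y - 1) / (2 * (Q - 1)) = Q\<^sup>2 * Y\<^sup>2 * K2"
    and c2': "Q ^ 3 * Y\<^sup>2 * (P - 1) * (Q\<^sup>2 * Y\<^sup>2 - 2 * (Q * Y\<^sup>2) + 1) * (Q * Y - 1) / (2 * (Q - 1)) = (P - 1) * (Q\<^sup>2 * Y\<^sup>2 * K2)"
    by (simp_all add: K2_def power2_eq_square power3_eq_cube mult_ac)
  have c3: "Y\<^sup>2 * (Y - 1) * (Q\<^sup>2 * Y\<^sup>2 - 1) / (Q\<^sup>2 - 1) = Y\<^sup>2 * n2"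
    and c3': "Y\<^sup>2 * (P - 1) * (Y - 1) * (Q\<^sup>2 * Y\<^sup>2 - 1) / (Q\<^sup>2 - 1) = (P - 1) * (Y\<^sup>2 * n2)"
    by (simp_all add: n2_def mult_ac)
  have "(Q\<^sup>2 * Y\<^sup>2 - Y\<^sup>2) * n2 = Y\<^sup>2 * ((Q\<^sup>2 - 1) * n2)" by (simp add: algebra_simps)
  also have "\<dots> = Y\<^sup>2 * ((Q\<^sup>2 * Y\<^sup>2 - 1) * (Y - 1))" using Q2 by (simp add: n2_def)
  finally have n2: "(Q\<^sup>2 * Y\<^sup>2 - Y\<^sup>2) * n2 = Y\<^sup>2 * ((Q\<^sup>2 * Y\<^sup>2 - 1) * (Y - 1))" .
  {
    assume "odd d"
    define H where "H = (P - 1) / 2"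
    define g1 g2 where "g1 = ind w (A - P ^ e)" and "g2 = ind w (A + P ^ e)"
    have V1: "(\<Sum>(a, b)\<in>Pk 1. V a b w) = (Q\<^sup>2 * Y\<^sup>2 - 1) * Y * W_odd (p ^ d) e w"
    proof -
      have "V a b w = W_odd (p ^ d) e w" if ab: "(a, b) \<in> Pk 1" for a b
      proof -
        have "card (R a b) = p ^ d" "a \<in> F" using ab by (auto simp: Pk_iff P_iff)
        moreover have "q * p ^ d = p ^ (2 * e + 1)"
          using \<open>odd d\<close> by (auto simp: q_eq m_eq e_def power_add[symmetric] elim!: oddE)
        ultimately show ?thesis using V_odd[of a b e] by simp
      qed
      hence "(\<Sum>(a, b)\<in>Pk 1. V a b w) = (\<Sum>(a, b)\<in>Pk 1. W_odd (p ^ d) e w)" by (intro sum.cong) auto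
      thus ?thesis using n1 by (simp add: case_prod_beta)
    qed
    have e': "s + (d - 1) div 2 = e" unfolding e_def using \<open>odd d\<close> by presburger
    have Wo: "W_odd (p ^ d) e w = Q * Y\<^sup>2 * (xA + H * g1 + H * g2) + (Q\<^sup>2 * Y\<^sup>2 - Q * Y\<^sup>2) * P * xA"
      unfolding W_odd_ind rs P_def[symmetric] q qr H_def g1_def g2_def xA_def A_def ..
    have half: "1 / 2 * (Q * Y ^ 3) * (P - 1) * (Q\<^sup>2 * Y\<^sup>2 - 1) = (Q\<^sup>2 * Y\<^sup>2 - 1) * Y * (Q * Y\<^sup>2) * H"
      by (simp add: H_def power2_eq_square power3_eq_cube mult_ac)
    \<comment> \<open>The sign (-1)^((p-1)/2) of the table at most exchanges two rows of equal
      multiplicity.\<close>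
    have sgn: "ind w (A + (- 1) ^ k * P ^ e) + ind w (A - (- 1) ^ k * P ^ e) = g1 + g2" for k
      unfolding g1_def g2_def by (cases "even k") simp_all
    \<comment> \<open>Words of generic weight come from the zero form with c nonzero, from the level
      of size q/p of the odd-rank forms, and from c outside \<open>perp\<close> for both nontrivial
      radical orders.\<close>
    have cA: "P * (Q\<^sup>2 * Y ^ 3 - Q * Y ^ 3 + Q * Y ^ 3 / P + Y ^ 3 - Y\<^sup>2 + 1) * (Q\<^sup>2 * Y\<^sup>2 - 1)
        = (Q\<^sup>2 * Y\<^sup>2 - 1) * P + (Q\<^sup>2 * Y\<^sup>2 - 1) * Y * (Q * Y\<^sup>2 + (Q\<^sup>2 * Y\<^sup>2 - Q * Y\<^sup>2) * P)
          + (Q\<^sup>2 * Y\<^sup>2 - Y\<^sup>2) * n2 * P"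
      unfolding n2 using P by (simp add: field_simps power2_eq_square power3_eq_cube)
    have "table_count (table_d_odd p m s d) w =
      1 * x0 + (Q\<^sup>2 * Y\<^sup>2 * K1 * a1 + ((P - 1) * (Q\<^sup>2 * Y\<^sup>2 * K1) * b1 + (Q\<^sup>2 * Y\<^sup>2 * K2 * a2 + ((P - 1) * (Q\<^sup>2 * Y\<^sup>2 * K2) * b2
      + (1 / 2 * (Q * Y ^ 3) * (P - 1) * (Q\<^sup>2 * Y\<^sup>2 - 1) * ind w (A + (- 1) ^ ((p - 1) div 2) * P ^ e)
      + (1 / 2 * (Q * Y ^ 3) * (P - 1) * (Q\<^sup>2 * Y\<^sup>2 - 1) * ind w (A - (- 1) ^ ((p - 1) div 2) * P ^ e)
      + (Y\<^sup>2 * n2 * a3 + ((P - 1) * (Y\<^sup>2 * n2) * b3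
      + (P * (Q\<^sup>2 * Y ^ 3 - Q * Y ^ 3 + Q * Y ^ 3 / P + Y ^ 3 - Y\<^sup>2 + 1) * (Q\<^sup>2 * Y\<^sup>2 - 1) * xA
      + ((P - 1) * xq + 0))))))))))"
      unfolding table_d_odd_def Let_def table_count_Cons table_count_Nil P_def[symmetric] pw pw' y Q_def[symmetric]
        e' c1 c1' c2 c2' c3 c3' wt(1-6)
      unfolding wt(7) x0_def xq_def xA_def a1_def b1_def a2_def b2_def a3_def b3_def ..
    also have "\<dots> = x0 + Q\<^sup>2 * Y\<^sup>2 * K1 * a1 + (P - 1) * (Q\<^sup>2 * Y\<^sup>2 * K1) * b1 + Q\<^sup>2 * Y\<^sup>2 * K2 * a2 + (P - 1) * (Q\<^sup>2 * Y\<^sup>2 * K2) * b2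
      + 1 / 2 * (Q * Y ^ 3) * (P - 1) * (Q\<^sup>2 * Y\<^sup>2 - 1) * (ind w (A + (- 1) ^ ((p - 1) div 2) * P ^ e) + ind w (A - (- 1) ^ ((p - 1) div 2) * P ^ e))
      + Y\<^sup>2 * n2 * a3 + (P - 1) * (Y\<^sup>2 * n2) * b3
      + (P * (Q\<^sup>2 * Y ^ 3 - Q * Y ^ 3 + Q * Y ^ 3 / P + Y ^ 3 - Y\<^sup>2 + 1) * (Q\<^sup>2 * Y\<^sup>2 - 1)) * xA
      + (P - 1) * xq"
      by (simp only: ring_distribs mult_1 add_0_right add.assoc)
    also have "\<dots> = W q m 1 w + K1 * W 1 s 1 w + K2 * W 1 s (- 1) w
        + (Q\<^sup>2 * Y\<^sup>2 - 1) * Y * W_odd (p ^ d) e w + n2 * W (p ^ (2 * d)) (s + d) (- 1) w"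
      unfolding sgn half cA W1 Wp Wn W2 Wo by (simp add: algebra_simps power2_eq_square power3_eq_cube)
    finally show "real (card {v \<in> code. real (hamming_weight v) = w}) = table_count (table_d_odd p m s d) w"
      using L V1 by simp
  }

  {
    assume "even d"
    \<comment> \<open>Half of \<open>Pk 1\<close>: its sum of S is 0, so both signs occur equally
      often.\<close>
    define G where "G = (Q\<^sup>2 * Y\<^sup>2 - 1) * Y / 2"
    define h where "h = P ^ (d div 2)"
    define a4 b4 a5 b5 where "a4 = ind w (A - (P - 1) * (Q * Y * h / P))" and "b4 = ind w (A + Q * Y * h / P)"
      and "a5 = ind w (A + (P - 1) * (Q * Y * h / P))" and "b5 = ind w (A - Q * Y * h / P)"
    have V1: "(\<Sum>(a, b)\<in>Pk 1. V a b w) = G * W (p ^ d) e 1 w + G * W (p ^ d) e (- 1) w"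
    proof -
      have "(\<Sum>(a, b)\<in>Pk 1. V a b w) = (real (card (Pk 1)) + 0 / real p ^ e) / 2 * W (p ^ d) e 1 w
          + (real (card (Pk 1)) - 0 / real p ^ e) / 2 * W (p ^ d) e (- 1) w"
      proof (rule sum_V_even)
        show "q * p ^ d = p ^ (2 * e)"
          using \<open>even d\<close> by (auto simp: q_eq m_eq e_def power_add[symmetric] elim!: evenE)
        show "(\<Sum>(a, b)\<in>Pk 1. S a b) = of_real 0" by (rule rank_counts(5))
      qed (auto simp: Pk_iff)
      thus ?thesis using n1 by (simp add: G_def)
    qed
    have h: "h * h = Q" unfolding h_def Q_def power_add[symmetric] using \<open>even d\<close> by (auto simp: mult_2 elim!: evenE)
    have pe: "P ^ e = Q * Y * h" unfolding e_def power_add y h_def ..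
    have "s + d div 2 > 0" using s_pos by simp
    hence pe1: "P ^ (s + d div 2 - 1) = Q * Y * h / P" using power_pred[of "s + d div 2" P] P pe[unfolded e_def] by simp
    have "s - d div 2 = t + d div 2" using \<open>even d\<close> by (auto simp: s elim!: evenE)
    hence ph: "P ^ (s - d div 2) = Y * h" "P ^ (s - d div 2 + 1) = Y * h * P"
      by (simp_all add: power_add h_def Y_def)
    have ps: "P ^ (s + 1) = Q * Y * P" "P ^ (s - d + 1) = Y * P"
      using y pw(9) by simp_all
    have Wa: "W (p ^ d) e 1 w = Q * Y\<^sup>2 * (a4 + (P - 1) * b4) + (Q\<^sup>2 * Y\<^sup>2 - Q * Y\<^sup>2) * P * xA"
      and Wb: "W (p ^ d) e (- 1) w = Q * Y\<^sup>2 * (a5 + (P - 1) * b5) + (Q\<^sup>2 * Y\<^sup>2 - Q * Y\<^sup>2) * P * xA"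
      unfolding W_plus W_minus rs P_def[symmetric] q qr pe a4_def b4_def a5_def b5_def xA_def A_def by (rule refl)+
    have hh: "Q * Y * h / P * (Y * h) = Q\<^sup>2 * Y\<^sup>2 / P"
      by (simp add: h[symmetric] power2_eq_square mult_ac)
    have wt': "Q * Y / P * (P - 1) * (Q * Y - 1) = A - (P - 1) * (Q * Y / P)"
      "Q * Y / P * (Q * Y * P - Q * Y + 1) = A + Q * Y / P"
      "Q * Y / P * (P - 1) * (Q * Y + 1) = A + (P - 1) * (Q * Y / P)"
      "Q * Y / P * (Q * Y * P - Q * Y - 1) = A - Q * Y / P"
      "Q\<^sup>2 * Y / P * (Y * P - Y - 1) = A - Q\<^sup>2 * Y / P"
      using P by (simp_all add: A_def field_simps power2_eq_square)
    have PA: "(P - 1) * (Q\<^sup>2 * Y\<^sup>2 / P) = A" using P by (simp add: A_def field_simps)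
    have wh: "Q * Y * h / P * (P - 1) * (Y * h + 1) = A + (P - 1) * (Q * Y * h / P)"
      "Q * Y * h / P * (P - 1) * (Y * h - 1) = A - (P - 1) * (Q * Y * h / P)"
      "Q * Y * h / P * (Y * h * P - Y * h + 1) = A + Q * Y * h / P"
      "Q * Y * h / P * (Y * h * P - Y * h - 1) = A - Q * Y * h / P"
      by (simp_all only: weight_expansions hh PA)
    \<comment> \<open>For even d no form of \<open>Pk 1\<close> has a level of size q/p, so compared
      with odd d that contribution is missing.\<close>
    have cA: "P * (Q\<^sup>2 * Y ^ 3 - Q * Y ^ 3 + Y ^ 3 - Y\<^sup>2 + 1) * (Q\<^sup>2 * Y\<^sup>2 - 1)
        = (Q\<^sup>2 * Y\<^sup>2 - 1) * P + 2 * G * ((Q\<^sup>2 * Y\<^sup>2 - Q * Y\<^sup>2) * P)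
          + (Q\<^sup>2 * Y\<^sup>2 - Y\<^sup>2) * n2 * P"
      unfolding n2 by (simp add: G_def) (simp add: algebra_simps power2_eq_square power3_eq_cube)
    have half: "1 / 2 * (Q * Y ^ 3) * (Q\<^sup>2 * Y\<^sup>2 - 1) = Q * Y\<^sup>2 * G"
      "1 / 2 * (Q * Y ^ 3) * (P - 1) * (Q\<^sup>2 * Y\<^sup>2 - 1) = (P - 1) * (Q * Y\<^sup>2 * G)"
      by (simp_all add: G_def power2_eq_square power3_eq_cube mult_ac)
    have "table_count (table_d_even p m s d) w =
      1 * x0 + (Q\<^sup>2 * Y\<^sup>2 * K1 * a1 + ((P - 1) * (Q\<^sup>2 * Y\<^sup>2 * K1) * b1 + (Q\<^sup>2 * Y\<^sup>2 * K2 * a2 + ((P - 1) * (Q\<^sup>2 * Y\<^sup>2 * K2) * b2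
      + (1 / 2 * (Q * Y ^ 3) * (Q\<^sup>2 * Y\<^sup>2 - 1) * a5
      + (1 / 2 * (Q * Y ^ 3) * (Q\<^sup>2 * Y\<^sup>2 - 1) * a4
      + (1 / 2 * (Q * Y ^ 3) * (P - 1) * (Q\<^sup>2 * Y\<^sup>2 - 1) * b4
      + (1 / 2 * (Q * Y ^ 3) * (P - 1) * (Q\<^sup>2 * Y\<^sup>2 - 1) * b5
      + (Y\<^sup>2 * n2 * a3 + ((P - 1) * (Y\<^sup>2 * n2) * b3
      + (P * (Q\<^sup>2 * Y ^ 3 - Q * Y ^ 3 + Y ^ 3 - Y\<^sup>2 + 1) * (Q\<^sup>2 * Y\<^sup>2 - 1) * xA
      + ((P - 1) * xq + 0))))))))))))"
      unfolding table_d_even_def Let_def table_count_Cons table_count_Nil P_def[symmetric] pe1 ph ps pw pw' y Q_def[symmetric]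
        c1 c1' c2 c2' c3 c3' wt(5) wt' wh
      unfolding wt(7) x0_def xq_def xA_def a1_def b1_def a2_def b2_def a3_def b3_def a4_def b4_def a5_def b5_def ..
    also have "\<dots> = W q m 1 w + K1 * W 1 s 1 w + K2 * W 1 s (- 1) w
        + (G * W (p ^ d) e 1 w + G * W (p ^ d) e (- 1) w)
        + n2 * W (p ^ (2 * d)) (s + d) (- 1) w"
      unfolding half cA W1 Wp Wn W2 Wa Wb by (simp add: algebra_simps power2_eq_square power3_eq_cube)
    finally show "real (card {v \<in> code. real (hamming_weight v) = w}) = table_count (table_d_even p m s d) w"
      using L V1 by simp
  }
qed

end

section \<open>The table for d' = 2d\<close>

lemma two_d_counts:
  fixes Q Z n0 n1 n2 :: real
  assumes Q: "Q > 1" and y: "y = Q ^ 3 * Z"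
    and n2: "n2 = (y\<^sup>2 - 1) * (Q\<^sup>2 * Z - 1) / ((Q\<^sup>2 - 1) * (Q + 1))"
    and n1: "(Q + 1) * n1 = (y\<^sup>2 - 1) * (y + 1) + (Q\<^sup>2 - 1) * n2"
    and n0: "n0 = y ^ 3 - 1 - n1 - n2"
  shows "n1 = Q * (Q ^ 3 * Z + Q\<^sup>2 * Z + Q * Z + 1) * (y\<^sup>2 - 1) / (Q + 1)\<^sup>2"
    and "n0 = Q ^ 3 * (y\<^sup>2 - Q ^ 4 * Z\<^sup>2 - Q ^ 3 * Z\<^sup>2 + y - Q\<^sup>2 * Z + 1) * (y - 1) / ((Q + 1) * (Q\<^sup>2 - 1))"
proof -
  have "Q * Q > 1 * 1" using Q by (intro mult_strict_mono) auto
  hence Q2: "Q\<^sup>2 - 1 \<noteq> 0" by (simp add: power2_eq_square)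
  have Q1: "Q + 1 \<noteq> 0" using Q by simp
  have n2': "(Q\<^sup>2 - 1) * (Q + 1) * n2 = (y\<^sup>2 - 1) * (Q\<^sup>2 * Z - 1)"
    unfolding n2 using Q1 Q2 by simp
  \<comment> \<open>The multiplier (Q + 1)^2 brings in (Q + 1) n1 and (Q^2 - 1)(Q + 1) n2, whose
    values are polynomials; only at the end is it divided out.\<close>
  have "n1 * (Q + 1)\<^sup>2 = (Q + 1) * ((Q + 1) * n1)" by (simp add: power2_eq_square mult_ac)
  also have "\<dots> = (Q + 1) * ((y\<^sup>2 - 1) * (y + 1)) + (Q\<^sup>2 - 1) * (Q + 1) * n2"
    unfolding n1 by (simp add: algebra_simps)
  also have "\<dots> = Q * (Q ^ 3 * Z + Q\<^sup>2 * Z + Q * Z + 1) * (y\<^sup>2 - 1)"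
    unfolding n2' y by (simp add: algebra_simps power2_eq_square power3_eq_cube)
  finally have n1': "n1 * (Q + 1)\<^sup>2 = Q * (Q ^ 3 * Z + Q\<^sup>2 * Z + Q * Z + 1) * (y\<^sup>2 - 1)" .
  thus "n1 = Q * (Q ^ 3 * Z + Q\<^sup>2 * Z + Q * Z + 1) * (y\<^sup>2 - 1) / (Q + 1)\<^sup>2"
    using Q1 by (subst nonzero_eq_divide_eq) simp_all
  have "n0 * ((Q + 1) * (Q\<^sup>2 - 1)) = (y ^ 3 - 1) * ((Q + 1) * (Q\<^sup>2 - 1)) - (Q - 1) * (n1 * (Q + 1)\<^sup>2) - (Q\<^sup>2 - 1) * (Q + 1) * n2"
    unfolding n0 by (simp add: algebra_simps power2_eq_square)
  also have "\<dots> = Q ^ 3 * (y\<^sup>2 - Q ^ 4 * Z\<^sup>2 - Q ^ 3 * Z\<^sup>2 + y - Q\<^sup>2 * Z + 1) * (y - 1)"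
    unfolding n1' n2' y by (simp add: algebra_simps power2_eq_square power3_eq_cube power4_eq_xxxx)
  finally show "n0 = Q ^ 3 * (y\<^sup>2 - Q ^ 4 * Z\<^sup>2 - Q ^ 3 * Z\<^sup>2 + y - Q\<^sup>2 * Z + 1) * (y - 1) / ((Q + 1) * (Q\<^sup>2 - 1))"
    using Q1 Q2 by (subst nonzero_eq_divide_eq) simp_all
qed

context kasami_two
begin

lemma card_weight_eq_table_count:
  "real (card {v \<in> code. real (hamming_weight v) = w}) = table_count (table_2d p m s d) w"
proof -
  define P Q where "P = real p" and "Q = P ^ d"
  \<comment> \<open>3d is at most s here, so the powers in the table become monomials in Q and Z =
    p^t.\<close>
  define t where "t = s - 3 * d"
  define Z where "Z = P ^ t"
  define y where "y = Q ^ 3 * Z"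
  define n where "n k = real (card (Pk k))" for k
  define A where "A = y\<^sup>2 - y\<^sup>2 / P"
  have s: "s = 3 * d + t" using three_d_le by (simp add: t_def)
  have m: "m = 6 * d + 2 * t" using m_eq s by simp
  have P: "P > 1" "P \<noteq> 0" using p_gt_1 by (auto simp: P_def)
  have Q: "Q > 1" unfolding Q_def using P d_pos by (simp add: one_less_power)
  have PQ: "P ^ (a * d + b * t) = Q ^ a * Z ^ b" for a b
    by (simp add: Q_def Z_def power_add power_mult mult.commute[of _ d] mult.commute[of _ t])
  have PQ1: "P ^ (a * d + b * t - 1) = Q ^ a * Z ^ b / P" if "a > 0" for a b
    using that d_pos P by (subst power_pred) (simp_all add: PQ)
  have ps: "P ^ s = y" using PQ[of 3 1] by (simp add: s y_def)
  have q: "real q = y\<^sup>2" by (simp add: q_sq ps[unfolded P_def])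
  have ysq: "y\<^sup>2 = Q ^ 6 * Z\<^sup>2" unfolding y_def power_mult_distrib by (simp flip: power_mult)
  have pw: "P ^ (m - 1) = y\<^sup>2 / P" "P ^ (s - 1) = y / P" "P ^ m = y\<^sup>2"
    "P ^ (m + 3 * d) = y\<^sup>2 * Q ^ 3" "P ^ (m - 2 * d) = Q ^ 4 * Z\<^sup>2" "P ^ (m - 3 * d) = Q ^ 3 * Z\<^sup>2"
    "P ^ (s - d) = Q\<^sup>2 * Z" "P ^ (2 * d) = Q\<^sup>2" "P ^ (m - d) = Q ^ 5 * Z\<^sup>2" "P ^ (s - 2 * d) = Q * Z"
    "P ^ (m - 4 * d) = Q\<^sup>2 * Z\<^sup>2" "P ^ (3 * s - d) = Q ^ 8 * Z ^ 3" "P ^ (3 * s - 2 * d) = Q ^ 7 * Z ^ 3"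
    "P ^ (3 * s - 3 * d) = Q ^ 6 * Z ^ 3" "P ^ (3 * s - 4 * d) = Q ^ 5 * Z ^ 3" "P ^ (3 * s - 5 * d) = Q ^ 4 * Z ^ 3"
    using PQ1[of 6 2] PQ1[of 3 1] PQ[of 6 2] PQ[of 9 2] PQ[of 4 2] PQ[of 3 2] PQ[of 2 1] PQ[of 2 0] PQ[of 5 2]
      PQ[of 1 1] PQ[of 2 2] PQ[of 8 3] PQ[of 7 3] PQ[of 6 3] PQ[of 5 3] PQ[of 4 3]
    by (simp_all add: s m ysq y_def[symmetric])
  have "s + d = 4 * d + 1 * t" "s + 2 * d = 5 * d + 1 * t" by (simp_all add: s)
  hence pw': "P ^ (s + d - 1) = y * Q / P" "P ^ (s + d) = y * Q" "P ^ (s + 2 * d - 1) = y * Q\<^sup>2 / P"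
      "P ^ (s + 2 * d) = y * Q\<^sup>2"
    using PQ1[of 4 1] PQ[of 4 1] PQ1[of 5 1] PQ[of 5 1]
    by (simp_all add: y_def power2_eq_square power3_eq_cube power_numeral_reduce mult_ac)
  have p1: "P ^ (s - d + 1) = Q\<^sup>2 * Z * P" "P ^ (s - 2 * d + 1) = Q * Z * P" "P ^ (s + 1) = y * P"
    using pw(7) pw(10) ps by simp_all
  have yQ: "y / Q = Q\<^sup>2 * Z" using Q by (simp add: y_def power2_eq_square power3_eq_cube)
  note counts = rank_counts[folded P_def, folded Q_def, unfolded ps yQ, folded n_def]
  note n01 = two_d_counts[OF Q y_def counts]
  have L: "real (card {v \<in> code. real (hamming_weight v) = w}) = W q m 1 w
      + (n 0 * W 1 s (- 1) w + n 1 * W (p ^ (2 * d)) (s + d) 1 w + n 2 * W (p ^ (4 * d)) (s + 2 * d) (- 1) w)"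
    using card_weight[OF card_R_less, of w] sum_V_Pk[where k = 0 and w = w] sum_V_Pk[where k = 1 and w = w] sum_V_Pk[where k = 2 and w = w]
    unfolding sum_P_split by (simp add: n_def)
  define x0 xq xA where "x0 = ind w 0" and "xq = ind w (y\<^sup>2)" and "xA = ind w A"
  define a1 b1 a2 b2 a3 b3 where "a1 = ind w (A + (P - 1) * (y / P))" and "b1 = ind w (A - y / P)"
    and "a2 = ind w (A - (P - 1) * (y * Q / P))" and "b2 = ind w (A + y * Q / P)"
    and "a3 = ind w (A + (P - 1) * (y * Q\<^sup>2 / P))" and "b3 = ind w (A - y * Q\<^sup>2 / P)"
  have W0: "W q m 1 w = x0 + (P - 1) * xq + (y\<^sup>2 - 1) * P * xA"
    unfolding W_zero_form P_def[symmetric] q x0_def xq_def xA_def A_def ..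
  have W1: "W 1 s (- 1) w = y\<^sup>2 * (a1 + (P - 1) * b1)"
    unfolding W_minus P_def[symmetric] q ps a1_def b1_def A_def by simp
  have rs: "real (p ^ (2 * d)) = Q\<^sup>2" "real (p ^ (4 * d)) = Q ^ 4"
    using pw(8) PQ[of 4 0] by (simp_all add: P_def Q_def)
  have qr: "y\<^sup>2 / Q\<^sup>2 = Q ^ 4 * Z\<^sup>2" "y\<^sup>2 / Q ^ 4 = Q\<^sup>2 * Z\<^sup>2"
    unfolding ysq using Q by (simp_all add: power_numeral_reduce)
  have W2: "W (p ^ (2 * d)) (s + d) 1 w = Q ^ 4 * Z\<^sup>2 * (a2 + (P - 1) * b2) + (y\<^sup>2 - Q ^ 4 * Z\<^sup>2) * P * xA"
    unfolding W_plus rs P_def[symmetric] q qr pw' a2_def b2_def xA_def A_def ..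
  have W3: "W (p ^ (4 * d)) (s + 2 * d) (- 1) w = Q\<^sup>2 * Z\<^sup>2 * (a3 + (P - 1) * b3) + (y\<^sup>2 - Q\<^sup>2 * Z\<^sup>2) * P * xA"
    unfolding W_minus rs P_def[symmetric] q qr pw' a3_def b3_def xA_def A_def ..
  have yy: "y * Q / P * (Q\<^sup>2 * Z) = y\<^sup>2 / P" "y * Q\<^sup>2 / P * (Q * Z) = y\<^sup>2 / P"
    by (simp_all add: y_def power2_eq_square power3_eq_cube mult_ac)
  have A: "(P - 1) * (y\<^sup>2 / P) = A" using P by (simp add: A_def field_simps)
  have wt: "y / P * (P - 1) * (y + 1) = A + (P - 1) * (y / P)"
    "y / P * (y * P - y - 1) = A - y / P"
    using P by (simp_all add: A_def field_simps power2_eq_square)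
  have wt': "y * Q / P * (P - 1) * (Q\<^sup>2 * Z - 1) = A - (P - 1) * (y * Q / P)"
    "y * Q / P * (Q\<^sup>2 * Z * P - Q\<^sup>2 * Z + 1) = A + y * Q / P"
    "y * Q\<^sup>2 / P * (P - 1) * (Q * Z + 1) = A + (P - 1) * (y * Q\<^sup>2 / P)"
    "y * Q\<^sup>2 / P * (Q * Z * P - Q * Z - 1) = A - y * Q\<^sup>2 / P"
    by (simp_all only: weight_expansions yy A)
  have wA: "y\<^sup>2 / P * (P - 1) = A" using A by (simp only: mult.commute)
  have c0: "y\<^sup>2 * Q ^ 3 * (y\<^sup>2 - Q ^ 4 * Z\<^sup>2 - Q ^ 3 * Z\<^sup>2 + y - Q\<^sup>2 * Z + 1) * (y - 1) / ((Q + 1) * (Q\<^sup>2 - 1)) = y\<^sup>2 * n 0"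
    and c0': "y\<^sup>2 * Q ^ 3 * (P - 1) * (y\<^sup>2 - Q ^ 4 * Z\<^sup>2 - Q ^ 3 * Z\<^sup>2 + y - Q\<^sup>2 * Z + 1) * (y - 1) / ((Q + 1) * (Q\<^sup>2 - 1)) = (P - 1) * (y\<^sup>2 * n 0)"
    by (simp_all add: n01(2) mult_ac)
  have c1: "Q ^ 5 * Z\<^sup>2 * (y + Q\<^sup>2 * Z + Q * Z + 1) * (y\<^sup>2 - 1) / (Q + 1)\<^sup>2 = Q ^ 4 * Z\<^sup>2 * n 1"
    and c1': "Q ^ 5 * Z\<^sup>2 * (P - 1) * (y + Q\<^sup>2 * Z + Q * Z + 1) * (y\<^sup>2 - 1) / (Q + 1)\<^sup>2 = (P - 1) * (Q ^ 4 * Z\<^sup>2 * n 1)"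
    unfolding n01(1) y_def[symmetric] by (simp_all add: power_numeral_reduce mult_ac)
  have c2: "Q\<^sup>2 * Z\<^sup>2 * (Q\<^sup>2 * Z - 1) * (y\<^sup>2 - 1) / ((Q + 1) * (Q\<^sup>2 - 1)) = Q\<^sup>2 * Z\<^sup>2 * n 2"
    and c2': "Q\<^sup>2 * Z\<^sup>2 * (P - 1) * (Q\<^sup>2 * Z - 1) * (y\<^sup>2 - 1) / ((Q + 1) * (Q\<^sup>2 - 1)) = (P - 1) * (Q\<^sup>2 * Z\<^sup>2 * n 2)"
    by (simp_all add: counts(1) mult_ac)
  have nz: "(Q\<^sup>2 - 1) * (Q + 1) \<noteq> 0" using Q by (simp add: power2_eq_1_iff)
  have n2: "(Q\<^sup>2 - 1) * (Q + 1) * n 2 = (y\<^sup>2 - 1) * (Q\<^sup>2 * Z - 1)"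
    unfolding counts(1) using nz by simp
  \<comment> \<open>The words of generic weight from nonzero pairs, up to the factor p. Grouping by
    (Q + 1) n 1 first makes the remaining terms in n 2 combine to Q^3 + 1 = (Q + 1)(Q^2 - Q + 1), so
    all denominators cancel.\<close>
  have "(y\<^sup>2 - Q ^ 4 * Z\<^sup>2) * n 1 + (y\<^sup>2 - Q\<^sup>2 * Z\<^sup>2) * n 2
      = Q ^ 4 * Z\<^sup>2 * (Q - 1) * ((Q + 1) * n 1) + Q\<^sup>2 * Z\<^sup>2 * ((Q\<^sup>2 - 1) * (Q\<^sup>2 + 1) * n 2)"
    unfolding ysq by (simp add: algebra_simps power_numeral_reduce)
  also have "\<dots> = Q ^ 4 * Z\<^sup>2 * (Q - 1) * ((y\<^sup>2 - 1) * (y + 1)) + Q\<^sup>2 * Z\<^sup>2 * (Q\<^sup>2 - Q + 1) * ((Q\<^sup>2 - 1) * (Q + 1) * n 2)"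
    unfolding counts(2) by (simp add: algebra_simps power_numeral_reduce)
  also have "\<dots> = (Q ^ 8 * Z ^ 3 - Q ^ 7 * Z ^ 3 + Q ^ 6 * Z ^ 3 - Q ^ 5 * Z ^ 3 + Q ^ 4 * Z ^ 3
      + Q ^ 5 * Z\<^sup>2 - 2 * (Q ^ 4 * Z\<^sup>2) + Q ^ 3 * Z\<^sup>2 - Q\<^sup>2 * Z\<^sup>2) * (y\<^sup>2 - 1)"
    unfolding n2 by (simp add: y_def algebra_simps power_numeral_reduce)
  finally have n12: "(y\<^sup>2 - Q ^ 4 * Z\<^sup>2) * n 1 + (y\<^sup>2 - Q\<^sup>2 * Z\<^sup>2) * n 2 = \<dots>" .
  have cA: "P * (Q ^ 8 * Z ^ 3 - Q ^ 7 * Z ^ 3 + Q ^ 6 * Z ^ 3 - Q ^ 5 * Z ^ 3 + Q ^ 4 * Z ^ 3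
      + Q ^ 5 * Z\<^sup>2 - 2 * (Q ^ 4 * Z\<^sup>2) + Q ^ 3 * Z\<^sup>2 - Q\<^sup>2 * Z\<^sup>2 + 1) * (y\<^sup>2 - 1)
      = P * (y\<^sup>2 - 1) + P * ((y\<^sup>2 - Q ^ 4 * Z\<^sup>2) * n 1 + (y\<^sup>2 - Q\<^sup>2 * Z\<^sup>2) * n 2)"
    unfolding n12 by (simp only: ring_distribs mult_1 mult.assoc add_ac)
  have "table_count (table_2d p m s d) w =
    1 * x0 + (y\<^sup>2 * n 0 * a1 + ((P - 1) * (y\<^sup>2 * n 0) * b1 + (Q ^ 4 * Z\<^sup>2 * n 1 * a2 + ((P - 1) * (Q ^ 4 * Z\<^sup>2 * n 1) * b2
    + (Q\<^sup>2 * Z\<^sup>2 * n 2 * a3 + ((P - 1) * (Q\<^sup>2 * Z\<^sup>2 * n 2) * b3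
    + (P * (Q ^ 8 * Z ^ 3 - Q ^ 7 * Z ^ 3 + Q ^ 6 * Z ^ 3 - Q ^ 5 * Z ^ 3 + Q ^ 4 * Z ^ 3
        + Q ^ 5 * Z\<^sup>2 - 2 * (Q ^ 4 * Z\<^sup>2) + Q ^ 3 * Z\<^sup>2 - Q\<^sup>2 * Z\<^sup>2 + 1) * (y\<^sup>2 - 1) * xA
    + ((P - 1) * xq + 0))))))))"
    unfolding table_2d_def Let_def table_count_Cons table_count_Nil P_def[symmetric] p1 pw pw' ps Q_def[symmetric]
      c0 c0' c1 c1' c2 c2' wt wt'
    unfolding wA x0_def xq_def xA_def a1_def b1_def a2_def b2_def a3_def b3_def ..
  also have "\<dots> = W q m 1 w
      + (n 0 * W 1 s (- 1) w + n 1 * W (p ^ (2 * d)) (s + d) 1 w + n 2 * W (p ^ (4 * d)) (s + 2 * d) (- 1) w)"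
    unfolding cA W0 W1 W2 W3 by (simp add: algebra_simps)
  finally show ?thesis using L by simp
qed

end

theorem theorem7:
  fixes p m s l q d d' :: nat
    and C :: "('p::prime_card mod_ring ^ 'a::{field,finite}) set"
  assumes "p = CARD('p)" and "odd p"
    and "0 < s" and "m = 2 * s" and "l \<noteq> s" and "l \<le> m - 1"
    and "q = p ^ m" and "CARD('a) = q"
    and "d = gcd s l" and "d' = gcd (s + l) (2 * l)"
    and "C = kasami_code s l"
    and "m \<ge> 4"
  shows "code_length C = p ^ m \<and> vec.subspace C \<and> vec.dim C = 5 * m div 2 + 1 \<and>
    (d' = d \<and> odd d \<longrightarrow> has_weight_distribution C (table_d_odd p m s d)) \<and>
    (d' = d \<and> even d \<longrightarrow> has_weight_distribution C (table_d_even p m s d)) \<and>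
    (d' = 2 * d \<longrightarrow> has_weight_distribution C (table_2d p m s d))"
proof -
  interpret kasami m p q "TYPE('p)" "TYPE('a)" s l d
    using assms by unfold_locales auto
  have C: "C = code" unfolding code_def by fact
  \<comment> \<open>Modulo a divisor of s + l, 2 l is the negative of 2 s; this rewrites d' as the
    order of the fixed field of \<open>fr (s + l)\<close>, in exponents of p.\<close>
  have iff: "x dvd 2 * l \<longleftrightarrow> x dvd 2 * s" if "x dvd s + l" for x
  proof -
    have "x dvd 2 * s + 2 * l" using that by (metis distrib_left dvd_mult)
    thus ?thesis by (metis dvd_add_right_iff dvd_add_left_iff)
  qed
  have d': "d' = gcd (s + l) m"
    unfolding assms(10) \<open>m = 2 * s\<close>
  proof (rule dvd_antisym)
    show "gcd (s + l) (2 * l) dvd gcd (s + l) (2 * s)"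
      using iff[of "gcd (s + l) (2 * l)"] by simp
    show "gcd (s + l) (2 * s) dvd gcd (s + l) (2 * l)"
      using iff[of "gcd (s + l) (2 * s)"] by simp
  qed
  have length: "code_length C = p ^ m" unfolding code_length_def using assms by simp
  \<comment> \<open>d divides d', and d' divides both 2 s and 2 l, hence 2 d.\<close>
  have cases: "d' = d \<or> d' = 2 * d"
  proof -
    have "d dvd d'" unfolding assms(10) using d_dvd by simp
    then obtain k where k: "d' = d * k" by auto
    have "d' dvd 2 * s" unfolding d' m_eq by simp
    moreover have "d' dvd 2 * l" unfolding assms(10) by simp
    ultimately have "d' dvd gcd (2 * s) (2 * l)" by simp
    hence "d' dvd 2 * d" by (simp only: d_eq gcd_mult_distrib_nat)
    hence "d * k dvd d * 2" by (simp only: k mult.commute)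
    hence "k dvd 2" using d_pos by (simp only: nat_mult_dvd_cancel1)
    hence "k = 1 \<or> k = 2" using prime_nat_iff[of 2] two_is_prime_nat by blast
    thus ?thesis using k by auto
  qed
  have dim: "vec.dim C = 5 * m div 2 + 1"
    if "\<And>a b. (a, b) \<in> P \<Longrightarrow> card (R a b) < q"
    using dim_code[OF that] \<open>m = 2 * s\<close> C by simp
  show ?thesis
  proof (cases "d' = d")
    case True
    then interpret kasami_eq m p q "TYPE('p)" "TYPE('a)" s l d by unfold_locales (simp add: d')
    have "d' \<noteq> 2 * d" using True d_pos by simp
    moreover have "odd d \<Longrightarrow> has_weight_distribution C (table_d_odd p m s d)"
      "even d \<Longrightarrow> has_weight_distribution C (table_d_even p m s d)"
      unfolding C by (intro has_weight_distributionI card_weight_eq_table_count; assumption)+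
    ultimately show ?thesis using length dim[OF card_R_less] subspace_code C by simp
  next
    case False
    hence two: "d' = 2 * d" using cases by simp
    then interpret kasami_two m p q "TYPE('p)" "TYPE('a)" s l d by unfold_locales (simp add: d')
    have "has_weight_distribution C (table_2d p m s d)"
      unfolding C by (intro has_weight_distributionI card_weight_eq_table_count)
    thus ?thesis using False length dim[OF card_R_less] subspace_code C by simp
  qed
qed

end
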